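(* Let $n\ge1$ and $p\in\{0,1,2,\dots\}\cup\{+\infty\}$. Let $\Omega_1,\dots,\Omega_n\subseteq\mathbb{C}$ be Jordan domains, $\Omega=\Omega_1\times\cdots\times\Omega_n$, let $\phi_i:\overline{D}\to\overline{\Omega_i}$ be the homeomorphic extensions of Riemann mappings $D\to\Omega_i$, $\gamma_i=\phi_i|_{\mathbb{T}}$, $\gamma=\gamma_1\times\cdots\times\gamma_n:\mathbb{T}^n\to\partial\Omega_1\times\cdots\times\partial\Omega_n$ and $\phi=\phi_1\times\cdots\times\phi_n:\overline{D}^n\to\overline{\Omega}$. Suppose $\gamma$ is $C^p$ smooth. Then: 1. The set of functions in $C^p(\gamma)$ that are holomorphically extendable from one side in the separately continuous sense at no point of $\gamma(\mathbb{T}^n)$ is a dense $G_\delta$ subset of $C^p(\gamma)$. 2. The set of functions in $C^p(\gamma)$ that are holomorphically extendable from one side (in the usual sense) at no point of $\gamma(\mathbb{T}^n)$ is residual in $C^p(\gamma)$, i.e. it contains a dense $G_\delta$ subset. 3. If $\phi$ and $\phi^{-1}$ are Lipschitz continuous, the set of functions in $C^p(\gamma)$ that are holomorphically extendable from one side in the Lipschitz continuous sense at no point of $\gamma(\mathbb{T}^n)$ is a dense $G_\delta$ subset of $C^p(\gamma)$.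
   Context: $D$ is the open unit disc and $\mathbb{T}$ the unit circle in $\mathbb{C}$; $B(\zeta,r)$ is the open Euclidean ball in $\mathbb{C}^n$ with center $\zeta$ and radius $r$. By the Carathéodory–Osgood theorem a Riemann mapping $D\to\Omega_i$ onto a Jordan domain extends to a homeomorphism $\overline{D}\to\overline{\Omega_i}$. $C^p(\mathbb{T}^n)$ is the space of functions $g:\mathbb{T}^n\to\mathbb{C}$ whose derivatives $\frac{\partial^{\alpha}g}{\partial\theta^{\alpha}}(e^{i\theta_1},\dots,e^{i\theta_n})$ with respect to $\theta_1,\dots,\theta_n$ exist and are continuous on $\mathbb{T}^n$ for all multi-indices $\alpha\in\mathbb{N}^n$ with $|\alpha|\le p$ (all $\alpha$ if $p=+\infty$). "$\gamma$ is $C^p$ smooth" means every $\gamma_i\in C^p(\mathbb{T})$. $C^p(\gamma)$ is the space of functions $f:\gamma(\mathbb{T}^n)\to\mathbb{C}$ such that $f\circ\gamma\in C^p(\mathbb{T}^n)$, with the topology given by the seminorms $|f|_\alpha=\sup_{\theta_i\in\mathbb{R}}\left|\frac{\partial^{\alpha}(f\circ\gamma)}{\partial\theta^{\alpha}}(e^{i\theta_1},\dots,e^{i\theta_n})\right|$, $|\alpha|\le p$. A continuous function $f:\gamma(\mathbb{T}^n)\to\mathbb{C}$ is holomorphically extendable from one side (usual sense) at a point $\zeta\in\gamma(\mathbb{T}^n)$ if there are a radius $r>0$ and a continuous function $F:[B(\zeta,r)\cap\Omega]\cup\gamma(\mathbb{T}^n)\to\mathbb{C}$ that is holomorphic on $B(\zeta,r)\cap\Omega$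 and agrees with $f$ on $\gamma(\mathbb{T}^n)$. In the separately continuous sense, the continuity of $F$ is relaxed to: $F$ is bounded and separately continuous in its variables, i.e. continuous in each complex variable when the other variables are fixed. In the Lipschitz continuous sense, the continuity of $F$ is strengthened to Lipschitz continuity of $F$.
   Formalization: In part 1, F is taken bounded and separately continuous on [B(ζ,r)∩closure of Ω]∪γ(T^n) instead of [B(ζ,r)∩Ω]∪γ(T^n); with the latter, for n≥2, setting F=0 on B(ζ,r)∩Ω extends every f, so the set would be empty. For n=1 the two agree. *)

theory Defs
  imports "HOL-Analysis.Analysis"
begin

definition jordan_domain :: "complex set \<Rightarrow> bool" where
  "jordan_domain U \<longleftrightarrow>
     (\<exists>c. simple_path c \<and> pathfinish c = pathstart c \<and> U = inside (path_image c))"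

definition extended_riemann_map :: "(complex \<Rightarrow> complex) \<Rightarrow> complex set \<Rightarrow> bool" where
  "extended_riemann_map h U \<longleftrightarrow>
     h holomorphic_on ball 0 1 \<and> bij_betw h (ball 0 1) U \<and>
     (\<exists>k. homeomorphism (cball 0 1) (closure U) h k)"

definition set_product :: "('n \<Rightarrow> complex set) \<Rightarrow> (complex^'n) set" where
  "set_product U = {z. \<forall>i. z $ i \<in> U i}"

definition map_product :: "('n \<Rightarrow> complex \<Rightarrow> complex) \<Rightarrow> complex^'n \<Rightarrow> complex^'n" where
  "map_product h z = (\<chi> i. h i (z $ i))"

definition torus :: "(complex^'n) set" where
  "torus = set_product (\<lambda>_. sphere 0 1)"

definition closed_polydisc :: "(complex^'n) set" where
  "closed_polydisc = set_product (\<lambda>_. cball 0 1)"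

definition torus_rotate :: "'n \<Rightarrow> real \<Rightarrow> complex^'n \<Rightarrow> complex^'n" where
  "torus_rotate j t z = (\<chi> i. if i = j then cis t * z $ i else z $ i)"

text \<open>The value at the point \<open>(cis \<theta>\<^sub>1, \<dots>, cis \<theta>\<^sub>n)\<close> of the derivative with respect to the angle \<open>\<theta>\<^sub>j\<close>:
  increasing \<open>\<theta>\<^sub>j\<close> by \<open>t\<close> is multiplication of the \<open>j\<close>-th coordinate by \<open>cis t\<close>.\<close>

definition torus_partial :: "'n \<Rightarrow> (complex^'n \<Rightarrow> complex) \<Rightarrow> complex^'n \<Rightarrow> complex" where
  "torus_partial j g z = vector_derivative (\<lambda>t. g (torus_rotate j t z)) (at 0)"

text \<open>A derivative of order \<open>k\<close> is given by the list of the \<open>k\<close> variables of differentiation. A list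
  represents the multi-index that counts its entries. On \<open>C\<^sup>p\<close> functions the order of
  differentiation is irrelevant, so lists with the same multi-index give the same derivative.\<close>

definition torus_deriv :: "'n list \<Rightarrow> (complex^'n \<Rightarrow> complex) \<Rightarrow> complex^'n \<Rightarrow> complex" where
  "torus_deriv js g = foldr torus_partial js g"

definition Cp_torus :: "enat \<Rightarrow> (complex^'n \<Rightarrow> complex) \<Rightarrow> bool" where
  "Cp_torus p g \<longleftrightarrow>
     (\<forall>js j. enat (length (j # js)) \<le> p \<longrightarrow>
        (\<forall>z\<in>torus. (\<lambda>t. torus_deriv js g (torus_rotate j t z)) differentiable (at 0))) \<and>
     (\<forall>js. enat (length js) \<le> p \<longrightarrow> continuous_on torus (torus_deriv js g))"

text \<open>Functions on \<open>\<gamma>(T\<^sup>n)\<close> are represented by functions that are \<open>undefined\<close> outside that set, so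
  that two elements are equal iff they agree on \<open>\<gamma>(T\<^sup>n)\<close>.\<close>

definition Cp_space :: "enat \<Rightarrow> (complex^'n \<Rightarrow> complex^'n) \<Rightarrow> (complex^'n \<Rightarrow> complex) set" where
  "Cp_space p \<gamma> = {f \<in> extensional (\<gamma> ` torus). Cp_torus p (f \<circ> \<gamma>)}"

definition Cp_seminorm ::
    "(complex^'n \<Rightarrow> complex^'n) \<Rightarrow> 'n list \<Rightarrow> (complex^'n \<Rightarrow> complex) \<Rightarrow> real" where
  "Cp_seminorm \<gamma> js f = (SUP z\<in>torus. norm (torus_deriv js (f \<circ> \<gamma>) z))"

definition Cp_topology ::
    "enat \<Rightarrow> (complex^'n \<Rightarrow> complex^'n) \<Rightarrow> (complex^'n \<Rightarrow> complex) topology" where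
  "Cp_topology p \<gamma> = topology_generated_by
     {{g \<in> Cp_space p \<gamma>. Cp_seminorm \<gamma> js (\<lambda>z. g z - f z) < e} | f js e.
        f \<in> Cp_space p \<gamma> \<and> enat (length js) \<le> p \<and> e > 0}"

definition dense_gdelta_in :: "'a topology \<Rightarrow> 'a set \<Rightarrow> bool" where
  "dense_gdelta_in X S \<longleftrightarrow> gdelta_in X S \<and> X closure_of S = topspace X"

definition residual_in :: "'a topology \<Rightarrow> 'a set \<Rightarrow> bool" where
  "residual_in X S \<longleftrightarrow> S \<subseteq> topspace X \<and> (\<exists>G\<subseteq>S. dense_gdelta_in X G)"

definition holomorphic_several :: "(complex^'n \<Rightarrow> complex) \<Rightarrow> (complex^'n) set \<Rightarrow> bool" where
  "holomorphic_several F U \<longleftrightarrow>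
     (\<forall>z\<in>U. \<exists>F'. (F has_derivative F') (at z within U) \<and> (\<forall>c v. F' (c *s v) = c * F' v))"

definition replace_coord :: "'n \<Rightarrow> complex \<Rightarrow> complex^'n \<Rightarrow> complex^'n" where
  "replace_coord j w z = (\<chi> i. if i = j then w else z $ i)"

definition separately_continuous_on :: "(complex^'n) set \<Rightarrow> (complex^'n \<Rightarrow> complex) \<Rightarrow> bool" where
  "separately_continuous_on S F \<longleftrightarrow>
     (\<forall>z j. continuous_on {w. replace_coord j w z \<in> S} (\<lambda>w. F (replace_coord j w z)))"

text \<open>In the following definitions \<open>V\<close> is the product domain, \<open>K\<close> the set \<open>\<gamma>(T\<^sup>n)\<close>.\<close>

definition extendable_at ::
    "(complex^'n) set \<Rightarrow> (complex^'n) set \<Rightarrow> (complex^'n \<Rightarrow> complex) \<Rightarrow> complex^'n \<Rightarrow> bool" where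
  "extendable_at V K f \<zeta> \<longleftrightarrow>
     (\<exists>r>0. \<exists>F. continuous_on ((ball \<zeta> r \<inter> V) \<union> K) F \<and>
        holomorphic_several F (ball \<zeta> r \<inter> V) \<and> (\<forall>z\<in>K. F z = f z))"

text \<open>For separate continuity the domain of \<open>F\<close> has to include the part of the boundary of \<open>V\<close> that lies
  in the ball. In dimension at least 2 no line \<open>{z. z $ i = a\<^sub>i for all i \<noteq> j}\<close> meets both \<open>V\<close> and
  \<open>K\<close>, so separate continuity on \<open>(ball \<zeta> r \<inter> V) \<union> K\<close> would not relate the values of \<open>F\<close> on these
  two sets: extending \<open>f\<close> by 0 would always be admissible. In dimension 1 both domains are the same,
  since \<open>K\<close> is then the whole boundary of \<open>V\<close>.\<close>

definition separately_extendable_at ::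
    "(complex^'n) set \<Rightarrow> (complex^'n) set \<Rightarrow> (complex^'n \<Rightarrow> complex) \<Rightarrow> complex^'n \<Rightarrow> bool" where
  "separately_extendable_at V K f \<zeta> \<longleftrightarrow>
     (\<exists>r>0. \<exists>F. bounded (F ` ((ball \<zeta> r \<inter> closure V) \<union> K)) \<and>
        separately_continuous_on ((ball \<zeta> r \<inter> closure V) \<union> K) F \<and>
        holomorphic_several F (ball \<zeta> r \<inter> V) \<and> (\<forall>z\<in>K. F z = f z))"

definition lipschitz_extendable_at ::
    "(complex^'n) set \<Rightarrow> (complex^'n) set \<Rightarrow> (complex^'n \<Rightarrow> complex) \<Rightarrow> complex^'n \<Rightarrow> bool" where
  "lipschitz_extendable_at V K f \<zeta> \<longleftrightarrow>
     (\<exists>r>0. \<exists>F. (\<exists>L. L-lipschitz_on ((ball \<zeta> r \<inter> V) \<union> K) F) \<and>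
        holomorphic_several F (ball \<zeta> r \<inter> V) \<and> (\<forall>z\<in>K. F z = f z))"

end

theory Submission
  imports Defs "HOL-Complex_Analysis.Complex_Analysis"
begin

text \<open>
  Call \<open>f\<close> extendable at \<open>\<gamma>(\<xi>)\<close>, \<open>\<xi> \<in> T\<^sup>n\<close>, if \<open>f \<circ> \<gamma>\<close> has an extension \<open>H\<close> to a corner of the closed
  polydisc at \<open>\<xi>\<close>, that is to the points \<open>z\<close> with \<open>\<bar>z\<^sub>i - \<xi>\<^sub>i\<bar> < \<rho>\<close> for all \<open>i\<close>, which is bounded and jointly
  continuous there and holomorphic in the interior. The homeomorphism \<open>\<phi>\<close> is holomorphic inside together with
  its inverse, so this can be compared with extensions in the product domain, and it turns out to be equivalent both to
  extendability in the usual sense and to extendability in the separately continuous sense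
  (\<open>extendable_iff\<close>, \<open>separately_extendable_iff\<close>). Hence the sets in the first two assertions are equal.

  Everything rests on a two-constants estimate. In one variable (\<open>two_constants_arc\<close>), a function that is
  holomorphic near a boundary point of the disc, bounded by \<open>M\<close>, and bounded by \<open>\<epsilon>\<close> on the arc, is bounded by
  \<open>sqrt (M \<epsilon>)\<close> on a smaller neighbourhood. Used in one variable after the other it shows that a bounded
  function which is small on the torus is small on a smaller corner (\<open>two_constants_corner\<close>).
  Here slices with some coordinates on the unit circle occur; they are holomorphic as bounded limits
  of interior slices (\<open>slicewise_holomorphicI\<close>). There are three consequences.

  \<^item> Extensions with a common bound converge uniformly on a smaller corner if their boundary values
    converge uniformly (\<open>extends_into_corner_limit\<close>).
  \<^item> For an extension in the usual or the separately continuous sense, the dilations \<open>z \<mapsto> H (t z)\<close> converge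
    uniformly as \<open>t\<close> increases to \<open>1\<close>, which gives joint continuity up to the boundary
    (\<open>extends_into_corner_radial\<close>).
  \<^item> A holomorphic function whose boundary values vanish on an arc is zero. Hence a smooth function that vanishes
    exactly on one side of \<open>\<xi>\<close>, such as \<open>exp (- 1 / x)\<close> for \<open>x > 0\<close>, continued by \<open>0\<close>, with
    \<open>x = Im (cnj \<xi>\<^sub>j z\<^sub>j)\<close>, is not extendable at \<open>\<xi>\<close> (\<open>one_sided_not_extendable\<close>).

  The conclusion is Baire's theorem in the complete metrizable space \<open>C\<^sup>p(\<gamma>)\<close>. The functions with an extension
  to the corner of radius \<open>1 / (k + 1)\<close> at \<open>\<xi>\<close> with bound \<open>m\<close>, where \<open>\<xi>\<close> runs through a countable dense set, are
  countably many sets whose union is the set of all functions that are extendable somewhere. By the first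
  consequence their closures are still contained in this union, so the complement is a \<open>G\<^sub>\<delta>\<close> set. The closure of each of these
  sets consists of functions extendable to one fixed corner. Such functions form a linear space, which is proper by
  the third consequence; so the closures have empty interior and the complement is dense
  (\<open>dense_gdelta_of_nonextendable\<close>). For Lipschitz extensions the same argument applies to the sets
  with a fixed Lipschitz constant, since Lipschitz bounds pass to pointwise limits.
\<close>

section \<open>Products of plane sets\<close>

lemma set_product_eq_INT: "set_product U = (\<Inter>i. (\<lambda>z::complex^'n::finite. z $ i) -` U i)"
  by (auto simp: set_product_def)

lemma open_set_product:
  fixes U :: "'n::finite \<Rightarrow> complex set"
  assumes "\<And>i. open (U i)"
  shows "open (set_product U)"
  unfolding set_product_eq_INT
  by (intro open_INT ballI open_vimage assms) (auto intro!: continuous_intros)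

lemma closed_set_product:
  fixes U :: "'n::finite \<Rightarrow> complex set"
  assumes "\<And>i. closed (U i)"
  shows "closed (set_product U)"
  unfolding set_product_eq_INT
  by (intro closed_INT ballI closed_vimage assms) (auto intro!: continuous_intros)

lemma compact_set_product:
  fixes U :: "'n::finite \<Rightarrow> complex set"
  assumes "\<And>i. compact (U i)"
  shows "compact (set_product U)"
proof -
  have "closed (set_product U)"
    by (intro closed_set_product compact_imp_closed assms)
  moreover have "bounded (set_product U)"
  proof -
    have "\<forall>i. \<exists>B. \<forall>w\<in>U i. norm w \<le> B"
      using assms compact_imp_bounded bounded_iff by metis
    then obtain B where B: "\<And>i w. w \<in> U i \<Longrightarrow> norm w \<le> B i"
      by metis
    have "norm z \<le> (\<Sum>i\<in>UNIV. B i)" if "z \<in> set_product U" for z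
    proof -
      have "norm z \<le> (\<Sum>i\<in>UNIV. norm (z $ i))"
        unfolding norm_vec_def by (rule L2_set_le_sum) auto
      also have "\<dots> \<le> (\<Sum>i\<in>UNIV. B i)"
        using that B by (intro sum_mono) (auto simp: set_product_def)
      finally show ?thesis .
    qed
    then show ?thesis
      unfolding bounded_iff by blast
  qed
  ultimately show ?thesis
    by (simp add: compact_eq_bounded_closed)
qed

lemma dist_vec_less:
  fixes x y :: "complex^'n::finite"
  assumes "\<And>i. dist (x $ i) (y $ i) < r"
  shows "dist x y < real CARD('n) * r"
proof -
  have "dist x y \<le> (\<Sum>i\<in>UNIV. dist (x $ i) (y $ i))"
    unfolding dist_vec_def by (rule L2_set_le_sum) auto
  also have "\<dots> < (\<Sum>i\<in>(UNIV :: 'n set). r)"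
    by (rule sum_strict_mono) (use assms in auto)
  finally show ?thesis by simp
qed

section \<open>Continuously differentiable functions on the torus\<close>

lemma compact_torus: "compact (torus :: (complex^'n::finite) set)"
  unfolding torus_def by (intro compact_set_product) auto

lemma torus_nonempty: "(torus :: (complex^'n::finite) set) \<noteq> {}"
proof -
  have "(\<chi> i. 1) \<in> (torus :: (complex^'n) set)"
    by (simp add: torus_def set_product_def)
  then show ?thesis by blast
qed

lemma torus_rotate_add:
  "torus_rotate j s (torus_rotate j t z) = torus_rotate j (s + t) (z :: complex^'n::finite)"
  by (auto simp: torus_rotate_def vec_eq_iff cis_mult [symmetric] mult.assoc)

lemma torus_rotate_0 [simp]: "torus_rotate j 0 z = (z :: complex^'n::finite)"
  by (auto simp: torus_rotate_def vec_eq_iff)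

lemma torus_rotate_in_torus:
  "z \<in> torus \<Longrightarrow> torus_rotate j t z \<in> (torus :: (complex^'n::finite) set)"
  by (auto simp: torus_def set_product_def torus_rotate_def norm_mult)

lemma torus_deriv_simps [simp]:
  "torus_deriv [] g = g"
  "torus_deriv (j # js) g = torus_partial j (torus_deriv js g)"
  by (simp_all add: torus_deriv_def)

text \<open>A derivative at angle \<open>0\<close> at every point of the torus is a derivative at every angle, because
  rotations form a one-parameter group.\<close>

lemma has_vector_derivative_along_rotation:
  fixes z :: "complex^'n::finite"
  assumes "((\<lambda>t. G (torus_rotate j t (torus_rotate j s z))) has_vector_derivative D) (at 0)"
  shows "((\<lambda>t. G (torus_rotate j t z)) has_vector_derivative D) (at s)"
proof -
  have "((\<lambda>t. t - s) has_vector_derivative 1) (at s)"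
    by (auto intro!: derivative_eq_intros)
  from vector_diff_chain_at[OF this, of "\<lambda>t. G (torus_rotate j (t + s) z)" D] assms
  show ?thesis
    by (simp add: torus_rotate_add o_def)
qed

text \<open>Derivatives on the torus are computed by exhibiting a candidate \<open>D js\<close> for every order: sums,
  uniform limits and explicit functions are all treated through this criterion.\<close>

lemma Cp_torus_by_candidates:
  fixes g :: "complex^'n::finite \<Rightarrow> complex"
  assumes deriv: "\<And>js j z. enat (Suc (length js)) \<le> p \<Longrightarrow> z \<in> torus \<Longrightarrow>
      ((\<lambda>t. D js (torus_rotate j t z)) has_vector_derivative D (j # js) z) (at 0)"
    and cont: "\<And>js. enat (length js) \<le> p \<Longrightarrow> continuous_on torus (D js)"
    and D0: "\<And>z. z \<in> torus \<Longrightarrow> D [] z = g z"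
  shows "Cp_torus p g"
    and "\<And>js z. enat (length js) \<le> p \<Longrightarrow> z \<in> torus \<Longrightarrow> torus_deriv js g z = D js z"
proof -
  show eq: "torus_deriv js g z = D js z" if "enat (length js) \<le> p" "z \<in> torus" for js z
    using that
  proof (induction js arbitrary: z)
    case Nil
    then show ?case using D0 by simp
  next
    case (Cons j js)
    have len: "enat (length js) \<le> p"
      using Cons.prems(1) by (simp add: Suc_ile_eq order.strict_implies_order)
    have "(\<lambda>t. torus_deriv js g (torus_rotate j t z)) = (\<lambda>t. D js (torus_rotate j t z))"
      using Cons.IH[OF len] torus_rotate_in_torus[OF Cons.prems(2)] by auto
    then show ?case
      using deriv[of js z j] Cons.prems
      by (simp add: torus_partial_def vector_derivative_at)
  qed
  show "Cp_torus p g"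
    unfolding Cp_torus_def
  proof (intro conjI allI impI ballI)
    fix js :: "'n list" and j and z :: "complex^'n"
    assume len: "enat (length (j # js)) \<le> p" and z: "z \<in> torus"
    then have len': "enat (length js) \<le> p"
      by (simp add: Suc_ile_eq order.strict_implies_order)
    have "(\<lambda>t. torus_deriv js g (torus_rotate j t z)) = (\<lambda>t. D js (torus_rotate j t z))"
      using eq[OF len'] torus_rotate_in_torus[OF z] by auto
    then show "(\<lambda>t. torus_deriv js g (torus_rotate j t z)) differentiable at 0"
      using deriv[of js z j] len z by (auto intro: differentiableI_vector)
  next
    fix js :: "'n list"
    assume "enat (length js) \<le> p"
    then show "continuous_on torus (torus_deriv js g)"
      using cont eq by (metis continuous_on_cong)
  qed
qed

lemma Cp_torus_has_vector_derivative:
  fixes g :: "complex^'n::finite \<Rightarrow> complex"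
  assumes "Cp_torus p g" "enat (Suc (length js)) \<le> p" "z \<in> torus"
  shows "((\<lambda>t. torus_deriv js g (torus_rotate j t z)) has_vector_derivative
           torus_deriv (j # js) g (torus_rotate j s z)) (at s)"
proof (rule has_vector_derivative_along_rotation)
  have "(\<lambda>t. torus_deriv js g (torus_rotate j t (torus_rotate j s z))) differentiable at 0"
    using assms(1,2) torus_rotate_in_torus[OF assms(3), of j s] unfolding Cp_torus_def by simp
  then show "((\<lambda>t. torus_deriv js g (torus_rotate j t (torus_rotate j s z))) has_vector_derivative
           torus_deriv (j # js) g (torus_rotate j s z)) (at 0)"
    by (simp add: torus_partial_def vector_derivative_works)
qed

lemma Cp_torus_continuous_on:
  "Cp_torus p g \<Longrightarrow> enat (length js) \<le> p \<Longrightarrow> continuous_on torus (torus_deriv js g)"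
  by (simp add: Cp_torus_def)

lemma Cp_torus_linear_combination:
  fixes g h :: "complex^'n::finite \<Rightarrow> complex"
  assumes g: "Cp_torus p g" and h: "Cp_torus p h"
    and u: "\<And>z. z \<in> torus \<Longrightarrow> u z = a * g z + b * h z"
  shows "Cp_torus p u"
    and "\<And>js z. enat (length js) \<le> p \<Longrightarrow> z \<in> torus \<Longrightarrow>
      torus_deriv js u z = a * torus_deriv js g z + b * torus_deriv js h z"
proof -
  let ?D = "\<lambda>js z. a * torus_deriv js g z + b * torus_deriv js h z"
  have deriv: "((\<lambda>t. ?D js (torus_rotate j t z)) has_vector_derivative ?D (j # js) z) (at 0)"
    if "enat (Suc (length js)) \<le> p" "z \<in> torus" for js j z
    using Cp_torus_has_vector_derivative[OF g that, of j 0] Cp_torus_has_vector_derivative[OF h that, of j 0]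
    by (auto intro!: derivative_eq_intros)
  have cont: "continuous_on torus (?D js)" if "enat (length js) \<le> p" for js
    by (intro continuous_intros Cp_torus_continuous_on[OF _ that] g h)
  have D0: "?D [] z = u z" if "z \<in> torus" for z
    using u[OF that] by simp
  show "Cp_torus p u"
    by (rule Cp_torus_by_candidates(1)[of p ?D, OF deriv cont D0])
  show "torus_deriv js u z = ?D js z" if "enat (length js) \<le> p" "z \<in> torus" for js z
    by (rule Cp_torus_by_candidates(2)[of p ?D, OF deriv cont D0 that])
qed

lemma Cp_torus_diff:
  fixes g h :: "complex^'n::finite \<Rightarrow> complex"
  assumes "Cp_torus p g" "Cp_torus p h"
  shows "Cp_torus p (\<lambda>z. g z - h z)"
    and "\<And>js z. enat (length js) \<le> p \<Longrightarrow> z \<in> torus \<Longrightarrow>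
      torus_deriv js (\<lambda>z. g z - h z) z = torus_deriv js g z - torus_deriv js h z"
  using Cp_torus_linear_combination[OF assms, of "\<lambda>z. g z - h z" 1 "-1"] by simp_all

text \<open>This is the analytic content of the completeness of \<open>C\<^sup>p\<close>: derivatives that converge uniformly
  along the orbits of the rotations are derivatives of the limit.\<close>

lemma Cp_torus_complete:
  fixes g :: "nat \<Rightarrow> complex^'n::finite \<Rightarrow> complex"
  assumes g: "\<And>m. Cp_torus p (g m)"
    and Cauchy: "\<And>js. enat (length js) \<le> p \<Longrightarrow>
      uniformly_Cauchy_on torus (\<lambda>m. torus_deriv js (g m))"
  obtains f where "Cp_torus p f"
    "\<And>js. enat (length js) \<le> p \<Longrightarrow>
      uniform_limit torus (\<lambda>m. torus_deriv js (g m)) (torus_deriv js f) sequentially"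
proof -
  define D where "D = (\<lambda>js z. lim (\<lambda>m. torus_deriv js (g m) z))"
  have ul: "uniform_limit torus (\<lambda>m. torus_deriv js (g m)) (D js) sequentially"
    if "enat (length js) \<le> p" for js
    unfolding D_def using Cauchy[OF that]
    by (metis Cauchy_uniformly_convergent uniformly_convergent_uniform_limit_iff)
  have cont: "continuous_on torus (D js)" if "enat (length js) \<le> p" for js
    by (rule uniform_limit_theorem[OF _ ul[OF that]])
      (auto intro!: always_eventually Cp_torus_continuous_on[OF g that])
  have deriv: "((\<lambda>t. D js (torus_rotate j t z)) has_vector_derivative D (j # js) z) (at 0)"
    if len: "enat (Suc (length js)) \<le> p" and z: "z \<in> torus" for js j z
  proof -
    have len': "enat (length js) \<le> p"
      using len by (simp add: Suc_ile_eq order.strict_implies_order)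
    have lim: "(\<lambda>m. torus_deriv js (g m) (torus_rotate j t z)) \<longlonglongrightarrow> D js (torus_rotate j t z)" for t
      by (rule tendsto_uniform_limitI[OF ul[OF len'] torus_rotate_in_torus[OF z]])
    let ?v = "\<lambda>m t. torus_deriv (j # js) (g m) (torus_rotate j t z)"
    let ?w = "\<lambda>t. D (j # js) (torus_rotate j t z)"
    have der: "((\<lambda>t. torus_deriv js (g m) (torus_rotate j t z)) has_derivative
          (\<lambda>h. h *\<^sub>R ?v m t)) (at t within UNIV)" for m t
      using Cp_torus_has_vector_derivative[OF g len z, of m j t]
      by (simp add: has_vector_derivative_def)
    have unif: "\<forall>\<^sub>F m in sequentially. \<forall>t\<in>UNIV. \<forall>h. norm (h *\<^sub>R ?v m t - h *\<^sub>R ?w t) \<le> e * norm h"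
      if e: "e > 0" for e
    proof -
      have "\<forall>\<^sub>F m in sequentially. \<forall>x\<in>torus. dist (torus_deriv (j # js) (g m) x) (D (j # js) x) < e"
        using uniform_limitD[OF ul[of "j # js"] e] len by simp
      then show ?thesis
      proof (rule eventually_mono)
        fix m
        assume close: "\<forall>x\<in>torus. dist (torus_deriv (j # js) (g m) x) (D (j # js) x) < e"
        have "norm (h *\<^sub>R ?v m t - h *\<^sub>R ?w t) \<le> e * norm h" for t h
        proof -
          have "norm (?v m t - ?w t) \<le> e"
            using close torus_rotate_in_torus[OF z, of j t] by (metis dist_norm less_imp_le)
          then have "\<bar>h\<bar> * norm (?v m t - ?w t) \<le> \<bar>h\<bar> * e"
            by (rule mult_left_mono) simp
          then show ?thesis
            by (metis mult.commute norm_scaleR real_norm_def scaleR_diff_right)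
        qed
        then show "\<forall>t\<in>UNIV. \<forall>h. norm (h *\<^sub>R ?v m t - h *\<^sub>R ?w t) \<le> e * norm h"
          by blast
      qed
    qed
    have "\<exists>G. \<forall>t\<in>UNIV. (\<lambda>m. torus_deriv js (g m) (torus_rotate j t z)) \<longlonglongrightarrow> G t \<and>
        (G has_derivative (\<lambda>h. h *\<^sub>R ?w t)) (at t within UNIV)"
      by (rule has_derivative_sequence[OF convex_UNIV der unif UNIV_I lim[of 0]])
    then obtain G where G: "\<forall>t\<in>UNIV. (\<lambda>m. torus_deriv js (g m) (torus_rotate j t z)) \<longlonglongrightarrow> G t \<and>
        (G has_derivative (\<lambda>h. h *\<^sub>R ?w t)) (at t within UNIV)"
      by (elim exE)
    have "G t = D js (torus_rotate j t z)" for t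
      using LIMSEQ_unique[OF _ lim[of t]] G by blast
    then have "G = (\<lambda>t. D js (torus_rotate j t z))"
      by (rule ext)
    moreover have "(G has_derivative (\<lambda>h. h *\<^sub>R ?w 0)) (at 0)"
      using G by blast
    ultimately show ?thesis
      by (simp add: has_vector_derivative_def)
  qed
  have f: "Cp_torus p (D [])"
    by (rule Cp_torus_by_candidates(1)[of p D, OF deriv cont refl])
  have f': "torus_deriv js (D []) z = D js z" if "enat (length js) \<le> p" "z \<in> torus" for js z
    by (rule Cp_torus_by_candidates(2)[of p D, OF deriv cont refl that])
  show ?thesis
  proof (rule that[OF f])
    fix js :: "'n list"
    assume len: "enat (length js) \<le> p"
    show "uniform_limit torus (\<lambda>m. torus_deriv js (g m)) (torus_deriv js (D [])) sequentially"
      using ul[OF len] f'[OF len] by (simp add: uniform_limit_iff)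
  qed
qed

section \<open>The topology of the space of \<open>C\<^sup>p\<close> functions\<close>

lemma Cp_seminorm_le:
  fixes f :: "complex^'n::finite \<Rightarrow> complex"
  assumes "\<And>z. z \<in> torus \<Longrightarrow> norm (torus_deriv js (f \<circ> \<gamma>) z) \<le> C"
  shows "Cp_seminorm \<gamma> js f \<le> C"
  unfolding Cp_seminorm_def by (rule cSUP_least) (use assms torus_nonempty in auto)

lemma norm_le_Cp_seminorm:
  fixes f :: "complex^'n::finite \<Rightarrow> complex"
  assumes "Cp_torus p (f \<circ> \<gamma>)" "enat (length js) \<le> p" "z \<in> torus"
  shows "norm (torus_deriv js (f \<circ> \<gamma>) z) \<le> Cp_seminorm \<gamma> js f"
  unfolding Cp_seminorm_def
proof (rule cSUP_upper)
  have "compact ((\<lambda>z. norm (torus_deriv js (f \<circ> \<gamma>) z)) ` torus)"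
    by (intro compact_continuous_image continuous_intros compact_torus Cp_torus_continuous_on[OF assms(1,2)])
  then show "bdd_above ((\<lambda>z. norm (torus_deriv js (f \<circ> \<gamma>) z)) ` torus)"
    by (simp add: bounded_imp_bdd_above compact_imp_bounded)
qed (fact assms)

text \<open>The seminorms are applied to pointwise differences, which need not belong to the space: outside
  \<open>\<gamma>(T\<^sup>n)\<close> they may fail to be \<open>undefined\<close>. Only their compositions with \<open>\<gamma>\<close> matter.\<close>

lemma comp_diff: "(\<lambda>z. f z - g z) \<circ> \<gamma> = (\<lambda>z. (f \<circ> \<gamma>) z - (g \<circ> \<gamma>) z)"
  by auto

lemma Cp_seminorm_diff:
  fixes f :: "complex^'n::finite \<Rightarrow> complex"
  assumes "f \<in> Cp_space p \<gamma>" "g \<in> Cp_space p \<gamma>" "enat (length js) \<le> p"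
  shows "(\<And>z. z \<in> torus \<Longrightarrow> norm (torus_deriv js (f \<circ> \<gamma>) z - torus_deriv js (g \<circ> \<gamma>) z) \<le> C) \<Longrightarrow>
      Cp_seminorm \<gamma> js (\<lambda>z. f z - g z) \<le> C"
    and "z \<in> torus \<Longrightarrow> norm (torus_deriv js (f \<circ> \<gamma>) z - torus_deriv js (g \<circ> \<gamma>) z) \<le>
      Cp_seminorm \<gamma> js (\<lambda>z. f z - g z)"
proof -
  have fg: "Cp_torus p (f \<circ> \<gamma>)" "Cp_torus p (g \<circ> \<gamma>)"
    using assms by (auto simp: Cp_space_def)
  show "Cp_seminorm \<gamma> js (\<lambda>z. f z - g z) \<le> C"
    if "\<And>z. z \<in> torus \<Longrightarrow> norm (torus_deriv js (f \<circ> \<gamma>) z - torus_deriv js (g \<circ> \<gamma>) z) \<le> C"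
    by (rule Cp_seminorm_le) (use that assms(3) in \<open>simp only: comp_diff Cp_torus_diff(2)[OF fg]\<close>)
  show "norm (torus_deriv js (f \<circ> \<gamma>) z - torus_deriv js (g \<circ> \<gamma>) z) \<le>
      Cp_seminorm \<gamma> js (\<lambda>z. f z - g z)" if "z \<in> torus"
    using norm_le_Cp_seminorm[of p "\<lambda>z. f z - g z" \<gamma> js z] that assms(3)
    by (simp only: comp_diff Cp_torus_diff[OF fg])
qed

lemma Cp_seminorm_diff_properties:
  fixes f :: "complex^'n::finite \<Rightarrow> complex"
  assumes "f \<in> Cp_space p \<gamma>" "g \<in> Cp_space p \<gamma>" "h \<in> Cp_space p \<gamma>" and len: "enat (length js) \<le> p"
  shows "Cp_seminorm \<gamma> js (\<lambda>z. f z - g z) \<ge> 0"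
    and "Cp_seminorm \<gamma> js (\<lambda>z. f z - g z) = Cp_seminorm \<gamma> js (\<lambda>z. g z - f z)"
    and "Cp_seminorm \<gamma> js (\<lambda>z. f z - h z) \<le> Cp_seminorm \<gamma> js (\<lambda>z. f z - g z) + Cp_seminorm \<gamma> js (\<lambda>z. g z - h z)"
    and "Cp_seminorm \<gamma> js (\<lambda>z. f z - f z) = 0"
proof -
  note F = Cp_seminorm_diff[OF _ _ len, of _ \<gamma>]
  obtain w :: "complex^'n" where "w \<in> torus"
    using torus_nonempty by blast
  then show nonneg: "Cp_seminorm \<gamma> js (\<lambda>z. f z - g z) \<ge> 0"
    using F(2)[OF assms(1,2)] norm_ge_zero order_trans by blast
  show "Cp_seminorm \<gamma> js (\<lambda>z. f z - g z) = Cp_seminorm \<gamma> js (\<lambda>z. g z - f z)"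
    by (intro antisym F(1) assms) (subst norm_minus_commute; intro F(2) assms; assumption)+
  show "Cp_seminorm \<gamma> js (\<lambda>z. f z - h z) \<le> Cp_seminorm \<gamma> js (\<lambda>z. f z - g z) + Cp_seminorm \<gamma> js (\<lambda>z. g z - h z)"
  proof (rule F(1)[OF assms(1,3)])
    fix z :: "complex^'n" assume "z \<in> torus"
    then show "norm (torus_deriv js (f \<circ> \<gamma>) z - torus_deriv js (h \<circ> \<gamma>) z) \<le>
        Cp_seminorm \<gamma> js (\<lambda>z. f z - g z) + Cp_seminorm \<gamma> js (\<lambda>z. g z - h z)"
      using F(2)[OF assms(1,2)] F(2)[OF assms(2,3)] by (intro norm_diff_triangle_le)
  qed
  show "Cp_seminorm \<gamma> js (\<lambda>z. f z - f z) = 0"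
  proof (rule antisym)
    show "Cp_seminorm \<gamma> js (\<lambda>z. f z - f z) \<le> 0"
      by (rule F(1)[OF assms(1,1)]) auto
    show "0 \<le> Cp_seminorm \<gamma> js (\<lambda>z. f z - f z)"
      using F(2)[OF assms(1,1)] \<open>w \<in> torus\<close> by fastforce
  qed
qed

text \<open>Truncating the seminorms of order \<open>k\<close> at \<open>1 / (k + 1)\<close> makes the supremum over all orders finite, and a
  ball of given radius constrains only finitely many derivatives. The value \<open>0\<close> outside the space makes the
  function nonnegative and symmetric without restriction.\<close>

definition Cp_dist ::
    "enat \<Rightarrow> (complex^'n \<Rightarrow> complex^'n) \<Rightarrow> (complex^'n \<Rightarrow> complex) \<Rightarrow> (complex^'n \<Rightarrow> complex) \<Rightarrow> real" where
  "Cp_dist p \<gamma> f g = (if f \<in> Cp_space p \<gamma> \<and> g \<in> Cp_space p \<gamma> then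
     (SUP js\<in>{js. enat (length js) \<le> p}. min (Cp_seminorm \<gamma> js (\<lambda>z. f z - g z)) (1 / real (Suc (length js))))
     else 0)"

lemma zero_order_le [simp]: "enat 0 \<le> p"
  by (simp add: zero_enat_def[symmetric])

lemma Cp_dist_ge:
  fixes f :: "complex^'n::finite \<Rightarrow> complex"
  assumes "f \<in> Cp_space p \<gamma>" "g \<in> Cp_space p \<gamma>" "enat (length js) \<le> p"
  shows "min (Cp_seminorm \<gamma> js (\<lambda>z. f z - g z)) (1 / real (Suc (length js))) \<le> Cp_dist p \<gamma> f g"
proof -
  have "min (Cp_seminorm \<gamma> js (\<lambda>z. f z - g z)) (1 / real (Suc (length js))) \<le> 1" for js
  proof -
    have "1 / real (Suc (length js)) \<le> 1" by simp
    then show ?thesis by linarith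
  qed
  then have "bdd_above ((\<lambda>js. min (Cp_seminorm \<gamma> js (\<lambda>z. f z - g z)) (1 / real (Suc (length js)))) ` {js. enat (length js) \<le> p})"
    by (intro bdd_aboveI2[where M = 1])
  then show ?thesis
    using assms unfolding Cp_dist_def by (auto intro!: cSUP_upper)
qed

lemma Cp_dist_le:
  fixes f :: "complex^'n::finite \<Rightarrow> complex"
  assumes "f \<in> Cp_space p \<gamma>" "g \<in> Cp_space p \<gamma>"
    and "\<And>js. enat (length js) \<le> p \<Longrightarrow>
      min (Cp_seminorm \<gamma> js (\<lambda>z. f z - g z)) (1 / real (Suc (length js))) \<le> C"
  shows "Cp_dist p \<gamma> f g \<le> C"
proof -
  have "{js :: 'n list. enat (length js) \<le> p} \<noteq> {}"
    by (auto intro: exI[of _ "[]"])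
  then show ?thesis
    using assms unfolding Cp_dist_def by (auto intro!: cSUP_least)
qed

lemma Cp_dist_le_from_finitely_many:
  fixes f :: "complex^'n::finite \<Rightarrow> complex"
  assumes "f \<in> Cp_space p \<gamma>" "g \<in> Cp_space p \<gamma>" and k: "1 / real (Suc k) \<le> C"
    and small: "\<And>js. length js \<le> k \<Longrightarrow> enat (length js) \<le> p \<Longrightarrow> Cp_seminorm \<gamma> js (\<lambda>z. f z - g z) \<le> C"
  shows "Cp_dist p \<gamma> f g \<le> C"
proof (rule Cp_dist_le[OF assms(1,2)])
  fix js :: "'n list" assume len: "enat (length js) \<le> p"
  show "min (Cp_seminorm \<gamma> js (\<lambda>z. f z - g z)) (1 / real (Suc (length js))) \<le> C"
  proof (cases "length js \<le> k")
    case True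
    then show ?thesis using small len by fastforce
  next
    case False
    then have "1 / real (Suc (length js)) \<le> 1 / real (Suc k)"
      by (intro divide_left_mono) auto
    then show ?thesis using k by linarith
  qed
qed

lemma Cp_seminorm_less_of_dist:
  fixes f :: "complex^'n::finite \<Rightarrow> complex"
  assumes "f \<in> Cp_space p \<gamma>" "g \<in> Cp_space p \<gamma>" "enat (length js) \<le> p"
    and "Cp_dist p \<gamma> f g < min e (1 / real (Suc (length js)))"
  shows "Cp_seminorm \<gamma> js (\<lambda>z. f z - g z) < e"
  using Cp_dist_ge[OF assms(1-3)] assms(4) by linarith

lemma finite_derivatives_up_to: "finite {js :: 'n::finite list. length js \<le> k \<and> enat (length js) \<le> p}"
proof -
  have "finite {js :: 'n list. set js \<subseteq> UNIV \<and> length js \<le> k}"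
    by (rule finite_lists_length_le) auto
  then show ?thesis by (rule finite_subset[rotated]) auto
qed

lemma Cp_space_eqI:
  assumes "f \<in> Cp_space p \<gamma>" "g \<in> Cp_space p \<gamma>" "\<And>z. z \<in> torus \<Longrightarrow> f (\<gamma> z) = g (\<gamma> z)"
  shows "f = g"
  using assms by (intro extensionalityI[of _ "\<gamma> ` torus"]) (auto simp: Cp_space_def)

lemma Metric_space_Cp_space:
  fixes \<gamma> :: "complex^'n::finite \<Rightarrow> complex^'n"
  shows "Metric_space (Cp_space p \<gamma>) (Cp_dist p \<gamma>)"
proof
  note S = Cp_seminorm_diff_properties
  fix f g :: "complex^'n \<Rightarrow> complex"
  show "0 \<le> Cp_dist p \<gamma> f g"
  proof (cases "f \<in> Cp_space p \<gamma> \<and> g \<in> Cp_space p \<gamma>")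
    case True
    then have "0 \<le> min (Cp_seminorm \<gamma> [] (\<lambda>z. f z - g z)) (1 / real (Suc (length ([] :: 'n list))))"
      using S(1)[of f p \<gamma> g f "[]"] by simp
    also have "\<dots> \<le> Cp_dist p \<gamma> f g"
      using True by (intro Cp_dist_ge) auto
    finally show ?thesis .
  qed (auto simp: Cp_dist_def)
  show "Cp_dist p \<gamma> f g = Cp_dist p \<gamma> g f"
  proof (cases "f \<in> Cp_space p \<gamma> \<and> g \<in> Cp_space p \<gamma>")
    case True
    then have "Cp_seminorm \<gamma> js (\<lambda>z. f z - g z) = Cp_seminorm \<gamma> js (\<lambda>z. g z - f z)"
      if "enat (length js) \<le> p" for js
      using S(2)[of f p \<gamma> g f js] that by blast
    then show ?thesis
      unfolding Cp_dist_def using True by simp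
  qed (auto simp: Cp_dist_def)
  show "Cp_dist p \<gamma> f g = 0 \<longleftrightarrow> f = g" if fg: "f \<in> Cp_space p \<gamma>" "g \<in> Cp_space p \<gamma>"
  proof
    assume "Cp_dist p \<gamma> f g = 0"
    then have "\<not> Cp_seminorm \<gamma> [] (\<lambda>z. f z - g z) > 0"
      using Cp_dist_ge[OF fg, of "[]"] by auto
    then have "norm (f (\<gamma> z) - g (\<gamma> z)) \<le> 0" if "z \<in> torus" for z
      using Cp_seminorm_diff(2)[OF fg, of "[]", OF _ that] by (auto intro: order_trans simp del: norm_le_zero_iff)
    then show "f = g"
      by (intro Cp_space_eqI[OF fg]) simp
  next
    assume "f = g"
    then have "Cp_dist p \<gamma> f g \<le> 0"
      using S(4)[OF fg(1,1,1)] by (intro Cp_dist_le[OF fg]) auto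
    then show "Cp_dist p \<gamma> f g = 0"
      using \<open>0 \<le> Cp_dist p \<gamma> f g\<close> by simp
  qed
next
  note S = Cp_seminorm_diff_properties
  fix f g h :: "complex^'n \<Rightarrow> complex"
  assume fgh: "f \<in> Cp_space p \<gamma>" "g \<in> Cp_space p \<gamma>" "h \<in> Cp_space p \<gamma>"
  show "Cp_dist p \<gamma> f h \<le> Cp_dist p \<gamma> f g + Cp_dist p \<gamma> g h"
  proof (rule Cp_dist_le[OF fgh(1,3)])
    fix js :: "'n list" assume len: "enat (length js) \<le> p"
    have "(1::real) / real (Suc (length js)) > 0" by simp
    then show "min (Cp_seminorm \<gamma> js (\<lambda>z. f z - h z)) (1 / real (Suc (length js))) \<le>
        Cp_dist p \<gamma> f g + Cp_dist p \<gamma> g h"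
      using Cp_dist_ge[OF fgh(1,2) len] Cp_dist_ge[OF fgh(2,3) len] S(3)[OF fgh len]
        S(1)[OF fgh(1,2,3) len] S(1)[OF fgh(2,3,1) len] by linarith
  qed
qed

lemma topspace_Cp_topology:
  fixes \<gamma> :: "complex^'n::finite \<Rightarrow> complex^'n"
  shows "topspace (Cp_topology p \<gamma>) = Cp_space p \<gamma>"
proof -
  let ?\<B> = "{{g \<in> Cp_space p \<gamma>. Cp_seminorm \<gamma> js (\<lambda>z. g z - f z) < e} | f js e.
        f \<in> Cp_space p \<gamma> \<and> enat (length js) \<le> p \<and> e > 0}"
  have "f \<in> \<Union>?\<B>" if f: "f \<in> Cp_space p \<gamma>" for f
  proof
    show "f \<in> {g \<in> Cp_space p \<gamma>. Cp_seminorm \<gamma> [] (\<lambda>z. g z - f z) < 1}"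
      using f Cp_seminorm_diff_properties(4)[OF f f f, of "[]"] by simp
    show "{g \<in> Cp_space p \<gamma>. Cp_seminorm \<gamma> [] (\<lambda>z. g z - f z) < 1} \<in> ?\<B>"
      using f by (intro CollectI exI[of _ f] exI[of _ "[]"] exI[of _ "1 :: real"]) simp
  qed
  moreover have "\<Union>?\<B> \<subseteq> Cp_space p \<gamma>"
    by blast
  ultimately show ?thesis
    unfolding Cp_topology_def topology_generated_by_topspace by (intro equalityI subsetI) blast+
qed

lemma Cp_topology_metrized:
  fixes \<gamma> :: "complex^'n::finite \<Rightarrow> complex^'n"
  shows "Cp_topology p \<gamma> = Metric_space.mtopology (Cp_space p \<gamma>) (Cp_dist p \<gamma>)"
proof -
  interpret Metric_space "Cp_space p \<gamma>" "Cp_dist p \<gamma>"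
    by (rule Metric_space_Cp_space)
  note S = Cp_seminorm_diff_properties
  let ?\<B> = "{{g \<in> Cp_space p \<gamma>. Cp_seminorm \<gamma> js (\<lambda>z. g z - f z) < e} | f js e.
        f \<in> Cp_space p \<gamma> \<and> enat (length js) \<le> p \<and> e > 0}"
  have basis: "openin mtopology {g \<in> Cp_space p \<gamma>. Cp_seminorm \<gamma> js (\<lambda>z. g z - f z) < e}"
    if f: "f \<in> Cp_space p \<gamma>" and len: "enat (length js) \<le> p" for f js e
    unfolding openin_mtopology
  proof (intro conjI allI impI)
    fix g assume g: "g \<in> {g \<in> Cp_space p \<gamma>. Cp_seminorm \<gamma> js (\<lambda>z. g z - f z) < e}"
    define r where "r = min (e - Cp_seminorm \<gamma> js (\<lambda>z. g z - f z)) (1 / real (Suc (length js)))"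
    have "r > 0"
      using g by (auto simp: r_def)
    moreover have "Cp_seminorm \<gamma> js (\<lambda>z. h z - f z) < e" if h: "h \<in> mball g r" for h
    proof -
      have h': "h \<in> Cp_space p \<gamma>" "g \<in> Cp_space p \<gamma>" "Cp_dist p \<gamma> h g < r"
        using h by (auto simp: commute)
      then have "Cp_seminorm \<gamma> js (\<lambda>z. h z - g z) < e - Cp_seminorm \<gamma> js (\<lambda>z. g z - f z)"
        using Cp_seminorm_less_of_dist[OF h'(1,2) len] unfolding r_def by blast
      then show ?thesis
        using S(3)[OF h'(1,2) f len] by linarith
    qed
    ultimately show "\<exists>r>0. mball g r \<subseteq> {g \<in> Cp_space p \<gamma>. Cp_seminorm \<gamma> js (\<lambda>z. g z - f z) < e}"
      by (intro exI[of _ r]) auto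
  qed auto
  have "openin (Cp_topology p \<gamma>) U" if U: "openin mtopology U" for U
  proof (subst openin_subopen, intro ballI)
    fix f assume "f \<in> U"
    then obtain r where r: "r > 0" "mball f r \<subseteq> U" and f: "f \<in> Cp_space p \<gamma>"
      using U unfolding openin_mtopology by blast
    obtain k where k: "1 / real (Suc k) < r / 2"
      using r(1) nat_approx_posE[of "r / 2"] by auto
    define T where "T = {g \<in> Cp_space p \<gamma>. Cp_seminorm \<gamma> [] (\<lambda>z. g z - f z) < 1} \<inter>
      (\<Inter>js\<in>{js. length js \<le> k \<and> enat (length js) \<le> p}. {g \<in> Cp_space p \<gamma>. Cp_seminorm \<gamma> js (\<lambda>z. g z - f z) < r / 2})"
    have sub: "openin (Cp_topology p \<gamma>) {g \<in> Cp_space p \<gamma>. Cp_seminorm \<gamma> js (\<lambda>z. g z - f z) < e}"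
      if "enat (length js) \<le> p" "e > 0" for js e
      unfolding Cp_topology_def using that f by (intro topology_generated_by_Basis) auto
    have "openin (Cp_topology p \<gamma>) (\<Inter>js\<in>{js. length js \<le> k \<and> enat (length js) \<le> p}.
        {g \<in> Cp_space p \<gamma>. Cp_seminorm \<gamma> js (\<lambda>z. g z - f z) < r / 2})"
      using r(1) finite_derivatives_up_to[of k p, where 'n = 'n]
      by (intro openin_INT2 sub) (auto intro!: exI[of _ "[]"])
    then have "openin (Cp_topology p \<gamma>) T"
      unfolding T_def by (intro openin_Int sub) auto
    moreover have "f \<in> T"
      using f r(1) S(4)[OF f f f] by (auto simp: T_def)
    moreover have "T \<subseteq> U"
    proof
      fix g assume g: "g \<in> T"
      then have "g \<in> Cp_space p \<gamma>" by (auto simp: T_def)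
      moreover have "Cp_dist p \<gamma> g f \<le> r / 2"
        using g k by (intro Cp_dist_le_from_finitely_many[where k = k]) (auto simp: T_def f less_imp_le)
      ultimately have "g \<in> mball f r"
        using r(1) f by (auto simp: commute)
      then show "g \<in> U" using r(2) by blast
    qed
    ultimately show "\<exists>T. openin (Cp_topology p \<gamma>) T \<and> f \<in> T \<and> T \<subseteq> U" by blast
  qed
  moreover have "openin mtopology U" if "openin (Cp_topology p \<gamma>) U" for U
  proof (rule generate_topology_on_coarsest[OF istopology_openin])
    show "generate_topology_on ?\<B> U"
      using that unfolding Cp_topology_def by (rule openin_topology_generated_by)
    show "openin mtopology B" if "B \<in> ?\<B>" for B
      using that basis by blast
  qed
  ultimately show ?thesis
    by (intro topology_eq[THEN iffD2]) blast
qed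

lemma Cp_space_representative:
  fixes g :: "complex^'n::finite \<Rightarrow> complex"
  assumes "Cp_torus p g" "inj_on \<gamma> torus"
  obtains f where "f \<in> Cp_space p \<gamma>" "\<And>z. z \<in> torus \<Longrightarrow> f (\<gamma> z) = g z"
proof -
  define f where "f = restrict (g \<circ> inv_into torus \<gamma>) (\<gamma> ` torus)"
  have eq: "f (\<gamma> z) = g z" if "z \<in> torus" for z
    using that assms(2) by (simp add: f_def)
  have "Cp_torus p (f \<circ> \<gamma>)"
    by (rule Cp_torus_linear_combination(1)[OF assms(1,1), where a = 1 and b = 0]) (use eq in auto)
  moreover have "f \<in> extensional (\<gamma> ` torus)"
    unfolding f_def by simp
  ultimately show ?thesis
    using eq that[of f] by (simp add: Cp_space_def)
qed

lemma mcomplete_Cp_space: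
  fixes \<gamma> :: "complex^'n::finite \<Rightarrow> complex^'n"
  assumes inj: "inj_on \<gamma> torus"
  shows "Metric_space.mcomplete (Cp_space p \<gamma>) (Cp_dist p \<gamma>)"
proof -
  interpret Metric_space "Cp_space p \<gamma>" "Cp_dist p \<gamma>"
    by (rule Metric_space_Cp_space)
  show ?thesis
    unfolding mcomplete_def
  proof (intro allI impI)
    fix \<sigma> assume \<sigma>: "MCauchy \<sigma>"
    then have mem: "\<sigma> m \<in> Cp_space p \<gamma>" for m
      by (auto simp: MCauchy_def)
    have "uniformly_Cauchy_on torus (\<lambda>m. torus_deriv js (\<sigma> m \<circ> \<gamma>))" if len: "enat (length js) \<le> p" for js
    proof (rule uniformly_Cauchy_onI)
      fix e :: real assume "e > 0"
      then have "min e (1 / real (Suc (length js))) > 0" by simp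
      then obtain N where N: "\<And>m n. m \<ge> N \<Longrightarrow> n \<ge> N \<Longrightarrow>
          Cp_dist p \<gamma> (\<sigma> m) (\<sigma> n) < min e (1 / real (Suc (length js)))"
        using \<sigma> unfolding MCauchy_def by metis
      have "dist (torus_deriv js (\<sigma> m \<circ> \<gamma>) z) (torus_deriv js (\<sigma> n \<circ> \<gamma>) z) < e"
        if "z \<in> torus" "m \<ge> N" "n \<ge> N" for z m n
        using Cp_seminorm_diff(2)[OF mem mem len that(1)]
          Cp_seminorm_less_of_dist[OF mem mem len N[OF that(2,3)]]
        unfolding dist_norm by (rule le_less_trans)
      then show "\<exists>N. \<forall>z\<in>torus. \<forall>m\<ge>N. \<forall>n\<ge>N.
          dist (torus_deriv js (\<sigma> m \<circ> \<gamma>) z) (torus_deriv js (\<sigma> n \<circ> \<gamma>) z) < e"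
        by blast
    qed
    moreover have "Cp_torus p (\<sigma> m \<circ> \<gamma>)" for m
      using mem by (auto simp: Cp_space_def)
    ultimately obtain g where g: "Cp_torus p g" and ul: "\<And>js. enat (length js) \<le> p \<Longrightarrow>
        uniform_limit torus (\<lambda>m. torus_deriv js (\<sigma> m \<circ> \<gamma>)) (torus_deriv js g) sequentially"
      using Cp_torus_complete[of p "\<lambda>m. \<sigma> m \<circ> \<gamma>"] by blast
    obtain f where f: "f \<in> Cp_space p \<gamma>" and fg: "\<And>z. z \<in> torus \<Longrightarrow> f (\<gamma> z) = g z"
      using Cp_space_representative[OF g inj] by blast
    have deriv_eq: "torus_deriv js (f \<circ> \<gamma>) z = torus_deriv js g z"
      if "enat (length js) \<le> p" "z \<in> torus" for js z
      using Cp_torus_linear_combination(2)[OF g g, of "f \<circ> \<gamma>" 1 0] that fg by simp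
    have "\<forall>\<^sub>F m in sequentially. Cp_dist p \<gamma> (\<sigma> m) f < e" if e: "e > 0" for e
    proof -
      obtain k where k: "1 / real (Suc k) < e / 2"
        using e nat_approx_posE[of "e / 2"] by auto
      have "\<forall>\<^sub>F m in sequentially. \<forall>js\<in>{js. length js \<le> k \<and> enat (length js) \<le> p}.
          \<forall>z\<in>torus. dist (torus_deriv js (\<sigma> m \<circ> \<gamma>) z) (torus_deriv js g z) < e / 2"
      proof (rule eventually_ball_finite[OF finite_derivatives_up_to], rule ballI)
        fix js :: "'n list" assume "js \<in> {js. length js \<le> k \<and> enat (length js) \<le> p}"
        then show "\<forall>\<^sub>F m in sequentially.
            \<forall>z\<in>torus. dist (torus_deriv js (\<sigma> m \<circ> \<gamma>) z) (torus_deriv js g z) < e / 2"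
          using uniform_limitD[OF ul, of js "e / 2"] e by simp
      qed
      then show ?thesis
      proof eventually_elim
        case (elim m)
        have "Cp_dist p \<gamma> (\<sigma> m) f \<le> e / 2"
        proof (rule Cp_dist_le_from_finitely_many[OF mem f])
          show "1 / real (Suc k) \<le> e / 2" using k by simp
          show "Cp_seminorm \<gamma> js (\<lambda>z. \<sigma> m z - f z) \<le> e / 2"
            if "length js \<le> k" "enat (length js) \<le> p" for js
            using elim that by (intro Cp_seminorm_diff(1)[OF mem f]) (auto simp: deriv_eq dist_norm less_imp_le)
        qed
        then show ?case using e by linarith
      qed
    qed
    then show "\<exists>x. limitin mtopology \<sigma> x sequentially"
      using f mem by (intro exI[of _ f]) (simp add: limitin_metric)
  qed
qed

lemma Cp_closure_approximation:
  fixes \<gamma> :: "complex^'n::finite \<Rightarrow> complex^'n"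
  assumes f: "f \<in> Cp_topology p \<gamma> closure_of E" and e: "e > 0"
  obtains g where "g \<in> E" "\<And>z. z \<in> torus \<Longrightarrow> norm (g (\<gamma> z) - f (\<gamma> z)) < e"
proof -
  let ?B = "{g \<in> Cp_space p \<gamma>. Cp_seminorm \<gamma> [] (\<lambda>z. g z - f z) < e}"
  have f': "f \<in> Cp_space p \<gamma>"
    using f by (auto simp: in_closure_of topspace_Cp_topology)
  then have op: "openin (Cp_topology p \<gamma>) ?B"
    unfolding Cp_topology_def using e by (intro topology_generated_by_Basis) (auto intro!: exI[of _ f] exI[of _ "[]"])
  have fB: "f \<in> ?B"
    using f' e Cp_seminorm_diff_properties(4)[OF f' f' f', of "[]"] by simp
  have "\<And>T. f \<in> T \<Longrightarrow> openin (Cp_topology p \<gamma>) T \<Longrightarrow> \<exists>g. g \<in> E \<and> g \<in> T"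
    using f by (simp add: in_closure_of)
  from this[OF fB op] obtain g where g: "g \<in> E" "g \<in> ?B"
    by (elim exE conjE)
  show ?thesis
  proof (rule that[OF g(1)])
    fix z :: "complex^'n" assume "z \<in> torus"
    then show "norm (g (\<gamma> z) - f (\<gamma> z)) < e"
      using Cp_seminorm_diff(2)[OF _ f', of g "[]" z] g(2) by auto
  qed
qed

text \<open>Scaling by a small \<open>t\<close> makes the finitely many seminorms of \<open>t h\<close> that matter for a neighbourhood of \<open>f\<close>
  as small as required.\<close>

lemma Cp_small_perturbation:
  fixes \<gamma> :: "complex^'n::finite \<Rightarrow> complex^'n"
  assumes inj: "inj_on \<gamma> torus" and f: "f \<in> Cp_space p \<gamma>" and h: "h \<in> Cp_space p \<gamma>"
    and U: "openin (Cp_topology p \<gamma>) U" "f \<in> U"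
  obtains g t where "g \<in> U" "t \<noteq> 0" "\<And>z. z \<in> torus \<Longrightarrow> g (\<gamma> z) = f (\<gamma> z) + complex_of_real t * h (\<gamma> z)"
proof -
  interpret Metric_space "Cp_space p \<gamma>" "Cp_dist p \<gamma>"
    by (rule Metric_space_Cp_space)
  obtain r where r: "r > 0" "mball f r \<subseteq> U"
  proof -
    have "openin mtopology U"
      using U(1) unfolding Cp_topology_metrized .
    then have "\<forall>x. x \<in> U \<longrightarrow> (\<exists>r>0. mball x r \<subseteq> U)"
      unfolding openin_mtopology by (rule conjunct2)
    then show thesis
      using U(2) that by blast
  qed
  obtain k where k: "1 / real (Suc k) < r / 2"
    using r(1) nat_approx_posE[of "r / 2"] by auto
  define J where "J = {js :: 'n list. length js \<le> k \<and> enat (length js) \<le> p}"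
  have fh: "Cp_torus p (f \<circ> \<gamma>)" "Cp_torus p (h \<circ> \<gamma>)"
    using f h by (auto simp: Cp_space_def)
  have nonneg: "Cp_seminorm \<gamma> js h \<ge> 0" if "js \<in> J" for js
  proof -
    obtain w :: "complex^'n" where "w \<in> torus"
      using torus_nonempty by blast
    then have "norm (torus_deriv js (h \<circ> \<gamma>) w) \<le> Cp_seminorm \<gamma> js h"
      using that by (intro norm_le_Cp_seminorm[OF fh(2)]) (auto simp: J_def)
    then show ?thesis
      using norm_ge_zero order_trans by blast
  qed
  define s where "s = (\<Sum>js\<in>J. Cp_seminorm \<gamma> js h)"
  have s: "0 \<le> s" "\<And>js. js \<in> J \<Longrightarrow> Cp_seminorm \<gamma> js h \<le> s"
  proof -
    have "finite J"
      unfolding J_def by (rule finite_derivatives_up_to)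
    then show "Cp_seminorm \<gamma> js h \<le> s" if "js \<in> J" for js
      unfolding s_def using nonneg that by (intro member_le_sum) auto
    show "0 \<le> s"
      unfolding s_def using nonneg by (rule sum_nonneg)
  qed
  define t where "t = r / (2 * (1 + s))"
  have t: "t > 0" "t * s \<le> r / 2"
    using r(1) s(1) by (auto simp: t_def field_simps)
  have "Cp_torus p (\<lambda>z. f (\<gamma> z) + complex_of_real t * h (\<gamma> z))"
    by (rule Cp_torus_linear_combination(1)[OF fh, where a = 1 and b = "of_real t"]) auto
  then obtain g where g: "g \<in> Cp_space p \<gamma>"
    "\<And>z. z \<in> torus \<Longrightarrow> g (\<gamma> z) = f (\<gamma> z) + complex_of_real t * h (\<gamma> z)"
    using Cp_space_representative[OF _ inj] by blast
  have deriv: "torus_deriv js (g \<circ> \<gamma>) z = torus_deriv js (f \<circ> \<gamma>) z + of_real t * torus_deriv js (h \<circ> \<gamma>) z"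
    if "enat (length js) \<le> p" "z \<in> torus" for js z
    using Cp_torus_linear_combination(2)[OF fh, where a = 1 and b = "of_real t" and u = "g \<circ> \<gamma>"] that g(2)
    by simp
  have "Cp_dist p \<gamma> g f \<le> r / 2"
  proof (rule Cp_dist_le_from_finitely_many[OF g(1) f])
    show "1 / real (Suc k) \<le> r / 2" using k by simp
    fix js :: "'n list" assume len: "length js \<le> k" "enat (length js) \<le> p"
    show "Cp_seminorm \<gamma> js (\<lambda>z. g z - f z) \<le> r / 2"
    proof (rule Cp_seminorm_diff(1)[OF g(1) f len(2)])
      fix z :: "complex^'n" assume z: "z \<in> torus"
      have "norm (torus_deriv js (g \<circ> \<gamma>) z - torus_deriv js (f \<circ> \<gamma>) z) = t * norm (torus_deriv js (h \<circ> \<gamma>) z)"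
        using t(1) by (simp add: deriv[OF len(2) z] norm_mult)
      also have "\<dots> \<le> t * s"
        using norm_le_Cp_seminorm[OF fh(2) len(2) z] s(2)[of js] len t(1) by (auto simp: J_def)
      finally show "norm (torus_deriv js (g \<circ> \<gamma>) z - torus_deriv js (f \<circ> \<gamma>) z) \<le> r / 2"
        using t(2) by linarith
    qed
  qed
  then have "g \<in> mball f r"
    using r(1) f g(1) by (auto simp: commute)
  then show ?thesis
    using that[of g t] r(2) t(1) g(2) by blast
qed

text \<open>An open set inside the closure of \<open>E\<close> would contain two functions that differ by a nonzero multiple of
  \<open>h\<close>, whatever \<open>h\<close> is. Excluding this for a single \<open>h\<close> makes the closures nowhere dense, and Baire's theorem
  applies.\<close>

lemma dense_gdelta_complement:
  fixes \<gamma> :: "complex^'n::finite \<Rightarrow> complex^'n"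
  assumes inj: "inj_on \<gamma> torus" and countable: "countable \<E>" and A: "A = \<Union>\<E>"
    and closure: "\<And>E. E \<in> \<E> \<Longrightarrow> Cp_topology p \<gamma> closure_of E \<subseteq> A"
    and direction: "\<And>E. E \<in> \<E> \<Longrightarrow> \<exists>h\<in>Cp_space p \<gamma>. \<forall>f\<in>Cp_topology p \<gamma> closure_of E.
      \<forall>g\<in>Cp_topology p \<gamma> closure_of E. \<forall>t. t \<noteq> 0 \<longrightarrow>
        (\<exists>z\<in>torus. g (\<gamma> z) \<noteq> f (\<gamma> z) + complex_of_real t * h (\<gamma> z))"
  shows "dense_gdelta_in (Cp_topology p \<gamma>) (Cp_space p \<gamma> - A)"
proof -
  let ?X = "Cp_topology p \<gamma>"
  interpret Metric_space "Cp_space p \<gamma>" "Cp_dist p \<gamma>"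
    by (rule Metric_space_Cp_space)
  have empty: "?X interior_of (?X closure_of E) = {}" if E: "E \<in> \<E>" for E
  proof (rule ccontr)
    assume "?X interior_of (?X closure_of E) \<noteq> {}"
    then obtain f where f: "f \<in> ?X interior_of (?X closure_of E)" by blast
    obtain h where h: "h \<in> Cp_space p \<gamma>" and dir: "\<And>f g t. f \<in> ?X closure_of E \<Longrightarrow> g \<in> ?X closure_of E \<Longrightarrow> t \<noteq> 0 \<Longrightarrow>
        (\<exists>z\<in>torus. g (\<gamma> z) \<noteq> f (\<gamma> z) + complex_of_real t * h (\<gamma> z))"
      using direction[OF E] by blast
    have "f \<in> Cp_space p \<gamma>"
      using f by (metis interior_of_subset_topspace subsetD topspace_Cp_topology)
    then obtain g t where "g \<in> ?X interior_of (?X closure_of E)" "t \<noteq> 0"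
      "\<And>z. z \<in> torus \<Longrightarrow> g (\<gamma> z) = f (\<gamma> z) + complex_of_real t * h (\<gamma> z)"
      using Cp_small_perturbation[OF inj _ h openin_interior_of f] by metis
    then show False
      using dir[of f g t] f interior_of_subset[of ?X "?X closure_of E"] by blast
  qed
  define \<G> where "\<G> = (\<lambda>E. Cp_space p \<gamma> - ?X closure_of E) ` \<E>"
  have eq: "Cp_space p \<gamma> - A = Cp_space p \<gamma> \<inter> \<Inter>\<G>"
  proof -
    have "f \<in> ?X closure_of E" if "f \<in> E" "f \<in> Cp_space p \<gamma>" for f E
      using that by (auto simp: in_closure_of topspace_Cp_topology)
    then show ?thesis
      using closure unfolding A \<G>_def by blast
  qed
  have op: "openin ?X T" and dense: "?X closure_of T = Cp_space p \<gamma>" if T: "T \<in> \<G>" for T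
  proof -
    obtain E where E: "E \<in> \<E>" "T = topspace ?X - ?X closure_of E"
      using T unfolding \<G>_def topspace_Cp_topology by blast
    show "openin ?X T"
      unfolding E(2) by (intro openin_diff openin_topspace closedin_closure_of)
    show "?X closure_of T = Cp_space p \<gamma>"
      unfolding E(2) closure_of_complement empty[OF E(1)] by (simp add: topspace_Cp_topology)
  qed
  have countable': "countable \<G>"
    unfolding \<G>_def using countable by (rule countable_image)
  have "mtopology closure_of \<Inter>\<G> = Cp_space p \<gamma>"
    using op dense unfolding Cp_topology_metrized
    by (intro metric_Baire_category mcomplete_Cp_space[OF inj] countable') blast
  then have "?X closure_of \<Inter>\<G> = Cp_space p \<gamma>"
    unfolding Cp_topology_metrized .
  then have "?X closure_of (Cp_space p \<gamma> - A) = Cp_space p \<gamma>"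
    using closure_of_restrict[of ?X "\<Inter>\<G>"] unfolding eq topspace_Cp_topology by simp
  moreover have "gdelta_in ?X (Cp_space p \<gamma> - A)"
  proof -
    have "openin ?X (Cp_space p \<gamma>)"
      by (metis openin_topspace topspace_Cp_topology)
    then have "gdelta_in ?X (\<Inter> (insert (Cp_space p \<gamma>) \<G>))"
      using op countable' by (intro gdelta_in_Inter) (auto intro: open_imp_gdelta_in)
    then show ?thesis unfolding eq by simp
  qed
  ultimately show ?thesis
    by (simp add: dense_gdelta_in_def topspace_Cp_topology)
qed

section \<open>Holomorphic functions of several variables\<close>

lemma replace_coord_simps [simp]:
  "replace_coord j w z $ i = (if i = j then w else z $ i)"
  "replace_coord j (z $ j) z = (z :: complex^'n::finite)"
  by (auto simp: replace_coord_def vec_eq_iff)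

lemma replace_coord_commute:
  "i \<noteq> j \<Longrightarrow> replace_coord i v (replace_coord j w z) = replace_coord j w (replace_coord i v (z :: complex^'n::finite))"
  by (auto simp: vec_eq_iff)

lemma has_derivative_vec_componentwise:
  fixes f :: "'a::real_normed_vector \<Rightarrow> complex^'n::finite"
  assumes "\<And>i. ((\<lambda>x. f x $ i) has_derivative (\<lambda>v. f' v $ i)) F"
  shows "(f has_derivative f') F"
proof -
  have sum_axis: "(\<Sum>i\<in>UNIV. axis i (v $ i)) = v" for v :: "complex^'n"
    by (simp add: vec_eq_iff axis_def if_distrib cong: if_cong)
  have "((\<lambda>x. \<Sum>i\<in>UNIV. axis i (f x $ i)) has_derivative (\<lambda>v. \<Sum>i\<in>UNIV. axis i (f' v $ i))) F"
  proof (intro has_derivative_sum)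
    fix i :: 'n
    have "linear (axis i :: complex \<Rightarrow> complex^'n)"
      by (rule linearI) (auto simp: axis_def vec_eq_iff)
    then have "bounded_linear (axis i :: complex \<Rightarrow> complex^'n)"
      by (simp add: linear_conv_bounded_linear)
    from bounded_linear.has_derivative[OF this assms[of i]]
    show "((\<lambda>x. axis i (f x $ i)) has_derivative (\<lambda>v. axis i (f' v $ i))) F" .
  qed
  then show ?thesis
    by (simp add: sum_axis)
qed

lemma norm_complex_smult: "norm (w *s (h :: complex^'n::finite)) = norm w * norm h"
  by (simp add: norm_vec_def norm_mult L2_set_right_distrib)

lemma holomorphic_several_at:
  fixes F :: "complex^'n::finite \<Rightarrow> complex"
  assumes "holomorphic_several F U" "open U" "z \<in> U"
  obtains F' where "(F has_derivative F') (at z)" "\<And>c v. F' (c *s v) = c * F' v"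
  using assms at_within_open[of z U] unfolding holomorphic_several_def by metis

lemma holomorphic_severalI:
  fixes F :: "complex^'n::finite \<Rightarrow> complex"
  assumes "\<And>z. z \<in> U \<Longrightarrow> \<exists>F'. (F has_derivative F') (at z) \<and> (\<forall>c v. F' (c *s v) = c * F' v)"
  shows "holomorphic_several F U"
  using assms has_derivative_at_withinI unfolding holomorphic_several_def by blast

lemma holomorphic_several_subset:
  "holomorphic_several F U \<Longrightarrow> V \<subseteq> U \<Longrightarrow> holomorphic_several F V"
  unfolding holomorphic_several_def using has_derivative_subset by blast

lemma holomorphic_several_cong:
  fixes F :: "complex^'n::finite \<Rightarrow> complex"
  assumes "\<And>z. z \<in> U \<Longrightarrow> F z = G z"
  shows "holomorphic_several F U \<longleftrightarrow> holomorphic_several G U"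
proof -
  have "holomorphic_several B U" if A: "holomorphic_several A U" and eq: "\<And>z. z \<in> U \<Longrightarrow> A z = B z"
    for A B :: "complex^'n \<Rightarrow> complex"
    unfolding holomorphic_several_def
  proof
    fix z assume z: "z \<in> U"
    then obtain F' where F': "(A has_derivative F') (at z within U)" "\<forall>c v. F' (c *s v) = c * F' v"
      using A unfolding holomorphic_several_def by blast
    have "(B has_derivative F') (at z within U)"
      using has_derivative_transform[OF z eq[symmetric] F'(1)] .
    then show "\<exists>F'. (B has_derivative F') (at z within U) \<and> (\<forall>c v. F' (c *s v) = c * F' v)"
      using F'(2) by blast
  qed
  then show ?thesis using assms by metis
qed

lemma holomorphic_several_imp_continuous_on:
  "holomorphic_several F U \<Longrightarrow> continuous_on U F"
  unfolding holomorphic_several_def continuous_on_eq_continuous_within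
  using has_derivative_continuous by blast

lemma holomorphic_several_diff:
  fixes F :: "complex^'n::finite \<Rightarrow> complex"
  assumes "holomorphic_several F U" "holomorphic_several G U"
  shows "holomorphic_several (\<lambda>z. F z - G z) U"
  unfolding holomorphic_several_def
proof
  fix z assume "z \<in> U"
  then obtain F' G' where "(F has_derivative F') (at z within U)" "\<forall>c v. F' (c *s v) = c * F' v"
    "(G has_derivative G') (at z within U)" "\<forall>c v. G' (c *s v) = c * G' v"
    using assms unfolding holomorphic_several_def by metis
  then show "\<exists>F'. ((\<lambda>z. F z - G z) has_derivative F') (at z within U) \<and> (\<forall>c v. F' (c *s v) = c * F' v)"
    by (intro exI[of _ "\<lambda>v. F' v - G' v"]) (auto intro: has_derivative_diff simp: right_diff_distrib)
qed

lemma has_field_derivative_along_complex_line: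
  fixes F :: "complex^'n::finite \<Rightarrow> complex"
  assumes F: "(F has_derivative F') (at (z + w *s h))" and lin: "\<And>c v. F' (c *s v) = c * F' v"
  shows "((\<lambda>w. F (z + w *s h)) has_field_derivative F' h) (at w)"
proof -
  have "((\<lambda>w. z + w *s h) has_derivative (\<lambda>v. v *s h)) (at w)"
    by (rule has_derivative_vec_componentwise) (auto intro!: derivative_eq_intros)
  from has_derivative_compose[OF this F]
  have "((\<lambda>x. F (z + x *s h)) has_derivative (\<lambda>x. F' (x *s h))) (at w)" .
  moreover have "(\<lambda>v. F' (v *s h)) = (*) (F' h)"
    by (auto simp: lin mult.commute)
  ultimately show ?thesis
    by (simp add: has_field_derivative_def)
qed

lemma holomorphic_several_slice:
  fixes F :: "complex^'n::finite \<Rightarrow> complex"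
  assumes F: "holomorphic_several F U" and U: "open U"
    and A: "open A" "\<And>w. w \<in> A \<Longrightarrow> replace_coord j w z \<in> U"
  shows "(\<lambda>w. F (replace_coord j w z)) holomorphic_on A"
  unfolding holomorphic_on_open[OF A(1)]
proof
  fix w assume "w \<in> A"
  then obtain F' where F': "(F has_derivative F') (at (replace_coord j w z))" "\<And>c v. F' (c *s v) = c * F' v"
    using holomorphic_several_at[OF F U] A(2) by metis
  define a where "a = replace_coord j 0 z"
  have eq: "replace_coord j w z = a + w *s axis j 1" for w
    by (auto simp: a_def vec_eq_iff axis_def)
  have "((\<lambda>w. F (a + w *s axis j 1)) has_field_derivative F' (axis j 1)) (at w)"
    by (rule has_field_derivative_along_complex_line[OF F'(1)[unfolded eq] F'(2)])
  then show "\<exists>f'. ((\<lambda>w. F (replace_coord j w z)) has_field_derivative f') (at w)"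
    unfolding eq by (rule exI)
qed

lemma holomorphic_several_compose_map_product:
  fixes h :: "'n::finite \<Rightarrow> complex \<Rightarrow> complex"
  assumes F: "holomorphic_several F U" "open U"
    and h: "\<And>i. h i holomorphic_on A i" "\<And>i. open (A i)"
    and V: "V \<subseteq> set_product A" "\<And>z. z \<in> V \<Longrightarrow> map_product h z \<in> U"
  shows "holomorphic_several (\<lambda>z. F (map_product h z)) V"
proof (rule holomorphic_severalI)
  fix z assume z: "z \<in> V"
  obtain F' where F': "(F has_derivative F') (at (map_product h z))" "\<And>c v. F' (c *s v) = c * F' v"
    using holomorphic_several_at[OF F V(2)[OF z]] by metis
  have der: "(h i has_field_derivative deriv (h i) (z $ i)) (at (z $ i))" for i
    using h z V(1) by (intro holomorphic_derivI) (auto simp: set_product_def)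
  have comp: "((\<lambda>x. h i (x $ i)) has_derivative (\<lambda>v. deriv (h i) (z $ i) * v $ i)) (at z)" for i
  proof -
    have "((\<lambda>x. x $ i) has_derivative (\<lambda>v. v $ i)) (at z)"
      by (intro bounded_linear_imp_has_derivative bounded_linear_vec_nth)
    from has_derivative_compose[OF this der[of i, unfolded has_field_derivative_def]]
    show ?thesis .
  qed
  have "(map_product h has_derivative (\<lambda>v. \<chi> i. deriv (h i) (z $ i) * v $ i)) (at z)"
    by (rule has_derivative_vec_componentwise) (use comp in \<open>simp add: map_product_def\<close>)
  from has_derivative_compose[OF this F'(1)]
  have "((\<lambda>z. F (map_product h z)) has_derivative (\<lambda>v. F' (\<chi> i. deriv (h i) (z $ i) * v $ i))) (at z)" .
  moreover have "F' (\<chi> i. deriv (h i) (z $ i) * (c *s v) $ i) = c * F' (\<chi> i. deriv (h i) (z $ i) * v $ i)" for c v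
  proof -
    have "(\<chi> i. deriv (h i) (z $ i) * (c *s v) $ i) = c *s (\<chi> i. deriv (h i) (z $ i) * v $ i)"
      by (simp add: vec_eq_iff)
    then show ?thesis by (simp only: F'(2))
  qed
  ultimately show "\<exists>F'. ((\<lambda>z. F (map_product h z)) has_derivative F') (at z) \<and> (\<forall>c v. F' (c *s v) = c * F' v)"
    by blast
qed

text \<open>Cauchy's estimate on the complex line through \<open>z\<close> in the direction \<open>h\<close> bounds the whole
  Frechet derivative, since \<open>F'\<close> is complex linear.\<close>

lemma Cauchy_estimate_several:
  fixes F :: "complex^'n::finite \<Rightarrow> complex"
  assumes F: "holomorphic_several F U" "open U" and r: "0 < r" "ball z r \<subseteq> U"
    and bound: "\<And>x. x \<in> ball z r \<Longrightarrow> norm (F x) \<le> B"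
    and F': "(F has_derivative F') (at z)" "\<And>c v. F' (c *s v) = c * F' v"
  shows "norm (F' h) \<le> 2 * B / r * norm h"
proof (cases "h = 0")
  case True
  then show ?thesis using F'(2)[of 0 0] by simp
next
  case False
  define s where "s = r / (2 * norm h)"
  have s: "s > 0" using r False by (simp add: s_def)
  have mem: "z + w *s h \<in> ball z r" if "w \<in> cball 0 s" for w
  proof -
    have "norm w * norm h \<le> s * norm h"
      using that by (intro mult_right_mono) auto
    also have "\<dots> < r" using False r by (simp add: s_def)
    finally show ?thesis by (simp add: dist_norm norm_complex_smult)
  qed
  let ?G = "\<lambda>w. F (z + w *s h)"
  have der: "\<exists>f'. (?G has_field_derivative f') (at w)" if w: "w \<in> cball 0 s" for w
  proof -
    have "z + w *s h \<in> U"
      using mem[OF w] r(2) by blast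
    then obtain F1 where "(F has_derivative F1) (at (z + w *s h))" "\<And>c v. F1 (c *s v) = c * F1 v"
      using holomorphic_several_at[OF F] by metis
    then show ?thesis using has_field_derivative_along_complex_line by blast
  qed
  have "norm ((deriv ^^ 1) ?G 0) \<le> fact 1 * B / s ^ 1"
  proof (rule Cauchy_inequality)
    show "?G holomorphic_on ball 0 s"
      using der by (auto simp: holomorphic_on_open)
    show "continuous_on (cball 0 s) ?G"
      using der DERIV_isCont by (intro continuous_at_imp_continuous_on) blast
    show "norm (?G x) \<le> B" if "norm (0 - x) = s" for x
      using that mem[of x] bound by auto
  qed (fact s)
  moreover have "deriv ?G 0 = F' h"
    using has_field_derivative_along_complex_line[of F F' z 0 h] F' by (intro DERIV_imp_deriv) simp
  ultimately show ?thesis by (simp add: s_def field_simps)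
qed

text \<open>By the previous estimate the Frechet derivatives converge uniformly near every point, so the limit is
  differentiable, and its derivative is complex linear as a limit of such maps.\<close>

lemma holomorphic_several_uniform_limit:
  fixes F :: "nat \<Rightarrow> complex^'n::finite \<Rightarrow> complex"
  assumes F: "\<And>m. holomorphic_several (F m) U" and U: "open U"
    and lim: "uniform_limit U F G sequentially"
  shows "holomorphic_several G U"
proof (rule holomorphic_severalI)
  fix z0 assume z0: "z0 \<in> U"
  obtain r where r: "r > 0" "ball z0 (2 * r) \<subseteq> U"
    using U z0 openE[of U z0] by (metis field_sum_of_halves half_gt_zero mult_2)
  have sub: "ball z r \<subseteq> U" if "z \<in> ball z0 r" for z
  proof -
    have "ball z r \<subseteq> ball z0 (2 * r)"
      using that by (intro ball_subset_ball_iff[THEN iffD2]) (auto simp: dist_commute)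
    then show ?thesis using r(2) by blast
  qed
  have zU: "z \<in> U" if "z \<in> ball z0 r" for z
    using sub[OF that] r(1) by auto
  have "\<forall>m z. \<exists>F'. z \<in> U \<longrightarrow> (F m has_derivative F') (at z) \<and> (\<forall>c v. F' (c *s v) = c * F' v)"
    using holomorphic_several_at[OF F U] by metis
  then obtain D where D: "\<And>m z. z \<in> U \<Longrightarrow> (F m has_derivative D m z) (at z)"
    "\<And>m z c v. z \<in> U \<Longrightarrow> D m z (c *s v) = c * D m z v"
    by metis
  have close: "\<exists>N. \<forall>m\<ge>N. \<forall>n\<ge>N. \<forall>z\<in>ball z0 r. \<forall>h. norm (D m z h - D n z h) \<le> e * norm h" if e: "e > 0" for e
  proof -
    have "uniformly_Cauchy_on U F"
      using lim uniformly_convergent_Cauchy uniformly_convergentI by blast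
    then obtain N where N: "\<forall>x\<in>U. \<forall>m\<ge>N. \<forall>n\<ge>N. dist (F m x) (F n x) < e * r / 2"
      using e r(1) unfolding uniformly_Cauchy_on_def by (metis half_gt_zero mult_pos_pos)
    have "norm (D m z h - D n z h) \<le> e * norm h" if mn: "m \<ge> N" "n \<ge> N" and z: "z \<in> ball z0 r" for m n z h
    proof -
      have "norm (D m z h - D n z h) \<le> 2 * (e * r / 2) / r * norm h"
      proof (rule Cauchy_estimate_several[OF holomorphic_several_diff[OF F F] U r(1) sub[OF z]])
        show "norm (F m x - F n x) \<le> e * r / 2" if "x \<in> ball z r" for x
          using N mn sub[OF z] that by (metis dist_norm less_imp_le subsetD)
        show "((\<lambda>z. F m z - F n z) has_derivative (\<lambda>h. D m z h - D n z h)) (at z)"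
          by (intro has_derivative_diff D zU z)
        show "D m z (c *s v) - D n z (c *s v) = c * (D m z v - D n z v)" for c v
          by (simp add: D(2)[OF zU[OF z]] right_diff_distrib)
      qed
      then show ?thesis using r(1) by simp
    qed
    then show ?thesis by blast
  qed
  define L where "L = (\<lambda>z h. lim (\<lambda>m. D m z h))"
  have conv: "(\<lambda>m. D m z h) \<longlonglongrightarrow> L z h" if z: "z \<in> ball z0 r" for z h
  proof -
    have "Cauchy (\<lambda>m. D m z h)"
    proof (rule metric_CauchyI)
      fix e :: real assume e: "e > 0"
      define e' where "e' = e / (norm h + 1)"
      have pos: "norm h + 1 > 0"
        using norm_ge_zero[of h] by linarith
      then have e': "e' > 0"
        using e by (simp add: e'_def)
      have "e' * (norm h + 1) = e"
        using pos by (simp add: e'_def)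
      then have e'': "e' * norm h < e"
        using e' by (simp add: distrib_left)
      obtain N where "\<forall>m\<ge>N. \<forall>n\<ge>N. \<forall>z\<in>ball z0 r. \<forall>h. norm (D m z h - D n z h) \<le> e' * norm h"
        using close[OF e'] by blast
      then show "\<exists>N. \<forall>m\<ge>N. \<forall>n\<ge>N. dist (D m z h) (D n z h) < e"
        using e'' z unfolding dist_norm by (metis le_less_trans)
    qed
    then show ?thesis
      unfolding L_def using Cauchy_convergent_iff convergent_LIMSEQ_iff by blast
  qed
  have "\<exists>g. \<forall>x\<in>ball z0 r. (\<lambda>n. F n x) \<longlonglongrightarrow> g x \<and> (g has_derivative L x) (at x within ball z0 r)"
  proof (rule has_derivative_sequence[OF convex_ball])
    show "(F m has_derivative D m x) (at x within ball z0 r)" if "x \<in> ball z0 r" for m x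
      using D(1)[OF zU[OF that]] by (rule has_derivative_at_withinI)
    show "z0 \<in> ball z0 r" using r(1) by simp
    show "(\<lambda>n. F n z0) \<longlonglongrightarrow> G z0"
      by (rule tendsto_uniform_limitI[OF lim z0])
    fix e :: real assume "e > 0"
    then obtain N where N: "\<forall>m\<ge>N. \<forall>n\<ge>N. \<forall>z\<in>ball z0 r. \<forall>h. norm (D m z h - D n z h) \<le> e * norm h"
      using close by blast
    have "norm (D m x h - L x h) \<le> e * norm h" if "m \<ge> N" "x \<in> ball z0 r" for m x h
    proof (rule LIMSEQ_le_const2)
      show "(\<lambda>n. norm (D m x h - D n x h)) \<longlonglongrightarrow> norm (D m x h - L x h)"
        by (intro tendsto_intros conv that)
      show "\<exists>N. \<forall>n\<ge>N. norm (D m x h - D n x h) \<le> e * norm h"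
        using N that by blast
    qed
    then show "\<forall>\<^sub>F m in sequentially. \<forall>x\<in>ball z0 r. \<forall>h. norm (D m x h - L x h) \<le> e * norm h"
      unfolding eventually_sequentially by blast
  qed
  then obtain g where g: "\<And>x. x \<in> ball z0 r \<Longrightarrow> (\<lambda>n. F n x) \<longlonglongrightarrow> g x"
    "\<And>x. x \<in> ball z0 r \<Longrightarrow> (g has_derivative L x) (at x within ball z0 r)"
    by blast
  have gG: "G x = g x" if "x \<in> ball z0 r" for x
    using LIMSEQ_unique[OF tendsto_uniform_limitI[OF lim zU[OF that]] g(1)[OF that]] .
  have z0r: "z0 \<in> ball z0 r" using r(1) by simp
  have "(G has_derivative L z0) (at z0 within ball z0 r)"
    using has_derivative_transform[OF z0r gG g(2)[OF z0r]] .
  then have "(G has_derivative L z0) (at z0)"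
    using at_within_open[OF z0r] by simp
  moreover have "L z0 (c *s v) = c * L z0 v" for c v
    using LIMSEQ_unique[OF conv[OF z0r, of "c *s v"]] tendsto_mult_left[OF conv[OF z0r, of v], of c]
    by (simp add: D(2)[OF z0])
  ultimately show "\<exists>F'. (G has_derivative F') (at z0) \<and> (\<forall>c v. F' (c *s v) = c * F' v)"
    by blast
qed


section \<open>Corners of the polydisc\<close>

text \<open>Neighbourhoods of \<open>\<xi>\<close> in the sup norm, because their slices in one variable do not depend on the other
  variables.\<close>

definition corner :: "complex^'n \<Rightarrow> real \<Rightarrow> (complex^'n) set" where
  "corner \<xi> \<rho> = set_product (\<lambda>i. cball 0 1 \<inter> ball (\<xi> $ i) \<rho>)"

definition open_corner :: "complex^'n \<Rightarrow> real \<Rightarrow> (complex^'n) set" where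
  "open_corner \<xi> \<rho> = set_product (\<lambda>i. ball 0 1 \<inter> ball (\<xi> $ i) \<rho>)"

lemma corner_iff: "z \<in> corner \<xi> \<rho> \<longleftrightarrow> (\<forall>i. norm (z $ i) \<le> 1 \<and> dist (\<xi> $ i) (z $ i) < \<rho>)"
  by (simp add: corner_def set_product_def)

lemma open_corner_iff: "z \<in> open_corner \<xi> \<rho> \<longleftrightarrow> (\<forall>i. norm (z $ i) < 1 \<and> dist (\<xi> $ i) (z $ i) < \<rho>)"
  by (simp add: open_corner_def set_product_def)

lemma torus_iff: "z \<in> torus \<longleftrightarrow> (\<forall>i. norm (z $ i) = 1)"
  by (simp add: torus_def set_product_def)

lemma open_open_corner: "open (open_corner \<xi> \<rho> :: (complex^'n::finite) set)"
  unfolding open_corner_def by (intro open_set_product open_Int open_ball)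

lemma open_corner_subset: "open_corner \<xi> \<rho> \<subseteq> corner \<xi> \<rho>"
  by (auto simp: corner_iff open_corner_iff less_imp_le)

lemma corner_mono: "\<rho> \<le> \<sigma> \<Longrightarrow> corner \<xi> \<rho> \<subseteq> corner \<xi> \<sigma>"
  unfolding subset_iff corner_iff by (meson less_le_trans)

lemma open_corner_mono: "\<rho> \<le> \<sigma> \<Longrightarrow> open_corner \<xi> \<rho> \<subseteq> open_corner \<xi> \<sigma>"
  unfolding subset_iff open_corner_iff by (meson less_le_trans)

text \<open>The linear function \<open>q\<close> below has real part at most \<open>1\<close> on the disc and vanishing real part on
  the chord that cuts off the cap around \<open>\<xi>\<close>. Multiplying \<open>G\<close> by \<open>exp (ln (M / \<epsilon>) q)\<close> therefore equalizes
  the bounds \<open>M\<close> on the chord and \<open>\<epsilon>\<close> on the arc, and the maximum principle applies.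
  Where the real part of \<open>q\<close> is at least \<open>1/2\<close>, the factor is at least \<open>sqrt (M / \<epsilon>)\<close> in modulus.\<close>

lemma two_constants_arc:
  fixes G :: "complex \<Rightarrow> complex"
  assumes \<xi>: "norm \<xi> = 1" and \<rho>: "0 < \<rho>" "\<rho> \<le> 1"
    and cont: "continuous_on (cball 0 1 \<inter> ball \<xi> \<rho>) G"
    and hol: "G holomorphic_on ball 0 1 \<inter> ball \<xi> \<rho>"
    and M: "\<And>w. w \<in> cball 0 1 \<inter> ball \<xi> \<rho> \<Longrightarrow> norm (G w) \<le> M"
    and \<epsilon>: "\<And>w. w \<in> sphere 0 1 \<inter> ball \<xi> \<rho> \<Longrightarrow> norm (G w) \<le> \<epsilon>"
    and \<epsilon>M: "0 < \<epsilon>" "\<epsilon> \<le> M"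
    and w: "w \<in> cball 0 1 \<inter> ball \<xi> (\<rho>\<^sup>2 / 8)"
  shows "norm (G w) \<le> sqrt (M * \<epsilon>)"
proof -
  \<comment> \<open>the chord is \<open>Re (cnj \<xi> z) = s\<close>; points of the disc between it and the arc have distance at most
    \<open>sqrt (2 (1 - s)) < \<rho>\<close> from \<open>\<xi>\<close>\<close>
  define s where "s = 1 - \<rho>\<^sup>2 / 4"
  define A where "A = ln (M / \<epsilon>)"
  define q where "q = (\<lambda>z. (cnj \<xi> * z - of_real s) / of_real (1 - s))"
  define S where "S = {z. norm z \<le> 1 \<and> s \<le> Re (cnj \<xi> * z)}"
  have rho2: "0 < \<rho>\<^sup>2" "\<rho>\<^sup>2 \<le> \<rho>"
    using \<rho> by (auto simp: power2_eq_square mult_left_le)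
  have s1: "1 - s > 0" using rho2 by (simp add: s_def)
  have A: "A \<ge> 0" "exp A = M / \<epsilon>"
    using \<epsilon>M by (auto simp: A_def)
  have dist2: "(dist \<xi> z)\<^sup>2 = 1 + (norm z)\<^sup>2 - 2 * Re (cnj \<xi> * z)" for z
  proof -
    have "(Re \<xi>)\<^sup>2 + (Im \<xi>)\<^sup>2 = 1"
      using \<xi> by (metis cmod_power2 one_power2)
    then show ?thesis
      unfolding dist_norm cmod_power2 by (simp add: power2_eq_square algebra_simps)
  qed
  have S_sub: "S \<subseteq> cball 0 1 \<inter> ball \<xi> \<rho>"
  proof
    fix z assume z: "z \<in> S"
    then have "(norm z)\<^sup>2 \<le> 1"
      by (auto simp: S_def power_le_one)
    moreover have "1 - \<rho>\<^sup>2 / 4 \<le> Re (cnj \<xi> * z)"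
      using z by (simp add: S_def s_def)
    ultimately have "(dist \<xi> z)\<^sup>2 < \<rho>\<^sup>2"
      using rho2(1) unfolding dist2 by linarith
    then have "dist \<xi> z < \<rho>"
      using \<rho>(1) power2_less_imp_less by fastforce
    then show "z \<in> cball 0 1 \<inter> ball \<xi> \<rho>"
      using z by (auto simp: S_def)
  qed
  have "closed S"
    unfolding S_def Collect_conj_eq by (intro closed_Int closed_Collect_le continuous_intros)
  then have closure_S: "closure S = S" by simp
  have int_S: "interior S \<subseteq> ball 0 1 \<inter> ball \<xi> \<rho>"
  proof -
    have "interior S \<subseteq> interior (cball 0 1)"
      using S_sub by (intro interior_mono) blast
    then show ?thesis
      using S_sub interior_subset[of S] by auto
  qed
  have frontier: "norm z = 1 \<or> Re (cnj \<xi> * z) = s" if z: "z \<in> frontier S" for z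
  proof (rule ccontr)
    assume "\<not> ?thesis"
    moreover have "z \<in> S" "z \<notin> interior S"
      using z closure_S by (auto simp: frontier_def)
    ultimately have z': "z \<in> ball 0 1 \<inter> {z. s < Re (cnj \<xi> * z)}"
      by (auto simp: S_def)
    have "open (ball 0 1 \<inter> {z. s < Re (cnj \<xi> * z)})"
      by (intro open_Int open_ball open_Collect_less continuous_intros)
    moreover have "ball 0 1 \<inter> {z. s < Re (cnj \<xi> * z)} \<subseteq> S"
      by (auto simp: S_def)
    ultimately have "z \<in> interior S"
      using z' by (meson interiorI)
    then show False using \<open>z \<notin> interior S\<close> by blast
  qed
  define g where "g = (\<lambda>z. G z * exp (of_real A * q z))"
  have Re_q: "Re (q z) = (Re (cnj \<xi> * z) - s) / (1 - s)" for z
    unfolding q_def Re_divide_of_real by simp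
  have norm_g: "norm (g z) = norm (G z) * exp (A * Re (q z))" for z
    by (simp add: g_def norm_mult)
  have Re_le: "Re (cnj \<xi> * z) \<le> 1" if "norm z \<le> 1" for z
  proof -
    have "Re (cnj \<xi> * z) \<le> norm (cnj \<xi> * z)" by (rule complex_Re_le_cmod)
    then show ?thesis using that \<xi> by (simp add: norm_mult)
  qed
  have bound: "norm (g z) \<le> M" if z: "z \<in> S" for z
  proof (rule maximum_modulus_frontier[where S = S and f = g])
    show "g holomorphic_on interior S"
      unfolding g_def q_def using s1
      by (intro holomorphic_intros holomorphic_on_subset[OF hol int_S]) auto
    show "continuous_on (closure S) g"
      unfolding g_def q_def closure_S using s1
      by (intro continuous_intros continuous_on_subset[OF cont S_sub]) auto
    show "bounded S"
      by (rule bounded_subset[OF bounded_cball[of 0 1]]) (use S_sub in blast)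
    show "z \<in> S" by (fact z)
    fix x assume x: "x \<in> frontier S"
    then have xS: "x \<in> S" using closure_S by (auto simp: frontier_def)
    show "norm (g x) \<le> M"
    proof (cases "norm x = 1")
      case True
      have "Re (q x) \<le> 1"
        using Re_le[of x] True s1 by (simp add: Re_q)
      then have "exp (A * Re (q x)) \<le> M / \<epsilon>"
        using A by (metis exp_le_cancel_iff mult_left_le)
      moreover have "norm (G x) \<le> \<epsilon>"
        using xS S_sub True by (intro \<epsilon>) auto
      ultimately have "norm (g x) \<le> \<epsilon> * (M / \<epsilon>)"
        unfolding norm_g using \<epsilon>M by (intro mult_mono) auto
      then show ?thesis using \<epsilon>M by simp
    next
      case False
      then have "Re (q x) = 0"
        using frontier[OF x] by (simp add: Re_q)
      then show ?thesis
        using M[of x] subsetD[OF S_sub xS] by (simp add: norm_g)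
    qed
  qed
  have Re_w: "Re (cnj \<xi> * w) \<ge> 1 - \<rho>\<^sup>2 / 8"
  proof -
    have "cnj \<xi> * \<xi> = 1"
      using \<xi> by (metis complex_norm_square mult.commute of_real_1 one_power2)
    then have "cnj \<xi> * w = 1 - cnj \<xi> * (\<xi> - w)"
      by (simp add: algebra_simps)
    then have "Re (cnj \<xi> * w) = 1 - Re (cnj \<xi> * (\<xi> - w))"
      by simp
    moreover have "Re (cnj \<xi> * (\<xi> - w)) \<le> norm (\<xi> - w)"
      using complex_Re_le_cmod[of "cnj \<xi> * (\<xi> - w)"] \<xi> by (simp add: norm_mult)
    moreover have "norm (\<xi> - w) < \<rho>\<^sup>2 / 8"
      using w by (simp add: dist_norm)
    ultimately show ?thesis by linarith
  qed
  then have "s \<le> Re (cnj \<xi> * w)"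
    using rho2(1) unfolding s_def by linarith
  then have "w \<in> S"
    using w by (simp add: S_def)
  have "Re (q w) \<ge> 1 / 2"
    using Re_w rho2 by (simp add: Re_q s_def field_simps)
  then have "A * (1 / 2) \<le> A * Re (q w)"
    using A(1) by (intro mult_left_mono)
  then have "norm (G w) * exp (A / 2) \<le> norm (g w)"
    unfolding norm_g by (intro mult_left_mono) auto
  also have "\<dots> \<le> M" by (rule bound[OF \<open>w \<in> S\<close>])
  finally have "(norm (G w) * exp (A / 2))\<^sup>2 \<le> M\<^sup>2"
    by (intro power_mono) auto
  moreover have "(exp (A / 2))\<^sup>2 = M / \<epsilon>"
    using A(2) by (simp add: exp_double[symmetric])
  ultimately have "(norm (G w))\<^sup>2 * (M / \<epsilon>) \<le> M\<^sup>2"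
    by (simp only: power_mult_distrib)
  then have "(norm (G w))\<^sup>2 \<le> M * \<epsilon>"
    using \<epsilon>M by (simp add: field_simps power2_eq_square)
  then show ?thesis
    by (rule real_le_rsqrt)
qed

text \<open>Functions that are holomorphic in each variable separately and continuous up to the boundary. The slices through
  points with some coordinates on the circle count as well; it is through them that boundary values on
  the torus control the function.\<close>

definition slicewise_holomorphic :: "(complex^'n \<Rightarrow> complex) \<Rightarrow> complex^'n \<Rightarrow> real \<Rightarrow> bool" where
  "slicewise_holomorphic H \<xi> \<rho> \<longleftrightarrow> (\<forall>z\<in>corner \<xi> \<rho>. \<forall>j.
     continuous_on (cball 0 1 \<inter> ball (\<xi> $ j) \<rho>) (\<lambda>w. H (replace_coord j w z)) \<and>
     (\<lambda>w. H (replace_coord j w z)) holomorphic_on ball 0 1 \<inter> ball (\<xi> $ j) \<rho>)"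

lemma replace_coord_in_corner:
  "z \<in> corner \<xi> \<rho> \<Longrightarrow> w \<in> cball 0 1 \<inter> ball (\<xi> $ j) \<rho> \<Longrightarrow> replace_coord j w z \<in> corner \<xi> \<rho>"
  by (auto simp: corner_iff)

lemma in_closure_open_corner:
  assumes "w \<in> cball 0 1 \<inter> ball a \<rho>"
  shows "w \<in> closure (ball 0 1 \<inter> ball (a :: complex) \<rho>)"
proof -
  have "w \<in> ball a \<rho> \<inter> closure (ball 0 1)"
    using assms by auto
  then have "w \<in> closure (ball a \<rho> \<inter> ball 0 1)"
    using open_Int_closure_subset[of "ball a \<rho>" "ball 0 1"] by blast
  then show ?thesis by (simp add: Int_commute)
qed

text \<open>A slice through a point with boundary coordinates is a bounded pointwise limit of slices with
  fewer boundary coordinates, so it is holomorphic by Montel's theorem.\<close>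

lemma slicewise_holomorphicI:
  fixes H :: "complex^'n::finite \<Rightarrow> complex"
  assumes cont: "\<And>z j. z \<in> corner \<xi> \<rho> \<Longrightarrow>
      continuous_on (cball 0 1 \<inter> ball (\<xi> $ j) \<rho>) (\<lambda>w. H (replace_coord j w z))"
    and hol: "holomorphic_several H (open_corner \<xi> \<rho>)"
    and bound: "\<And>z. z \<in> corner \<xi> \<rho> \<Longrightarrow> norm (H z) \<le> M"
  shows "slicewise_holomorphic H \<xi> \<rho>"
  unfolding slicewise_holomorphic_def
proof (intro ballI allI conjI cont)
  fix z j assume z: "z \<in> corner \<xi> \<rho>"
  let ?S = "ball 0 1 \<inter> ball (\<xi> $ j) \<rho>"
  have "(\<lambda>w. H (replace_coord j w z)) holomorphic_on ?S"
    if "finite B" "{i. i \<noteq> j \<and> norm (z $ i) = 1} = B" "z \<in> corner \<xi> \<rho>" for B z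
    using that
  proof (induction B arbitrary: z rule: finite_induct)
    case empty
    have lt: "norm (z $ i) < 1" if "i \<noteq> j" for i
      using empty that by (force simp: corner_iff less_le)
    show ?case
    proof (rule holomorphic_several_slice[OF hol open_open_corner])
      show "replace_coord j w z \<in> open_corner \<xi> \<rho>" if "w \<in> ?S" for w
        using that lt empty(2) by (auto simp: open_corner_iff corner_iff)
    qed auto
  next
    case (insert b B)
    have b: "b \<noteq> j" "norm (z $ b) = 1"
      using insert.prems(1) by blast+
    have "z $ b \<in> closure (ball 0 1 \<inter> ball (\<xi> $ b) \<rho>)"
      using insert.prems(2) by (intro in_closure_open_corner) (auto simp: corner_iff)
    then obtain x where x': "\<forall>m. x m \<in> ball 0 1 \<inter> ball (\<xi> $ b) \<rho>" and lim: "x \<longlonglongrightarrow> z $ b"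
      unfolding closure_sequential by (elim exE conjE)
    note x = x'[THEN spec] lim
    define f where "f = (\<lambda>m w. H (replace_coord j w (replace_coord b (x m) z)))"
    have mem: "replace_coord b (x m) z \<in> corner \<xi> \<rho>" for m
      using x(1)[of m] insert.prems(2) by (intro replace_coord_in_corner) auto
    have f_hol: "f m holomorphic_on ?S" for m
      unfolding f_def
    proof (rule insert.IH[OF _ mem])
      have "norm (x m) \<noteq> 1"
        using x(1)[of m] by auto
      then show "{i. i \<noteq> j \<and> norm (replace_coord b (x m) z $ i) = 1} = B"
        using insert.prems(1) insert.hyps by auto
    qed
    have f_bound: "norm (f m w) \<le> M" if "w \<in> ?S" for m w
      unfolding f_def using that by (intro bound replace_coord_in_corner mem) auto
    have f_lim: "(\<lambda>m. f m w) \<longlonglongrightarrow> H (replace_coord j w z)" if w: "w \<in> ?S" for w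
    proof -
      let ?y = "replace_coord j w z"
      have y: "?y \<in> corner \<xi> \<rho>"
        using w insert.prems(2) by (intro replace_coord_in_corner) auto
      have zb: "z $ b \<in> cball 0 1 \<inter> ball (\<xi> $ b) \<rho>"
        using insert.prems(2) by (auto simp: corner_iff)
      have "(\<lambda>m. H (replace_coord b (x m) ?y)) \<longlonglongrightarrow> H (replace_coord b (z $ b) ?y)"
      proof (rule continuous_on_tendsto_compose[OF cont[OF y, of b] x(2) zb])
        show "\<forall>\<^sub>F m in sequentially. x m \<in> cball 0 1 \<inter> ball (\<xi> $ b) \<rho>"
          using x(1) by (intro always_eventually) (simp add: less_imp_le)
      qed
      moreover have "replace_coord b (z $ b) ?y = ?y"
        using b(1) by (simp add: vec_eq_iff)
      moreover have "replace_coord b (x m) ?y = replace_coord j w (replace_coord b (x m) z)" for m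
        by (rule replace_coord_commute[OF b(1)])
      ultimately show ?thesis by (simp add: f_def)
    qed
    obtain g r where g: "g holomorphic_on ?S" "strict_mono (r :: nat \<Rightarrow> nat)"
      "\<And>w. w \<in> ?S \<Longrightarrow> (\<lambda>n. f (r n) w) \<longlonglongrightarrow> g w"
    proof (rule Montel[of ?S "range f" f])
      show "\<exists>B. \<forall>h\<in>range f. \<forall>w\<in>K. norm (h w) \<le> B" if "K \<subseteq> ?S" for K
      proof (intro exI ballI)
        fix h w assume "h \<in> range f" "w \<in> K"
        then show "norm (h w) \<le> M"
          using f_bound that by blast
      qed
      show "open ?S" by (intro open_Int open_ball)
      show "h holomorphic_on ?S" if "h \<in> range f" for h
        using f_hol that by auto
    qed auto
    have "g w = H (replace_coord j w z)" if w: "w \<in> ?S" for w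
    proof (rule LIMSEQ_unique[OF g(3)[OF w]])
      show "(\<lambda>n. f (r n) w) \<longlonglongrightarrow> H (replace_coord j w z)"
        using LIMSEQ_subseq_LIMSEQ[OF f_lim[OF w] g(2)] by (simp add: o_def)
    qed
    then show ?case
      by (rule holomorphic_transform[OF g(1)])
  qed
  then show "(\<lambda>w. H (replace_coord j w z)) holomorphic_on ?S"
    using z by simp
qed

text \<open>Applied in one variable after the other, the one-variable estimate propagates smallness from the torus
  to the corner; every variable costs a square root.\<close>

lemma two_constants_corner:
  fixes H :: "complex^'n::finite \<Rightarrow> complex"
  assumes \<xi>: "\<xi> \<in> torus" and \<rho>: "0 < \<rho>" "\<rho> \<le> 1"
    and slice: "slicewise_holomorphic H \<xi> \<rho>"
    and M: "M > 0" "\<And>z. z \<in> corner \<xi> \<rho> \<Longrightarrow> norm (H z) \<le> M"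
    and q: "0 < q" "q \<le> 1" "\<And>z. z \<in> torus \<inter> corner \<xi> \<rho> \<Longrightarrow> norm (H z) \<le> M * q ^ (2 ^ CARD('n))"
    and z: "z \<in> corner \<xi> (\<rho>\<^sup>2 / 8)"
  shows "norm (H z) \<le> M * q"
proof -
  have step: "norm (H z) \<le> M * q ^ (2 ^ (CARD('n) - card S))"
    if "finite S" "z \<in> corner \<xi> \<rho>" "\<forall>i\<in>S. dist (\<xi> $ i) (z $ i) < \<rho>\<^sup>2 / 8" "\<forall>i. i \<notin> S \<longrightarrow> norm (z $ i) = 1"
    for S and z :: "complex^'n"
    using that
  proof (induction S arbitrary: z rule: finite_induct)
    case empty
    then show ?case using q(3)[of z] by (auto simp: torus_iff)
  next
    case (insert j S)
    define m where "m = (2::nat) ^ (CARD('n) - card (insert j S))"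
    have "card (insert j S) \<le> CARD('n)"
      by (rule card_mono) auto
    then have "CARD('n) - card S = Suc (CARD('n) - card (insert j S))"
      using insert.hyps by simp
    then have m: "2 ^ (CARD('n) - card S) = 2 * m"
      by (simp add: m_def)
    define \<epsilon> where "\<epsilon> = M * q ^ (2 * m)"
    have \<epsilon>: "0 < \<epsilon>" "\<epsilon> \<le> M"
      using M(1) q(1,2) by (auto simp: \<epsilon>_def mult_left_le power_le_one)
    have "norm (H (replace_coord j (z $ j) z)) \<le> sqrt (M * \<epsilon>)"
    proof (rule two_constants_arc[where G = "\<lambda>w. H (replace_coord j w z)" and \<xi> = "\<xi> $ j" and \<rho> = \<rho>])
      show "norm (\<xi> $ j) = 1"
        using \<xi> by (simp add: torus_iff)
      show "continuous_on (cball 0 1 \<inter> ball (\<xi> $ j) \<rho>) (\<lambda>w. H (replace_coord j w z))"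
        "(\<lambda>w. H (replace_coord j w z)) holomorphic_on ball 0 1 \<inter> ball (\<xi> $ j) \<rho>"
        using slice insert.prems(1) unfolding slicewise_holomorphic_def by blast+
      show "norm (H (replace_coord j w z)) \<le> M" if "w \<in> cball 0 1 \<inter> ball (\<xi> $ j) \<rho>" for w
        by (rule M(2)[OF replace_coord_in_corner[OF insert.prems(1) that]])
      show "norm (H (replace_coord j w z)) \<le> \<epsilon>" if "w \<in> sphere 0 1 \<inter> ball (\<xi> $ j) \<rho>" for w
        unfolding \<epsilon>_def m[symmetric]
      proof (rule insert.IH)
        show "replace_coord j w z \<in> corner \<xi> \<rho>"
          using that by (intro replace_coord_in_corner insert.prems(1)) auto
        show "\<forall>i\<in>S. dist (\<xi> $ i) (replace_coord j w z $ i) < \<rho>\<^sup>2 / 8"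
          using insert.prems(2) insert.hyps(2) by auto
        show "\<forall>i. i \<notin> S \<longrightarrow> norm (replace_coord j w z $ i) = 1"
          using insert.prems(3) that by auto
      qed
      show "z $ j \<in> cball 0 1 \<inter> ball (\<xi> $ j) (\<rho>\<^sup>2 / 8)"
        using insert.prems(1,2) by (auto simp: corner_iff)
    qed (use \<epsilon> \<rho> in auto)
    also have "M * \<epsilon> = (M * q ^ m)\<^sup>2"
      by (simp add: \<epsilon>_def power2_eq_square mult_2 power_add)
    also have "sqrt ((M * q ^ m)\<^sup>2) = M * q ^ m"
      using M(1) q(1) by simp
    finally show ?case by (simp add: m_def)
  qed
  have "\<rho>\<^sup>2 \<le> \<rho>"
    using \<rho> by (auto simp: power2_eq_square mult_left_le)
  then have "\<rho>\<^sup>2 / 8 \<le> \<rho>" using \<rho> by auto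
  then have "z \<in> corner \<xi> \<rho>"
    using z corner_mono by blast
  then show ?thesis
    using step[of UNIV z] z by (auto simp: corner_iff)
qed

section \<open>Continuous holomorphic extensions to a corner\<close>

text \<open>The bound \<open>M\<close> is recorded because the passage to a limit of extensions requires a common bound.\<close>

definition extends_into_corner ::
    "(complex^'n \<Rightarrow> complex) \<Rightarrow> complex^'n \<Rightarrow> real \<Rightarrow> real \<Rightarrow> (complex^'n \<Rightarrow> complex) \<Rightarrow> bool" where
  "extends_into_corner g \<xi> \<rho> M H \<longleftrightarrow>
     continuous_on (corner \<xi> \<rho>) H \<and> holomorphic_several H (open_corner \<xi> \<rho>) \<and>
     (\<forall>z\<in>corner \<xi> \<rho>. norm (H z) \<le> M) \<and> (\<forall>z\<in>torus \<inter> corner \<xi> \<rho>. H z = g z)"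

lemma continuous_on_replace_coord [continuous_intros]:
  "continuous_on A (\<lambda>w. replace_coord j w (z :: complex^'n::finite))"
proof -
  have "continuous_on A (\<lambda>w. if i = j then w else z $ i)" for i
    by (cases "i = j") simp_all
  then show ?thesis
    unfolding replace_coord_def by (intro continuous_on_vec_lambda)
qed

lemma slicewise_holomorphic_of_continuous:
  fixes H :: "complex^'n::finite \<Rightarrow> complex"
  assumes "continuous_on (corner \<xi> \<rho>) H" "holomorphic_several H (open_corner \<xi> \<rho>)"
    and "\<And>z. z \<in> corner \<xi> \<rho> \<Longrightarrow> norm (H z) \<le> M"
  shows "slicewise_holomorphic H \<xi> \<rho>"
proof (rule slicewise_holomorphicI[OF _ assms(2,3)])
  fix z j assume z: "z \<in> corner \<xi> \<rho>"
  show "continuous_on (cball 0 1 \<inter> ball (\<xi> $ j) \<rho>) (\<lambda>w. H (replace_coord j w z))"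
    by (rule continuous_on_compose2[OF assms(1) continuous_on_replace_coord])
      (use replace_coord_in_corner[OF z] in blast)
qed

lemma extends_into_corner_diff:
  fixes g :: "complex^'n::finite \<Rightarrow> complex"
  assumes "extends_into_corner g \<xi> \<rho> M H" "extends_into_corner g' \<xi> \<rho> M' H'"
  shows "extends_into_corner (\<lambda>z. g z - g' z) \<xi> \<rho> (M + M') (\<lambda>z. H z - H' z)"
  using assms unfolding extends_into_corner_def
  by (auto intro!: continuous_intros holomorphic_several_diff norm_triangle_le_diff add_mono)

lemma extends_into_corner_slicewise:
  "extends_into_corner g \<xi> \<rho> M H \<Longrightarrow> slicewise_holomorphic H \<xi> (\<rho> :: real)"
  for g :: "complex^'n::finite \<Rightarrow> complex"
  unfolding extends_into_corner_def by (intro slicewise_holomorphic_of_continuous[where M = M]) auto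

lemma shrunk_radius: "0 < \<rho> \<Longrightarrow> \<rho> \<le> 1 \<Longrightarrow> 0 < \<rho>\<^sup>2 / 8 \<and> \<rho>\<^sup>2 / 8 \<le> \<rho>" for \<rho> :: real
  by (auto simp: power2_eq_square mult_left_le intro: order_trans[of _ "\<rho> * \<rho>"])

text \<open>Uniform convergence on the torus forces uniform convergence of bounded extensions, at the price of
  a smaller corner. Hence limits of functions that are extendable with a fixed bound are extendable.\<close>

lemma extends_into_corner_limit:
  fixes g :: "nat \<Rightarrow> complex^'n::finite \<Rightarrow> complex"
  assumes \<xi>: "\<xi> \<in> torus" and \<rho>: "0 < \<rho>" "\<rho> \<le> 1"
    and ext: "\<And>m. extends_into_corner (g m) \<xi> \<rho> M (H m)"
    and lim: "uniform_limit (torus \<inter> corner \<xi> \<rho>) g f sequentially"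
  obtains H' where "extends_into_corner f \<xi> (\<rho>\<^sup>2 / 8) M H'"
    "uniform_limit (corner \<xi> (\<rho>\<^sup>2 / 8)) H H' sequentially"
proof -
  let ?\<sigma> = "\<rho>\<^sup>2 / 8"
  note sub = corner_mono[OF conjunct2[OF shrunk_radius[OF \<rho>]]]
  define B where "B = \<bar>M\<bar> + \<bar>M\<bar> + 1"
  have B: "B > 0" "M + M \<le> B" by (auto simp: B_def)
  have "uniformly_Cauchy_on (corner \<xi> ?\<sigma>) H"
  proof (rule uniformly_Cauchy_onI)
    fix e :: real assume e: "e > 0"
    define q where "q = min 1 (e / (2 * B))"
    have q: "0 < q" "q \<le> 1" "B * q \<le> e / 2"
    proof -
      show "0 < q" "q \<le> 1" using e B(1) by (simp_all add: q_def)
      have "q \<le> e / (2 * B)" by (simp add: q_def)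
      then show "B * q \<le> e / 2" using B(1) by (simp add: field_simps)
    qed
    define \<delta> where "\<delta> = B * q ^ (2 ^ CARD('n))"
    have "\<delta> > 0" using q(1) B(1) by (simp add: \<delta>_def)
    have "uniformly_Cauchy_on (torus \<inter> corner \<xi> \<rho>) g"
      using lim uniformly_convergent_Cauchy uniformly_convergentI by blast
    then obtain N where N: "\<And>z m n. z \<in> torus \<inter> corner \<xi> \<rho> \<Longrightarrow> m \<ge> N \<Longrightarrow> n \<ge> N \<Longrightarrow> dist (g m z) (g n z) < \<delta>"
      using \<open>\<delta> > 0\<close> unfolding uniformly_Cauchy_on_def by metis
    have "dist (H m z) (H n z) < e" if z: "z \<in> corner \<xi> ?\<sigma>" and mn: "m \<ge> N" "n \<ge> N" for z m n
    proof -
      have ext': "extends_into_corner (\<lambda>z. g m z - g n z) \<xi> \<rho> (M + M) (\<lambda>z. H m z - H n z)"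
        by (intro extends_into_corner_diff ext)
      have "norm (H m z - H n z) \<le> B * q"
      proof (rule two_constants_corner[OF \<xi> \<rho> extends_into_corner_slicewise[OF ext'] B(1) _ q(1,2) _ z])
        show "norm (H m y - H n y) \<le> B" if "y \<in> corner \<xi> \<rho>" for y
          using ext' B(2) that unfolding extends_into_corner_def by (meson order_trans)
        show "norm (H m y - H n y) \<le> B * q ^ (2 ^ CARD('n))" if y: "y \<in> torus \<inter> corner \<xi> \<rho>" for y
        proof -
          have "H m y - H n y = g m y - g n y"
            using ext' y unfolding extends_into_corner_def by blast
          then show ?thesis
            using N[OF y mn] by (simp add: dist_norm \<delta>_def)
        qed
      qed
      then show ?thesis using e q(3) unfolding dist_norm by linarith
    qed
    then show "\<exists>N. \<forall>z\<in>corner \<xi> ?\<sigma>. \<forall>m\<ge>N. \<forall>n\<ge>N. dist (H m z) (H n z) < e"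
      by blast
  qed
  then obtain H' where H': "uniform_limit (corner \<xi> ?\<sigma>) H H' sequentially"
    using Cauchy_uniformly_convergent uniformly_convergent_on_def by blast
  have pt: "(\<lambda>m. H m z) \<longlonglongrightarrow> H' z" if "z \<in> corner \<xi> ?\<sigma>" for z
    by (rule tendsto_uniform_limitI[OF H' that])
  have "extends_into_corner f \<xi> ?\<sigma> M H'"
    unfolding extends_into_corner_def
  proof (intro conjI ballI)
    show "continuous_on (corner \<xi> ?\<sigma>) H'"
    proof (rule uniform_limit_theorem[OF _ H'])
      show "\<forall>\<^sub>F m in sequentially. continuous_on (corner \<xi> ?\<sigma>) (H m)"
        using ext sub continuous_on_subset unfolding extends_into_corner_def
        by (intro always_eventually) blast
    qed auto
    show "holomorphic_several H' (open_corner \<xi> ?\<sigma>)"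
    proof (rule holomorphic_several_uniform_limit[OF _ open_open_corner])
      show "holomorphic_several (H m) (open_corner \<xi> ?\<sigma>)" for m
        using ext[of m] open_corner_mono[OF conjunct2[OF shrunk_radius[OF \<rho>]]] holomorphic_several_subset
        unfolding extends_into_corner_def by blast
      show "uniform_limit (open_corner \<xi> ?\<sigma>) H H' sequentially"
        by (rule uniform_limit_on_subset[OF H' open_corner_subset])
    qed
    show "norm (H' z) \<le> M" if z: "z \<in> corner \<xi> ?\<sigma>" for z
    proof (rule LIMSEQ_le_const2[OF tendsto_norm[OF pt[OF z]]])
      show "\<exists>N. \<forall>n\<ge>N. norm (H n z) \<le> M"
        using ext z sub unfolding extends_into_corner_def by blast
    qed
    show "H' z = f z" if z: "z \<in> torus \<inter> corner \<xi> ?\<sigma>" for z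
    proof (rule LIMSEQ_unique)
      have z': "z \<in> torus \<inter> corner \<xi> \<rho>" using z sub by blast
      show "(\<lambda>m. H m z) \<longlonglongrightarrow> H' z" using pt z by blast
      have "H m z = g m z" for m
        using ext[of m] z' unfolding extends_into_corner_def by blast
      then show "(\<lambda>m. H m z) \<longlonglongrightarrow> f z"
        using tendsto_uniform_limitI[OF lim z'] by simp
    qed
  qed
  then show ?thesis using H' that by blast
qed

lemma dilation_in_open_corner:
  fixes z :: "complex^'n::finite"
  assumes z: "z \<in> corner \<xi> (\<rho> / 2)" and t: "0 < t" "t < 1" "1 - t < \<rho> / 2"
  shows "t *\<^sub>R z \<in> open_corner \<xi> \<rho>"
  unfolding open_corner_iff
proof (intro allI conjI)
  fix i
  have zi: "norm (z $ i) \<le> 1" "dist (\<xi> $ i) (z $ i) < \<rho> / 2"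
    using z by (auto simp: corner_iff)
  have "t * norm (z $ i) \<le> t"
    using zi(1) t by (simp add: mult_left_le)
  moreover have "norm ((t *\<^sub>R z) $ i) = t * norm (z $ i)"
    using t by simp
  ultimately show "norm ((t *\<^sub>R z) $ i) < 1"
    using t(2) by linarith
  have "z $ i - t *\<^sub>R z $ i = (1 - t) *\<^sub>R z $ i"
    by (simp add: scaleR_diff_left)
  then have "dist (z $ i) ((t *\<^sub>R z) $ i) = (1 - t) * norm (z $ i)"
    using t by (simp add: dist_norm)
  also have "\<dots> \<le> 1 - t"
    using zi(1) t by (simp add: mult_left_le)
  finally show "dist (\<xi> $ i) ((t *\<^sub>R z) $ i) < \<rho>"
    using zi(2) t dist_triangle[of "\<xi> $ i" "(t *\<^sub>R z) $ i" "z $ i"] by linarith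
qed

text \<open>The dilations \<open>z \<mapsto> H (t z)\<close>, \<open>t < 1\<close>, are continuous up to the boundary. If they converge uniformly on the
  torus, then they converge uniformly on a corner, to a continuous function that can only be \<open>H\<close> in the interior.\<close>

lemma extends_into_corner_radial:
  fixes g :: "complex^'n::finite \<Rightarrow> complex"
  assumes \<xi>: "\<xi> \<in> torus" and \<rho>: "0 < \<rho>" "\<rho> \<le> 1"
    and hol: "holomorphic_several H (open_corner \<xi> \<rho>)"
    and bound: "\<And>z. z \<in> open_corner \<xi> \<rho> \<Longrightarrow> norm (H z) \<le> M"
    and radial: "\<And>e. e > 0 \<Longrightarrow> \<exists>\<tau><1. \<forall>t. \<tau> < t \<and> t < 1 \<longrightarrow> (\<forall>z\<in>torus \<inter> corner \<xi> (\<rho> / 2). norm (H (t *\<^sub>R z) - g z) \<le> e)"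
  obtains H' where "extends_into_corner g \<xi> ((\<rho> / 2)\<^sup>2 / 8) M H'"
    "\<And>z. z \<in> open_corner \<xi> ((\<rho> / 2)\<^sup>2 / 8) \<Longrightarrow> H' z = H z"
proof -
  \<comment> \<open>\<open>1 - t m < \<rho> / 2\<close> ensures that dilation by \<open>t m\<close> maps the corner of radius \<open>\<rho> / 2\<close> into the open one of radius \<open>\<rho>\<close>\<close>
  define t where "t = (\<lambda>m::nat. 1 - (\<rho> / 4) * inverse (real (Suc m)))"
  have t: "0 < t m" "t m < 1" "1 - t m < \<rho> / 2" for m
  proof -
    have "inverse (real (Suc m)) \<le> 1"
      by (simp add: inverse_le_1_iff)
    then have "(\<rho> / 4) * inverse (real (Suc m)) \<le> \<rho> / 4"
      using \<rho> by (intro mult_left_le) auto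
    moreover have "(\<rho> / 4) * inverse (real (Suc m)) > 0"
      using \<rho> by simp
    ultimately show "0 < t m" "t m < 1" "1 - t m < \<rho> / 2"
      using \<rho> unfolding t_def by linarith+
  qed
  have t_lim: "t \<longlonglongrightarrow> 1"
  proof -
    have "(\<lambda>m. 1 - (\<rho> / 4) * inverse (real (Suc m))) \<longlonglongrightarrow> 1 - (\<rho> / 4) * 0"
      by (intro tendsto_intros LIMSEQ_inverse_real_of_nat)
    then show ?thesis by (simp add: t_def)
  qed
  define K where "K = (\<lambda>m z. H (t m *\<^sub>R z))"
  have mem: "t m *\<^sub>R z \<in> open_corner \<xi> \<rho>" if "z \<in> corner \<xi> (\<rho> / 2)" for m z
    by (rule dilation_in_open_corner[OF that t])
  have ext: "extends_into_corner (K m) \<xi> (\<rho> / 2) M (K m)" for m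
    unfolding extends_into_corner_def
  proof (intro conjI ballI)
    show "continuous_on (corner \<xi> (\<rho> / 2)) (K m)"
      unfolding K_def
      by (rule continuous_on_compose2[OF holomorphic_several_imp_continuous_on[OF hol]])
        (use mem in \<open>auto intro!: continuous_intros\<close>)
    have "holomorphic_several (\<lambda>z. H (map_product (\<lambda>_ w. of_real (t m) * w) z)) (open_corner \<xi> (\<rho> / 2))"
    proof (rule holomorphic_several_compose_map_product[OF hol open_open_corner, where A = "\<lambda>_. UNIV"])
      show "map_product (\<lambda>_ w. of_real (t m) * w) z \<in> open_corner \<xi> \<rho>" if "z \<in> open_corner \<xi> (\<rho> / 2)" for z
      proof -
        have "map_product (\<lambda>_ w. of_real (t m) * w) z = t m *\<^sub>R z"
          by (simp add: map_product_def vec_eq_iff scaleR_conv_of_real[where 'a = complex])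
        then show ?thesis
          using mem[OF subsetD[OF open_corner_subset that]] by simp
      qed
    qed (auto intro!: holomorphic_intros simp: set_product_def)
    moreover have "map_product (\<lambda>_ w. of_real (t m) * w) z = t m *\<^sub>R z" for z :: "complex^'n"
      by (simp add: map_product_def vec_eq_iff scaleR_conv_of_real[where 'a = complex])
    ultimately show "holomorphic_several (K m) (open_corner \<xi> (\<rho> / 2))"
      by (simp add: K_def)
    show "norm (K m z) \<le> M" if "z \<in> corner \<xi> (\<rho> / 2)" for z
      unfolding K_def by (rule bound[OF mem[OF that]])
  qed auto
  have lim: "uniform_limit (torus \<inter> corner \<xi> (\<rho> / 2)) K g sequentially"
  proof (rule uniform_limitI)
    fix e :: real assume e: "e > 0"
    then obtain \<tau> where "\<tau> < 1" and \<tau>: "\<And>t z. \<tau> < t \<Longrightarrow> t < 1 \<Longrightarrow> z \<in> torus \<inter> corner \<xi> (\<rho> / 2) \<Longrightarrow> norm (H (t *\<^sub>R z) - g z) \<le> e / 2"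
      using radial[of "e / 2"] by (auto simp: field_simps)
    have "\<forall>\<^sub>F m in sequentially. \<tau> < t m"
      using order_tendstoD(1)[OF t_lim \<open>\<tau> < 1\<close>] .
    then show "\<forall>\<^sub>F m in sequentially. \<forall>z\<in>torus \<inter> corner \<xi> (\<rho> / 2). dist (K m z) (g z) < e"
    proof eventually_elim
      case (elim m)
      show ?case
      proof
        fix z assume "z \<in> torus \<inter> corner \<xi> (\<rho> / 2)"
        from \<tau>[OF elim t(2) this] show "dist (K m z) (g z) < e"
          using e by (simp add: K_def dist_norm)
      qed
    qed
  qed
  have half: "0 < \<rho> / 2" "\<rho> / 2 \<le> 1" using \<rho> by auto
  obtain H' where H': "extends_into_corner g \<xi> ((\<rho> / 2)\<^sup>2 / 8) M H'"
    "uniform_limit (corner \<xi> ((\<rho> / 2)\<^sup>2 / 8)) K H' sequentially"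
    by (rule extends_into_corner_limit[OF \<xi> half ext lim])
  have "H' z = H z" if z: "z \<in> open_corner \<xi> ((\<rho> / 2)\<^sup>2 / 8)" for z
  proof (rule LIMSEQ_unique)
    have z': "z \<in> corner \<xi> ((\<rho> / 2)\<^sup>2 / 8)" "z \<in> open_corner \<xi> \<rho>" "z \<in> corner \<xi> (\<rho> / 2)"
      using z open_corner_subset corner_mono[OF conjunct2[OF shrunk_radius[OF half]]]
        open_corner_mono[of "(\<rho> / 2)\<^sup>2 / 8" \<rho>] shrunk_radius[OF half] \<rho> by force+
    show "(\<lambda>m. K m z) \<longlonglongrightarrow> H' z"
      by (rule tendsto_uniform_limitI[OF H'(2) z'(1)])
    have "(\<lambda>m. t m *\<^sub>R z) \<longlonglongrightarrow> 1 *\<^sub>R z"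
      by (intro tendsto_intros t_lim)
    then have "(\<lambda>m. t m *\<^sub>R z) \<longlonglongrightarrow> z" by simp
    then show "(\<lambda>m. K m z) \<longlonglongrightarrow> H z"
      unfolding K_def
      by (rule continuous_on_tendsto_compose[OF holomorphic_several_imp_continuous_on[OF hol] _ z'(2)])
        (use mem[OF z'(3)] in simp)
  qed
  then show ?thesis using H'(1) that by blast
qed

text \<open>Separate continuity does not say directly that \<open>H (t z)\<close> tends to \<open>g z\<close> when all coordinates move at
  once. This follows, uniformly in \<open>\<eta>\<close>, from the two-constants estimate for \<open>H - g \<eta>\<close>, which is small on the torus
  near \<open>\<eta>\<close>.\<close>

lemma extends_into_corner_of_slicewise:
  fixes g :: "complex^'n::finite \<Rightarrow> complex"
  assumes \<xi>: "\<xi> \<in> torus" and \<rho>: "0 < \<rho>" "\<rho> \<le> 1"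
    and hol: "holomorphic_several H (open_corner \<xi> \<rho>)"
    and slice: "slicewise_holomorphic H \<xi> \<rho>"
    and bound: "\<And>z. z \<in> corner \<xi> \<rho> \<Longrightarrow> norm (H z) \<le> M"
    and H: "\<And>z. z \<in> torus \<inter> corner \<xi> \<rho> \<Longrightarrow> H z = g z"
    and g: "continuous_on torus g"
  obtains H' where "extends_into_corner g \<xi> ((\<rho> / 2)\<^sup>2 / 8) M H'"
proof (rule extends_into_corner_radial[OF \<xi> \<rho> hol])
  show "norm (H z) \<le> M" if "z \<in> open_corner \<xi> \<rho>" for z
    using that open_corner_subset bound by blast
  fix e :: real assume e: "e > 0"
  define B where "B = \<bar>M\<bar> + \<bar>M\<bar> + 1"
  have B: "B > 0" "M + M \<le> B" by (auto simp: B_def)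
  define q where "q = min 1 (e / B)"
  have q: "0 < q" "q \<le> 1" "B * q \<le> e"
  proof -
    show "0 < q" "q \<le> 1" using e B(1) by (simp_all add: q_def)
    have "q \<le> e / B" by (simp add: q_def)
    then show "B * q \<le> e" using B(1) by (simp add: field_simps)
  qed
  define \<delta> where "\<delta> = B * q ^ (2 ^ CARD('n))"
  have "\<delta> > 0" using q(1) B(1) by (simp add: \<delta>_def)
  have "uniformly_continuous_on torus g"
    by (rule compact_uniformly_continuous[OF g compact_torus])
  then obtain d where "d > 0" and d: "\<And>x y. x \<in> torus \<Longrightarrow> y \<in> torus \<Longrightarrow> dist y x < d \<Longrightarrow> dist (g y) (g x) < \<delta>"
    using \<open>\<delta> > 0\<close> unfolding uniformly_continuous_on_def by metis
  define r where "r = min (\<rho> / 2) (d / real (CARD('n)))"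
  have r: "0 < r" "r \<le> \<rho> / 2" "r \<le> 1"
  proof -
    show "0 < r" using \<rho> \<open>d > 0\<close> by (simp add: r_def)
    show "r \<le> \<rho> / 2" unfolding r_def by (rule min.cobounded1)
    then show "r \<le> 1" using \<rho> by linarith
  qed
  have "r \<le> d / real (CARD('n))"
    by (simp add: r_def)
  then have r_card: "real (CARD('n)) * r \<le> d"
    by (simp add: field_simps)
  have close: "norm (H z - g \<eta>) \<le> e" if \<eta>: "\<eta> \<in> torus \<inter> corner \<xi> (\<rho> / 2)" and z: "z \<in> corner \<eta> (r\<^sup>2 / 8)" for \<eta> z
  proof -
    have ball: "ball (\<eta> $ i) r \<subseteq> ball (\<xi> $ i) \<rho>" for i
    proof
      fix w assume "w \<in> ball (\<eta> $ i) r"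
      moreover have "dist (\<xi> $ i) (\<eta> $ i) < \<rho> / 2"
        using \<eta> by (auto simp: corner_iff)
      ultimately show "w \<in> ball (\<xi> $ i) \<rho>"
        using r(2) dist_triangle[of "\<xi> $ i" w "\<eta> $ i"] by auto
    qed
    have sub: "corner \<eta> r \<subseteq> corner \<xi> \<rho>"
    proof
      fix w assume w: "w \<in> corner \<eta> r"
      have "w $ i \<in> ball (\<eta> $ i) r" for i
        using w by (simp add: corner_iff)
      then have "dist (\<xi> $ i) (w $ i) < \<rho>" for i
        using ball[of i] by (simp add: subset_iff)
      then show "w \<in> corner \<xi> \<rho>"
        using w by (simp add: corner_iff)
    qed
    have slice': "slicewise_holomorphic (\<lambda>z. H z - g \<eta>) \<eta> r"
      unfolding slicewise_holomorphic_def
    proof (intro ballI allI conjI)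
      fix z j assume "z \<in> corner \<eta> r"
      then have z: "z \<in> corner \<xi> \<rho>" using sub by blast
      show "continuous_on (cball 0 1 \<inter> ball (\<eta> $ j) r) (\<lambda>w. H (replace_coord j w z) - g \<eta>)"
      proof (intro continuous_on_diff continuous_on_const)
        have "continuous_on (cball 0 1 \<inter> ball (\<xi> $ j) \<rho>) (\<lambda>w. H (replace_coord j w z))"
          using slice z unfolding slicewise_holomorphic_def by blast
        then show "continuous_on (cball 0 1 \<inter> ball (\<eta> $ j) r) (\<lambda>w. H (replace_coord j w z))"
          by (rule continuous_on_subset) (use ball[of j] in blast)
      qed
      show "(\<lambda>w. H (replace_coord j w z) - g \<eta>) holomorphic_on ball 0 1 \<inter> ball (\<eta> $ j) r"
      proof (intro holomorphic_on_diff holomorphic_on_const)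
        have "(\<lambda>w. H (replace_coord j w z)) holomorphic_on ball 0 1 \<inter> ball (\<xi> $ j) \<rho>"
          using slice z unfolding slicewise_holomorphic_def by blast
        then show "(\<lambda>w. H (replace_coord j w z)) holomorphic_on ball 0 1 \<inter> ball (\<eta> $ j) r"
          by (rule holomorphic_on_subset) (use ball[of j] in blast)
      qed
    qed
    have \<eta>': "\<eta> \<in> torus \<inter> corner \<xi> \<rho>"
      using \<eta> corner_mono[of "\<rho> / 2" \<rho>] \<rho> by auto
    have B': "norm (H z - g \<eta>) \<le> B" if "z \<in> corner \<eta> r" for z
    proof -
      have "norm (H z) \<le> M" "norm (H \<eta>) \<le> M"
        using bound subsetD[OF sub that] \<eta>' by simp_all
      then show "norm (H z - g \<eta>) \<le> B"
        using H[OF \<eta>'] B(2) norm_triangle_ineq4[of "H z" "g \<eta>"] by simp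
    qed
    have \<delta>': "norm (H z - g \<eta>) \<le> \<delta>" if z: "z \<in> torus \<inter> corner \<eta> r" for z
    proof -
      have "dist z \<eta> < real CARD('n) * r"
        using z by (intro dist_vec_less) (simp add: corner_iff dist_commute)
      then have "dist (g z) (g \<eta>) < \<delta>"
        using z \<eta> r_card by (intro d) simp_all
      moreover have "H z = g z"
        using z sub by (intro H) blast
      ultimately show "norm (H z - g \<eta>) \<le> \<delta>"
        by (simp add: dist_norm)
    qed
    have "\<eta> \<in> torus" using \<eta> by blast
    from two_constants_corner[OF this r(1,3) slice' B(1) B' q(1,2) \<delta>'[unfolded \<delta>_def] z]
    show ?thesis using q(3) by linarith
  qed
  show "\<exists>\<tau><1. \<forall>t. \<tau> < t \<and> t < 1 \<longrightarrow> (\<forall>z\<in>torus \<inter> corner \<xi> (\<rho> / 2). norm (H (t *\<^sub>R z) - g z) \<le> e)"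
  proof (intro exI conjI allI impI ballI)
    show "1 - r\<^sup>2 / 8 < 1" using r(1) by simp
    fix t z assume t: "1 - r\<^sup>2 / 8 < t \<and> t < 1" and z: "z \<in> torus \<inter> corner \<xi> (\<rho> / 2)"
    have "r\<^sup>2 / 8 \<le> 1" using shrunk_radius[OF r(1,3)] r(3) by linarith
    then have t0: "t > 0" using t by linarith
    have "t *\<^sub>R z \<in> corner z (r\<^sup>2 / 8)"
      unfolding corner_iff
    proof (intro allI conjI)
      fix i
      have zi: "norm (z $ i) = 1" using z by (auto simp: torus_iff)
      show "norm ((t *\<^sub>R z) $ i) \<le> 1" using zi t t0 by simp
      have "z $ i - t *\<^sub>R z $ i = (1 - t) *\<^sub>R z $ i"
        by (simp add: scaleR_diff_left)
      then have "dist (z $ i) ((t *\<^sub>R z) $ i) = 1 - t"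
        using t zi by (simp add: dist_norm)
      then show "dist (z $ i) ((t *\<^sub>R z) $ i) < r\<^sup>2 / 8" using t by linarith
    qed
    then show "norm (H (t *\<^sub>R z) - g z) \<le> e"
      by (rule close[OF z])
  qed
qed (use that in blast)

text \<open>Here the radial limits are uniform because \<open>H\<close> is uniformly continuous on the compact set of all \<open>t z\<close>, with \<open>z\<close>
  in a closed piece of the torus and \<open>t \<le> 1\<close> close to \<open>1\<close>.\<close>

lemma extends_into_corner_of_continuous:
  fixes g :: "complex^'n::finite \<Rightarrow> complex"
  assumes \<xi>: "\<xi> \<in> torus" and \<rho>: "0 < \<rho>" "\<rho> \<le> 1"
    and hol: "holomorphic_several H (open_corner \<xi> \<rho>)"
    and cont: "continuous_on (open_corner \<xi> \<rho> \<union> (torus \<inter> corner \<xi> \<rho>)) H"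
    and bound: "\<And>z. z \<in> open_corner \<xi> \<rho> \<Longrightarrow> norm (H z) \<le> M"
    and H: "\<And>z. z \<in> torus \<inter> corner \<xi> \<rho> \<Longrightarrow> H z = g z"
  obtains H' where "extends_into_corner g \<xi> ((\<rho> / 2)\<^sup>2 / 8) M H'"
    "\<And>z. z \<in> open_corner \<xi> ((\<rho> / 2)\<^sup>2 / 8) \<Longrightarrow> H' z = H z"
proof (rule extends_into_corner_radial[OF \<xi> \<rho> hol bound])
  fix e :: real assume e: "e > 0"
  define T where "T = torus \<inter> set_product (\<lambda>i. cball (\<xi> $ i) (\<rho> / 2))"
  have "compact T"
    unfolding T_def by (intro compact_Int compact_torus compact_set_product compact_cball)
  define C where "C = (\<lambda>p. fst p *\<^sub>R snd p) ` ({1 - \<rho> / 4..1} \<times> T)"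
  have "compact C"
    unfolding C_def
    by (intro compact_continuous_image compact_Times compact_Icc \<open>compact T\<close> continuous_intros)
  have CI: "t *\<^sub>R z \<in> C" if "1 - \<rho> / 4 \<le> t" "t \<le> 1" "z \<in> T" for t z
    unfolding C_def using that by force
  have T_corner: "z \<in> torus \<inter> corner \<xi> \<rho>" if "z \<in> T" for z
  proof -
    have "dist (\<xi> $ i) (z $ i) < \<rho>" for i
    proof -
      have "dist (\<xi> $ i) (z $ i) \<le> \<rho> / 2"
        using that by (simp add: T_def set_product_def)
      then show ?thesis using \<rho>(1) by linarith
    qed
    then show ?thesis
      using that by (auto simp: T_def corner_iff torus_iff)
  qed
  have "C \<subseteq> open_corner \<xi> \<rho> \<union> (torus \<inter> corner \<xi> \<rho>)"
  proof
    fix y assume "y \<in> C"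
    then obtain t z where y: "y = t *\<^sub>R z" "1 - \<rho> / 4 \<le> t" "t \<le> 1" "z \<in> T"
      unfolding C_def by auto
    show "y \<in> open_corner \<xi> \<rho> \<union> (torus \<inter> corner \<xi> \<rho>)"
    proof (cases "t = 1")
      case True
      then show ?thesis using y T_corner by auto
    next
      case False
      have zi: "norm (z $ i) = 1" "dist (\<xi> $ i) (z $ i) \<le> \<rho> / 2" for i
        using y(4) by (auto simp: T_def torus_iff set_product_def)
      have "norm (y $ i) < 1" "dist (\<xi> $ i) (y $ i) < \<rho>" for i
      proof -
        show "norm (y $ i) < 1" using zi(1)[of i] y False \<rho> by simp
        have "z $ i - t *\<^sub>R z $ i = (1 - t) *\<^sub>R z $ i"
          by (simp add: scaleR_diff_left)
        then have "dist (z $ i) (y $ i) = 1 - t"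
          using zi(1)[of i] y by (simp add: dist_norm)
        then show "dist (\<xi> $ i) (y $ i) < \<rho>"
          using zi(2)[of i] y(2) \<rho> dist_triangle[of "\<xi> $ i" "y $ i" "z $ i"] by linarith
      qed
      then show ?thesis by (auto simp: open_corner_iff)
    qed
  qed
  then have "uniformly_continuous_on C H"
    using compact_uniformly_continuous[OF continuous_on_subset[OF cont] \<open>compact C\<close>] by blast
  then obtain d where "d > 0" and d: "\<And>x y. x \<in> C \<Longrightarrow> y \<in> C \<Longrightarrow> dist y x < d \<Longrightarrow> dist (H y) (H x) < e"
    using e unfolding uniformly_continuous_on_def by metis
  obtain B where "B > 0" and B: "\<And>z. z \<in> T \<Longrightarrow> norm z \<le> B"
    using compact_imp_bounded[OF \<open>compact T\<close>] bounded_pos by metis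
  define \<tau> where "\<tau> = max (1 - \<rho> / 4) (1 - d / B)"
  show "\<exists>\<tau><1. \<forall>t. \<tau> < t \<and> t < 1 \<longrightarrow> (\<forall>z\<in>torus \<inter> corner \<xi> (\<rho> / 2). norm (H (t *\<^sub>R z) - g z) \<le> e)"
  proof (intro exI conjI allI impI ballI)
    show "\<tau> < 1" using \<rho> \<open>d > 0\<close> \<open>B > 0\<close> by (simp add: \<tau>_def)
    fix t z assume t: "\<tau> < t \<and> t < 1" and z: "z \<in> torus \<inter> corner \<xi> (\<rho> / 2)"
    then have zT: "z \<in> T"
      by (auto simp: T_def corner_iff set_product_def less_imp_le)
    have "t *\<^sub>R z - z = (t - 1) *\<^sub>R z"
      by (simp add: scaleR_diff_left)
    then have "dist (t *\<^sub>R z) z = (1 - t) * norm z"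
      using t by (simp add: dist_norm)
    also have "\<dots> \<le> (1 - t) * B"
      using B[OF zT] t by (intro mult_left_mono) auto
    also have "\<dots> < d"
      using t \<open>B > 0\<close> by (auto simp: \<tau>_def field_simps)
    finally have "dist (H (t *\<^sub>R z)) (H z) < e"
      using CI[of t z] CI[of 1 z] zT t \<rho> by (intro d) (auto simp: \<tau>_def)
    then show "norm (H (t *\<^sub>R z) - g z) \<le> e"
      using H[OF T_corner[OF zT]] by (simp add: dist_norm)
  qed
qed (use that in blast)+

text \<open>On the slice in direction \<open>j\<close> an extension would vanish on the arc where \<open>Im (cnj (\<xi> $ j) * w) \<le> 0\<close>. By
  the two-constants estimate with arbitrarily small \<open>\<epsilon>\<close> it would vanish near this arc, hence identically, although
  the boundary values on the other side of \<open>\<xi> $ j\<close> are not zero.\<close>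

lemma one_sided_not_extendable:
  fixes \<beta> :: "real \<Rightarrow> real"
  assumes \<beta>: "\<And>x. x \<le> 0 \<Longrightarrow> \<beta> x = 0" "\<And>x. x > 0 \<Longrightarrow> \<beta> x \<noteq> 0"
    and \<xi>: "\<xi> \<in> torus" and \<rho>: "0 < \<rho>" "\<rho> \<le> 1"
  shows "\<not> extends_into_corner (\<lambda>z. of_real (\<beta> (Im (cnj (\<xi> $ j) * z $ j)))) (\<xi> :: complex^'n::finite) \<rho> M H"
proof
  assume ext: "extends_into_corner (\<lambda>z. of_real (\<beta> (Im (cnj (\<xi> $ j) * z $ j)))) \<xi> \<rho> M H"
  define a where "a = \<xi> $ j"
  have a: "norm a = 1" "cnj a * a = 1"
    using \<xi> by (auto simp: a_def torus_iff complex_norm_square[symmetric] mult.commute)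
  define G where "G = (\<lambda>w. H (replace_coord j w \<xi>))"
  have \<xi>_corner: "\<xi> \<in> corner \<xi> \<rho>"
    using \<xi> \<rho> by (auto simp: corner_iff torus_iff)
  have cont: "continuous_on (cball 0 1 \<inter> ball a \<rho>) G" and hol: "G holomorphic_on ball 0 1 \<inter> ball a \<rho>"
    using extends_into_corner_slicewise[OF ext] \<xi>_corner
    unfolding slicewise_holomorphic_def G_def a_def by blast+
  have mem: "replace_coord j w \<xi> \<in> corner \<xi> \<rho>" if "w \<in> cball 0 1 \<inter> ball a \<rho>" for w
    using replace_coord_in_corner[OF \<xi>_corner] that unfolding a_def by blast
  have bound: "norm (G w) \<le> M" if "w \<in> cball 0 1 \<inter> ball a \<rho>" for w
    using ext mem[OF that] unfolding extends_into_corner_def G_def by blast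
  have arc: "G w = of_real (\<beta> (Im (cnj a * w)))" if "w \<in> sphere 0 1 \<inter> ball a \<rho>" for w
  proof -
    have "replace_coord j w \<xi> \<in> torus \<inter> corner \<xi> \<rho>"
      using that mem[of w] \<xi> by (auto simp: torus_iff)
    then show ?thesis
      using ext unfolding extends_into_corner_def G_def a_def by simp
  qed
  obtain d where "d > 0" and d: "\<And>t. \<bar>t\<bar> < d \<Longrightarrow> dist (a * cis t) a < \<rho>"
  proof -
    have "isCont (\<lambda>t. a * exp (\<i> * of_real t)) 0"
      by (intro continuous_intros)
    then have "isCont (\<lambda>t. a * cis t) 0"
      by (simp add: cis_conv_exp)
    then have "\<exists>d>0. \<forall>t. dist t 0 < d \<longrightarrow> dist (a * cis t) (a * cis 0) < \<rho>"
      using \<rho>(1) unfolding continuous_at_eps_delta by blast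
    then show thesis
      using that by (auto simp: dist_norm)
  qed
  define t where "t = min (d / 2) 1"
  have t: "0 < t" "t < d" "t < pi"
    using \<open>d > 0\<close> pi_gt3 by (auto simp: t_def min_def)
  have cis_mem: "a * cis x \<in> sphere 0 1 \<inter> ball a \<rho>" if "\<bar>x\<bar> < d" for x
    using d[OF that] a by (auto simp: norm_mult dist_commute)
  have Im_cis: "Im (cnj a * (a * cis x)) = sin x" for x
    using a(2) by (simp add: mult.assoc[symmetric])
  define \<eta> where "\<eta> = a * cis (- t)"
  have \<eta>: "\<eta> \<in> sphere 0 1 \<inter> ball a \<rho>" "Im (cnj a * \<eta>) < 0"
    unfolding \<eta>_def Im_cis using cis_mem[of "- t"] t sin_gt_zero[of t] by auto
  have "open (ball a \<rho> \<inter> {w. Im (cnj a * w) < 0})"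
    by (intro open_Int open_ball open_Collect_less continuous_intros)
  then obtain r0 where "r0 > 0" and r0: "ball \<eta> r0 \<subseteq> ball a \<rho> \<inter> {w. Im (cnj a * w) < 0}"
    using \<eta> open_contains_ball by (metis (no_types, lifting) IntD2 IntI mem_Collect_eq)
  define r where "r = min r0 1"
  have r: "0 < r" "r \<le> 1" "ball \<eta> r \<subseteq> ball a \<rho> \<inter> {w. Im (cnj a * w) < 0}"
    using \<open>r0 > 0\<close> r0 by (auto simp: r_def)
  have zero: "G w = 0" if w: "w \<in> cball 0 1 \<inter> ball \<eta> (r\<^sup>2 / 8)" for w
  proof (rule ccontr)
    assume "G w \<noteq> 0"
    define B where "B = max M (norm (G w))"
    have B: "B > 0" "M \<le> B" "norm (G w) \<le> B"
      using \<open>G w \<noteq> 0\<close> by (auto simp: B_def less_max_iff_disj)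
    \<comment> \<open>chosen such that \<open>sqrt (B * \<epsilon>)\<close> is half of \<open>norm (G w)\<close>\<close>
    define \<epsilon> where "\<epsilon> = (norm (G w))\<^sup>2 / (4 * B)"
    have "norm (G w) * norm (G w) \<le> B * B"
      using B by (intro mult_mono) auto
    moreover have "0 \<le> B * B" by simp
    ultimately have "norm (G w) * norm (G w) \<le> B * (B * 4)"
      by linarith
    then have \<epsilon>: "0 < \<epsilon>" "\<epsilon> \<le> B" "B * \<epsilon> = (norm (G w) / 2)\<^sup>2"
      using B \<open>G w \<noteq> 0\<close> by (auto simp: \<epsilon>_def field_simps power2_eq_square)
    have "norm (G w) \<le> sqrt (B * \<epsilon>)"
    proof (rule two_constants_arc[where G = G and w = w and \<xi> = \<eta> and \<rho> = r])
      show "norm \<eta> = 1" using \<eta> by auto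
      show "continuous_on (cball 0 1 \<inter> ball \<eta> r) G"
        using r(3) by (intro continuous_on_subset[OF cont]) auto
      show "G holomorphic_on ball 0 1 \<inter> ball \<eta> r"
        using r(3) by (intro holomorphic_on_subset[OF hol]) auto
      show "norm (G x) \<le> B" if "x \<in> cball 0 1 \<inter> ball \<eta> r" for x
        using bound[of x] that r(3) B(2) by auto
      show "norm (G x) \<le> \<epsilon>" if "x \<in> sphere 0 1 \<inter> ball \<eta> r" for x
      proof -
        have "x \<in> sphere 0 1 \<inter> ball a \<rho>" "Im (cnj a * x) \<le> 0"
          using that r(3) by auto
        then show ?thesis
          using arc[of x] \<beta>(1) \<epsilon>(1) by simp
      qed
    qed (use r \<epsilon> w in auto)
    then show False
      using \<open>G w \<noteq> 0\<close> \<epsilon>(3) by simp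
  qed
  have zero': "G w = 0" if w: "w \<in> ball 0 1 \<inter> ball a \<rho>" for w
  proof (rule analytic_continuation_open[where s = "ball 0 1 \<inter> ball \<eta> (r\<^sup>2 / 8)" and s' = "ball 0 1 \<inter> ball a \<rho>" and f = G and g = "\<lambda>_. 0" and z = w])
    have "\<eta> \<in> closure (ball 0 1 \<inter> ball \<eta> (r\<^sup>2 / 8))"
      using \<eta> r(1) by (intro in_closure_open_corner) auto
    then show "ball 0 1 \<inter> ball \<eta> (r\<^sup>2 / 8) \<noteq> {}"
      by (metis closure_empty empty_iff)
    show "connected (ball 0 1 \<inter> ball a \<rho>)"
      by (intro convex_connected convex_Int convex_ball)
    have "ball \<eta> (r\<^sup>2 / 8) \<subseteq> ball \<eta> r"
      using shrunk_radius[OF r(1,2)] by (intro subset_ball) auto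
    then show "ball 0 1 \<inter> ball \<eta> (r\<^sup>2 / 8) \<subseteq> ball 0 1 \<inter> ball a \<rho>"
      using r(3) by blast
  qed (use hol zero w in auto)
  have \<eta>': "a * cis t \<in> sphere 0 1 \<inter> ball a \<rho>"
    using cis_mem[of t] t by auto
  then have "a * cis t \<in> closure (ball 0 1 \<inter> ball a \<rho>)"
    by (intro in_closure_open_corner) auto
  then obtain x where x': "\<forall>m. x m \<in> ball 0 1 \<inter> ball a \<rho>" and lim: "x \<longlonglongrightarrow> a * cis t"
    unfolding closure_sequential by (elim exE conjE)
  have "(\<lambda>m. G (x m)) \<longlonglongrightarrow> G (a * cis t)"
    using x' \<eta>' by (intro continuous_on_tendsto_compose[OF cont lim] always_eventually) (auto simp: less_imp_le)
  moreover have "(\<lambda>m. G (x m)) = (\<lambda>m. 0)"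
    using zero' x' by auto
  ultimately have "G (a * cis t) = 0"
    using LIMSEQ_unique tendsto_const by metis
  then show False
    using arc[OF \<eta>'] \<beta>(2)[of "sin t"] sin_gt_zero[OF t(1,3)] unfolding Im_cis by simp
qed

section \<open>A smooth function that is flat on one side\<close>

text \<open>The factors \<open>inverse x ^ k\<close> occur in the derivatives of \<open>exp (- 1 / x)\<close>; with them the family is closed
  under differentiation up to linear combinations.\<close>

definition flat_exp :: "nat \<Rightarrow> real \<Rightarrow> real" where
  "flat_exp k x = (if x > 0 then exp (- inverse x) * inverse x ^ k else 0)"

lemma power_le_fact_exp:
  fixes u :: real
  assumes "u \<ge> 0"
  shows "u ^ n \<le> fact n * exp u"
proof -
  have "(\<Sum>i\<in>{n}. u ^ i /\<^sub>R fact i) \<le> (\<Sum>i. u ^ i /\<^sub>R fact i)"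
    using assms by (intro sum_le_suminf summable_exp_generic) auto
  then have "u ^ n / fact n \<le> exp u"
    by (simp add: exp_def field_simps)
  then show ?thesis
    by (simp add: field_simps)
qed

lemma flat_exp_quadratic_bound: "\<bar>flat_exp k x\<bar> \<le> fact (k + 2) * x\<^sup>2"
proof (cases "x > 0")
  case True
  have "inverse x ^ (k + 2) \<le> fact (k + 2) * exp (inverse x)"
    using True by (intro power_le_fact_exp) auto
  then have "exp (- inverse x) * inverse x ^ (k + 2) \<le> exp (- inverse x) * (fact (k + 2) * exp (inverse x))"
    by (intro mult_left_mono) auto
  also have "\<dots> = fact (k + 2)"
    by (simp add: exp_minus field_simps)
  finally have "exp (- inverse x) * inverse x ^ (k + 2) * x\<^sup>2 \<le> fact (k + 2) * x\<^sup>2"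
    by (intro mult_right_mono) auto
  moreover have "exp (- inverse x) * inverse x ^ (k + 2) * x\<^sup>2 = exp (- inverse x) * inverse x ^ k"
  proof -
    have "exp (- inverse x) * inverse x ^ (k + 2) * x\<^sup>2 = exp (- inverse x) * inverse x ^ k * (inverse x * x)\<^sup>2"
      by (simp only: power_add power_mult_distrib mult.assoc)
    then show ?thesis using True by simp
  qed
  moreover have "\<bar>flat_exp k x\<bar> = exp (- inverse x) * inverse x ^ k"
    using True by (simp add: flat_exp_def)
  ultimately show ?thesis by linarith
qed (simp add: flat_exp_def)

lemma flat_exp_has_derivative:
  "(flat_exp k has_real_derivative flat_exp (k + 2) x - real k * flat_exp (k + 1) x) (at x)"
proof (cases x "0 :: real" rule: linorder_cases)
  case less
  have "((\<lambda>_. 0) has_real_derivative 0) (at x)" by simp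
  then have "(flat_exp k has_real_derivative 0) (at x)"
    by (rule has_field_derivative_transform_within_open[where S = "{..<0}"]) (use less in \<open>auto simp: flat_exp_def\<close>)
  then show ?thesis using less by (simp add: flat_exp_def)
next
  case equal
  have "((\<lambda>h. flat_exp k h / h) \<longlongrightarrow> 0) (at 0)"
  proof (rule Lim_null_comparison)
    show "\<forall>\<^sub>F h in at 0. norm (flat_exp k h / h) \<le> fact (k + 2) * \<bar>h\<bar>"
    proof (rule always_eventually, rule allI)
      fix h :: real
      show "norm (flat_exp k h / h) \<le> fact (k + 2) * \<bar>h\<bar>"
      proof (cases "h = 0")
        case False
        have "\<bar>flat_exp k h\<bar> \<le> fact (k + 2) * \<bar>h\<bar> * \<bar>h\<bar>"
          using flat_exp_quadratic_bound[of k h] by (simp add: power2_eq_square abs_mult_self_eq mult.assoc)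
        then show ?thesis
          using False by (simp add: abs_divide pos_divide_le_eq)
      qed simp
    qed
    show "((\<lambda>h. fact (k + 2) * \<bar>h\<bar>) \<longlongrightarrow> 0) (at (0 :: real))"
      by (intro tendsto_mult_right_zero tendsto_rabs_zero tendsto_ident_at)
  qed
  moreover have "flat_exp k 0 = 0" for k
    by (simp add: flat_exp_def)
  ultimately show ?thesis
    unfolding equal DERIV_def by simp
next
  case greater
  have "((\<lambda>x. exp (- inverse x) * inverse x ^ k) has_real_derivative
      flat_exp (k + 2) x - real k * flat_exp (k + 1) x) (at x)"
  proof (cases k)
    case 0
    then show ?thesis
      using greater by (auto intro!: derivative_eq_intros simp: flat_exp_def power2_eq_square)
  next
    case (Suc m)
    have "(inverse has_real_derivative - (inverse x * inverse x)) (at x)"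
      using DERIV_inverse[of x] greater by simp
    from DERIV_mult[OF DERIV_chain2[OF DERIV_exp DERIV_minus[OF this]] DERIV_power_Suc[OF this, of m]]
    show ?thesis
      using greater by (simp add: flat_exp_def Suc algebra_simps)
  qed
  then show ?thesis
    by (rule has_field_derivative_transform_within_open[where S = "{0<..}"]) (use greater in \<open>auto simp: flat_exp_def\<close>)
qed

text \<open>Differentiation with respect to the angle of \<open>z $ j\<close> maps \<open>Im (c * z $ j)\<close> to \<open>Re (c * z $ j)\<close> and
  \<open>Re (c * z $ j)\<close> to \<open>- Im (c * z $ j)\<close>. The following set is closed under it and contains the function
  \<open>flat_exp 0 (Im (c * z $ j))\<close>.\<close>

inductive_set flat_algebra :: "complex \<Rightarrow> 'n::finite \<Rightarrow> (complex^'n \<Rightarrow> complex) set"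
  for c :: complex and j :: "'n::finite" where
  flat: "(\<lambda>z. of_real (flat_exp k (Im (c * z $ j)))) \<in> flat_algebra c j"
| add: "u \<in> flat_algebra c j \<Longrightarrow> v \<in> flat_algebra c j \<Longrightarrow> (\<lambda>z. u z + v z) \<in> flat_algebra c j"
| const: "u \<in> flat_algebra c j \<Longrightarrow> (\<lambda>z. b * u z) \<in> flat_algebra c j"
| Re: "u \<in> flat_algebra c j \<Longrightarrow> (\<lambda>z. of_real (Re (c * z $ j)) * u z) \<in> flat_algebra c j"
| Im: "u \<in> flat_algebra c j \<Longrightarrow> (\<lambda>z. of_real (Im (c * z $ j)) * u z) \<in> flat_algebra c j"

lemma flat_algebra_continuous: "u \<in> flat_algebra c j \<Longrightarrow> continuous_on UNIV u"
proof (induction rule: flat_algebra.induct)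
  case (flat k)
  have "continuous_on UNIV (flat_exp k)"
    using DERIV_isCont[OF flat_exp_has_derivative] by (simp add: continuous_on_eq_continuous_at)
  then have "continuous_on UNIV (\<lambda>z. flat_exp k (Im (c * z $ j)))"
    by (rule continuous_on_compose2) (auto intro!: continuous_intros)
  then show ?case
    by (rule continuous_on_of_real)
next
  case (add u v)
  then show ?case by (intro continuous_on_add)
next
  case (const u b)
  then show ?case by (intro continuous_on_mult continuous_on_const)
next
  case (Re u)
  have "continuous_on UNIV (\<lambda>z. complex_of_real (Re (c * z $ j)))"
    by (intro continuous_intros)
  then show ?case using Re.IH by (rule continuous_on_mult)
next
  case (Im u)
  have "continuous_on UNIV (\<lambda>z. complex_of_real (Im (c * z $ j)))"
    by (intro continuous_intros)
  then show ?case using Im.IH by (rule continuous_on_mult)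
qed

lemma flat_algebra_one_coordinate:
  "u \<in> flat_algebra c j \<Longrightarrow> z $ j = w $ j \<Longrightarrow> u z = u w"
  by (induction rule: flat_algebra.induct) simp_all

lemma Re_Im_rotate_derivative:
  fixes z :: "complex^'n::finite"
  shows "((\<lambda>t. Re (c * torus_rotate j t z $ j)) has_real_derivative - Im (c * z $ j)) (at 0)"
    and "((\<lambda>t. Im (c * torus_rotate j t z $ j)) has_real_derivative Re (c * z $ j)) (at 0)"
proof -
  have "(\<lambda>t. Re (c * torus_rotate j t z $ j)) = (\<lambda>t. cos t * Re (c * z $ j) - sin t * Im (c * z $ j))"
    by (auto simp: torus_rotate_def algebra_simps)
  then show "((\<lambda>t. Re (c * torus_rotate j t z $ j)) has_real_derivative - Im (c * z $ j)) (at 0)"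
    by (auto intro!: derivative_eq_intros)
  have "(\<lambda>t. Im (c * torus_rotate j t z $ j)) = (\<lambda>t. cos t * Im (c * z $ j) + sin t * Re (c * z $ j))"
    by (auto simp: torus_rotate_def algebra_simps)
  then show "((\<lambda>t. Im (c * torus_rotate j t z $ j)) has_real_derivative Re (c * z $ j)) (at 0)"
    by (auto intro!: derivative_eq_intros)
qed

lemma flat_algebra_derivative:
  fixes u :: "complex^'n::finite \<Rightarrow> complex"
  assumes "u \<in> flat_algebra c j"
  shows "\<exists>v\<in>flat_algebra c j. \<forall>z. ((\<lambda>t. u (torus_rotate i t z)) has_vector_derivative v z) (at 0)"
proof (cases "i = j")
  case False
  have "u (torus_rotate i t z) = u z" for t z
    using False by (intro flat_algebra_one_coordinate[OF assms]) (simp add: torus_rotate_def)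
  then show ?thesis
    by (intro bexI[OF _ flat_algebra.const[OF assms, of 0]]) simp
next
  case True
  let ?rot = "\<lambda>t z. torus_rotate j t z :: complex^'n"
  have Re: "((\<lambda>t. complex_of_real (Re (c * ?rot t z $ j))) has_vector_derivative - of_real (Im (c * z $ j))) (at 0)"
    and Im: "((\<lambda>t. complex_of_real (Im (c * ?rot t z $ j))) has_vector_derivative of_real (Re (c * z $ j))) (at 0)" for z
    using has_vector_derivative_of_real[OF Re_Im_rotate_derivative(1)[of c j z]]
      has_vector_derivative_of_real[OF Re_Im_rotate_derivative(2)[of c j z]]
    by simp_all
  show ?thesis
    unfolding True using assms
  proof (induction rule: flat_algebra.induct)
    case (flat k)
    let ?f = "\<lambda>k z. complex_of_real (flat_exp k (Im (c * z $ j)))"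
    have deriv: "((\<lambda>t. ?f k (?rot t z)) has_vector_derivative
        of_real (Re (c * z $ j)) * (?f (k + 2) z + - of_nat k * ?f (k + 1) z)) (at 0)" for z
    proof -
      have "((\<lambda>t. flat_exp k (Im (c * ?rot t z $ j))) has_real_derivative
          (flat_exp (k + 2) (Im (c * z $ j)) - real k * flat_exp (k + 1) (Im (c * z $ j))) * Re (c * z $ j)) (at 0)"
        using DERIV_chain2[OF flat_exp_has_derivative Re_Im_rotate_derivative(2)[of c j z], of k] by simp
      from has_vector_derivative_of_real[OF this, where 'a = complex]
      have "((\<lambda>t. ?f k (?rot t z)) has_vector_derivative complex_of_real
          ((flat_exp (k + 2) (Im (c * z $ j)) - real k * flat_exp (k + 1) (Im (c * z $ j))) * Re (c * z $ j))) (at 0)" .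
      moreover have "complex_of_real ((a - real k * b) * d) = of_real d * (of_real a + - of_nat k * of_real b)" for a b d
        by (simp add: algebra_simps)
      ultimately show ?thesis by (simp only:)
    qed
    have mem: "(\<lambda>z. of_real (Re (c * z $ j)) * (?f (k + 2) z + - of_nat k * ?f (k + 1) z)) \<in> flat_algebra c j"
      by (intro flat_algebra.intros)
    show ?case
      by (rule bexI[OF _ mem], rule allI, rule deriv)
  next
    case (add u v)
    then obtain u' v' where "u' \<in> flat_algebra c j" "v' \<in> flat_algebra c j"
      "\<And>z. ((\<lambda>t. u (?rot t z)) has_vector_derivative u' z) (at 0)"
      "\<And>z. ((\<lambda>t. v (?rot t z)) has_vector_derivative v' z) (at 0)" by blast
    then show ?case
      by (intro bexI[OF _ flat_algebra.add[of u' c j v']]) (auto intro: has_vector_derivative_add)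
  next
    case (const u b)
    then obtain u' where "u' \<in> flat_algebra c j"
      "\<And>z. ((\<lambda>t. u (?rot t z)) has_vector_derivative u' z) (at 0)" by blast
    then show ?case
      by (intro bexI[OF _ flat_algebra.const[of u' c j b]]) (auto intro: has_vector_derivative_mult_right)
  next
    case (Re u)
    then obtain u' where u': "u' \<in> flat_algebra c j"
      "\<And>z. ((\<lambda>t. u (?rot t z)) has_vector_derivative u' z) (at 0)" by blast
    let ?v = "\<lambda>z. of_real (Re (c * z $ j)) * u' z + (- 1) * (of_real (Im (c * z $ j)) * u z)"
    have mem: "?v \<in> flat_algebra c j"
      by (intro flat_algebra.intros u'(1) Re.hyps)
    have deriv: "((\<lambda>t. of_real (Re (c * ?rot t z $ j)) * u (?rot t z)) has_vector_derivative ?v z) (at 0)" for z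
      using has_vector_derivative_mult[OF \<open>\<And>z. ((\<lambda>t. complex_of_real (Re (c * ?rot t z $ j))) has_vector_derivative - of_real (Im (c * z $ j))) (at 0)\<close>[of z] u'(2)[of z]]
      by (simp only: torus_rotate_0 mult_minus_left mult_1)
    show ?case
      by (rule bexI[OF _ mem], rule allI, rule deriv)
  next
    case (Im u)
    then obtain u' where u': "u' \<in> flat_algebra c j"
      "\<And>z. ((\<lambda>t. u (?rot t z)) has_vector_derivative u' z) (at 0)" by blast
    let ?v = "\<lambda>z. of_real (Im (c * z $ j)) * u' z + of_real (Re (c * z $ j)) * u z"
    have mem: "?v \<in> flat_algebra c j"
      by (intro flat_algebra.intros u'(1) Im.hyps)
    have deriv: "((\<lambda>t. of_real (Im (c * ?rot t z $ j)) * u (?rot t z)) has_vector_derivative ?v z) (at 0)" for z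
      using has_vector_derivative_mult[OF \<open>\<And>z. ((\<lambda>t. complex_of_real (Im (c * ?rot t z $ j))) has_vector_derivative of_real (Re (c * z $ j))) (at 0)\<close>[of z] u'(2)[of z]]
      by simp
    show ?case
      by (rule bexI[OF _ mem], rule allI, rule deriv)
  qed
qed

lemma Cp_torus_flat:
  fixes j :: "'n::finite"
  shows "Cp_torus p (\<lambda>z. of_real (flat_exp 0 (Im (c * z $ j))) :: complex)"
proof -
  have "\<forall>i u. \<exists>v. u \<in> flat_algebra c j \<longrightarrow> v \<in> flat_algebra c j \<and>
      (\<forall>z. ((\<lambda>t. u (torus_rotate i t z)) has_vector_derivative v z) (at 0))"
    using flat_algebra_derivative[of _ c j] by blast
  then obtain \<delta> where \<delta>: "\<And>i u. u \<in> flat_algebra c j \<Longrightarrow> \<delta> i u \<in> flat_algebra c j"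
    "\<And>i u z. u \<in> flat_algebra c j \<Longrightarrow> ((\<lambda>t. u (torus_rotate i t z)) has_vector_derivative \<delta> i u z) (at 0)"
    by metis
  define D where "D = (\<lambda>js. foldr \<delta> js (\<lambda>z. of_real (flat_exp 0 (Im (c * z $ j)))))"
  have D: "D js \<in> flat_algebra c j" for js
  proof (induction js)
    case Nil
    show ?case
      unfolding D_def foldr.simps id_apply by (rule flat_algebra.flat)
  next
    case (Cons i js)
    then show ?case
      by (simp add: D_def \<delta>(1))
  qed
  show ?thesis
  proof (rule Cp_torus_by_candidates(1)[of p D])
    show "((\<lambda>t. D js (torus_rotate i t z)) has_vector_derivative D (i # js) z) (at 0)" for js i z
      using \<delta>(2)[OF D, of js i z] by (simp add: D_def)
    show "continuous_on torus (D js)" for js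
      by (rule continuous_on_subset[OF flat_algebra_continuous[OF D]]) simp
  qed (simp add: D_def)
qed

section \<open>Transport to the product domain\<close>

lemma homeomorphism_inv_into:
  assumes "homeomorphism S T h k"
  shows "homeomorphism S T h (inv_into S h)"
proof (rule homeomorphism_cong[OF assms])
  show "inv_into S h y = k y" if "y \<in> T" for y
  proof -
    have "k y \<in> S" "h (k y) = y"
      using assms that by (auto simp: homeomorphism_def)
    moreover have "inj_on h S"
      using assms by (metis homeomorphism_def inj_on_inverseI)
    ultimately show ?thesis by (metis inv_into_f_f)
  qed
qed auto

lemma continuous_on_map_product:
  fixes h :: "'n::finite \<Rightarrow> complex \<Rightarrow> complex"
  assumes "\<And>i. continuous_on (A i) (h i)"
  shows "continuous_on (set_product A) (map_product h)"
  unfolding map_product_def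
proof (rule continuous_on_vec_lambda)
  fix i
  have "continuous_on (set_product A) (\<lambda>z. z $ i)"
    by (intro continuous_intros)
  then show "continuous_on (set_product A) (\<lambda>z. h i (z $ i))"
    by (rule continuous_on_compose2[OF assms]) (auto simp: set_product_def)
qed

text \<open>In this locale \<open>\<Phi>\<close> is the extension to the closed polydisc of the product of the Riemann maps, \<open>V\<close> the
  product domain and \<open>K\<close> the image of the torus. The coordinates of \<open>\<Psi>\<close> are the inverses on the closures of the
  factors, so that \<open>\<Psi>\<close> is the inverse of \<open>\<Phi>\<close> on the closure of \<open>V\<close>.\<close>

locale riemann_product =
  fixes \<Omega> :: "'n::finite \<Rightarrow> complex set" and \<phi> :: "'n \<Rightarrow> complex \<Rightarrow> complex"
  assumes riemann_maps: "\<And>i. extended_riemann_map (\<phi> i) (\<Omega> i)"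
begin

abbreviation "\<Phi> \<equiv> map_product \<phi>"
abbreviation "\<Psi> \<equiv> map_product (\<lambda>i. inv_into (cball 0 1) (\<phi> i))"
abbreviation "V \<equiv> set_product \<Omega>"
abbreviation "K \<equiv> \<Phi> ` torus"

lemma coordinate_homeomorphism:
  "homeomorphism (cball 0 1) (closure (\<Omega> i)) (\<phi> i) (inv_into (cball 0 1) (\<phi> i))"
  using riemann_maps[of i] homeomorphism_inv_into unfolding extended_riemann_map_def by blast

lemma coordinate_inverse:
  "norm w \<le> 1 \<Longrightarrow> inv_into (cball 0 1) (\<phi> i) (\<phi> i w) = w"
  "x \<in> closure (\<Omega> i) \<Longrightarrow> \<phi> i (inv_into (cball 0 1) (\<phi> i) x) = x"
  "x \<in> closure (\<Omega> i) \<Longrightarrow> norm (inv_into (cball 0 1) (\<phi> i) x) \<le> 1"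
proof -
  show "inv_into (cball 0 1) (\<phi> i) (\<phi> i w) = w" if "norm w \<le> 1"
    using homeomorphism_apply1[OF coordinate_homeomorphism[of i], of w] that by simp
  assume x: "x \<in> closure (\<Omega> i)"
  show "\<phi> i (inv_into (cball 0 1) (\<phi> i) x) = x"
    by (rule homeomorphism_apply2[OF coordinate_homeomorphism x])
  have "inv_into (cball 0 1) (\<phi> i) x \<in> cball 0 1"
    using homeomorphism_image2[OF coordinate_homeomorphism[of i]] x by blast
  then show "norm (inv_into (cball 0 1) (\<phi> i) x) \<le> 1" by simp
qed

lemma coordinate_image: "\<phi> i ` ball 0 1 = \<Omega> i"
  using riemann_maps[of i] unfolding extended_riemann_map_def bij_betw_def by blast

lemma coordinate_in_domain_iff: "norm w \<le> 1 \<Longrightarrow> \<phi> i w \<in> \<Omega> i \<longleftrightarrow> norm w < 1"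
proof
  assume w: "norm w \<le> 1" and "\<phi> i w \<in> \<Omega> i"
  then obtain v where "v \<in> ball 0 1" "\<phi> i w = \<phi> i v"
    unfolding coordinate_image[symmetric] by (elim imageE)
  then have "norm v < 1" "\<phi> i v = \<phi> i w"
    by simp_all
  then show "norm w < 1"
    using coordinate_inverse(1)[of v i] coordinate_inverse(1)[OF w, of i] by (metis less_imp_le)
next
  assume "norm w < 1"
  then show "\<phi> i w \<in> \<Omega> i"
    unfolding coordinate_image[symmetric] by simp
qed

lemma coordinate_holomorphic: "\<phi> i holomorphic_on ball 0 1"
  using riemann_maps[of i] by (simp add: extended_riemann_map_def)

lemma coordinate_inj: "inj_on (\<phi> i) (ball 0 1)"
  by (rule inj_on_inverseI[of _ "inv_into (cball 0 1) (\<phi> i)"]) (simp add: coordinate_inverse(1))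

lemma open_coordinate_domain: "open (\<Omega> i)"
  using open_mapping_thm3[OF coordinate_holomorphic open_ball coordinate_inj, of i]
  by (simp add: coordinate_image)

lemma coordinate_inverse_holomorphic: "inv_into (cball 0 1) (\<phi> i) holomorphic_on \<Omega> i"
proof -
  obtain g where g: "g holomorphic_on (\<phi> i ` ball 0 1)" "\<And>z. z \<in> ball 0 1 \<Longrightarrow> g (\<phi> i z) = z"
    using holomorphic_has_inverse[OF coordinate_holomorphic open_ball coordinate_inj, of i] by metis
  have "g x = inv_into (cball 0 1) (\<phi> i) x" if x: "x \<in> \<Omega> i" for x
  proof -
    obtain z where z: "z \<in> ball 0 1" "x = \<phi> i z"
      using x unfolding coordinate_image[symmetric] by (elim imageE)
    then show ?thesis
      using g(2)[OF z(1)] coordinate_inverse(1)[of z i] by simp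
  qed
  then show ?thesis
    using holomorphic_transform[OF g(1)[unfolded coordinate_image]] by blast
qed

lemma open_V: "open V"
  by (intro open_set_product open_coordinate_domain)

lemma closed_polydisc_iff: "z \<in> closed_polydisc \<longleftrightarrow> (\<forall>i. norm (z $ i) \<le> 1)" for z :: "complex^'n"
  by (simp add: closed_polydisc_def set_product_def)

lemma torus_subset: "(torus :: (complex^'n) set) \<subseteq> closed_polydisc"
  by (auto simp: torus_iff closed_polydisc_iff)

lemma corner_subset: "corner \<xi> \<rho> \<subseteq> (closed_polydisc :: (complex^'n) set)"
  by (auto simp: corner_iff closed_polydisc_iff)

lemma Psi_Phi: "z \<in> closed_polydisc \<Longrightarrow> \<Psi> (\<Phi> z) = z"
  using coordinate_inverse(1) by (simp add: map_product_def vec_eq_iff closed_polydisc_iff)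

lemma Phi_in_V_iff: "z \<in> closed_polydisc \<Longrightarrow> \<Phi> z \<in> V \<longleftrightarrow> (\<forall>i. norm (z $ i) < 1)"
  using coordinate_in_domain_iff by (simp add: map_product_def set_product_def closed_polydisc_iff)

lemma Phi_continuous: "continuous_on closed_polydisc \<Phi>"
  unfolding closed_polydisc_def using coordinate_homeomorphism
  by (intro continuous_on_map_product) (auto simp: homeomorphism_def)

lemma Phi_inj: "inj_on \<Phi> closed_polydisc"
  by (rule inj_on_inverseI[of _ \<Psi>]) (rule Psi_Phi)

lemma closure_V: "closure V = \<Phi> ` closed_polydisc" and closure_V_coordinates: "closure V = set_product (\<lambda>i. closure (\<Omega> i))"
proof -
  have "closure V \<subseteq> set_product (\<lambda>i. closure (\<Omega> i))"
    using closure_subset by (intro closure_minimal closed_set_product) (auto simp: set_product_def)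
  moreover have "set_product (\<lambda>i. closure (\<Omega> i)) \<subseteq> \<Phi> ` closed_polydisc"
  proof
    fix x assume "x \<in> set_product (\<lambda>i. closure (\<Omega> i))"
    then have "\<Psi> x \<in> closed_polydisc" "\<Phi> (\<Psi> x) = x"
      using coordinate_inverse(2,3) by (auto simp: map_product_def set_product_def closed_polydisc_iff vec_eq_iff)
    then show "x \<in> \<Phi> ` closed_polydisc" by (metis imageI)
  qed
  moreover have "\<Phi> ` closed_polydisc \<subseteq> closure V"
  proof
    fix x assume "x \<in> \<Phi> ` closed_polydisc"
    then obtain z where z: "z \<in> closed_polydisc" "x = \<Phi> z" by blast
    define t where "t = (\<lambda>m. 1 - inverse (real (Suc m)))"
    have t: "0 \<le> t m" "t m < 1" for m
      by (simp_all add: t_def inverse_le_1_iff)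
    have mem: "t m *\<^sub>R z \<in> closed_polydisc" "\<forall>i. norm ((t m *\<^sub>R z) $ i) < 1" for m
    proof -
      have "norm ((t m *\<^sub>R z) $ i) < 1" for i
      proof -
        have "t m * norm (z $ i) \<le> t m"
          using z(1) t[of m] by (intro mult_left_le) (auto simp: closed_polydisc_iff)
        then show ?thesis using t[of m] by (simp add: le_less_trans)
      qed
      then show "t m *\<^sub>R z \<in> closed_polydisc" "\<forall>i. norm ((t m *\<^sub>R z) $ i) < 1"
        by (auto simp: closed_polydisc_iff less_imp_le)
    qed
    have "t \<longlonglongrightarrow> 1 - 0"
      unfolding t_def by (intro tendsto_intros LIMSEQ_inverse_real_of_nat)
    then have "(\<lambda>m. t m *\<^sub>R z) \<longlonglongrightarrow> (1 - 0) *\<^sub>R z"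
      by (intro tendsto_intros)
    then have "(\<lambda>m. t m *\<^sub>R z) \<longlonglongrightarrow> z" by simp
    then have "(\<lambda>m. \<Phi> (t m *\<^sub>R z)) \<longlonglongrightarrow> x"
      unfolding z(2)
      by (rule continuous_on_tendsto_compose[OF Phi_continuous _ z(1)]) (use mem in auto)
    moreover have "\<Phi> (t m *\<^sub>R z) \<in> V" for m
      using Phi_in_V_iff mem by blast
    ultimately show "x \<in> closure V"
      unfolding closure_sequential by (intro exI[of _ "\<lambda>m. \<Phi> (t m *\<^sub>R z)"] conjI allI)
  qed
  ultimately show "closure V = \<Phi> ` closed_polydisc" "closure V = set_product (\<lambda>i. closure (\<Omega> i))"
    by blast+
qed

lemma Psi_continuous: "continuous_on (closure V) \<Psi>"
  unfolding closure_V_coordinates using coordinate_homeomorphism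
  by (intro continuous_on_map_product) (auto simp: homeomorphism_def)

lemma Phi_Psi: "x \<in> closure V \<Longrightarrow> \<Phi> (\<Psi> x) = x" and Psi_closed_polydisc: "x \<in> closure V \<Longrightarrow> \<Psi> x \<in> closed_polydisc"
  unfolding closure_V using Psi_Phi by auto

lemma K_subset: "K \<subseteq> closure V"
  unfolding closure_V using torus_subset by blast

lemma V_K_disjoint: "x \<in> V \<Longrightarrow> x \<notin> K"
proof
  assume "x \<in> V" "x \<in> K"
  then obtain z where z: "z \<in> torus" "\<Phi> z \<in> V" by blast
  then have "norm (z $ undefined) < 1"
    using Phi_in_V_iff torus_subset by blast
  then show False using z(1) by (auto simp: torus_iff)
qed

lemma Phi_corner_in_ball:
  assumes \<xi>: "\<xi> \<in> torus" and r: "r > 0"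
  obtains \<rho> where "0 < \<rho>" "\<rho> \<le> 1" "\<And>z. z \<in> corner \<xi> \<rho> \<Longrightarrow> \<Phi> z \<in> ball (\<Phi> \<xi>) r \<inter> closure V"
proof -
  have "\<xi> \<in> closed_polydisc" using \<xi> torus_subset by blast
  then obtain d where d: "d > 0" "\<And>z. z \<in> closed_polydisc \<Longrightarrow> dist z \<xi> < d \<Longrightarrow> dist (\<Phi> z) (\<Phi> \<xi>) < r"
    using Phi_continuous r unfolding continuous_on_iff by metis
  define \<rho> where "\<rho> = min 1 (d / real CARD('n))"
  have "\<rho> \<le> d / real CARD('n)" by (simp add: \<rho>_def)
  then have "real CARD('n) * \<rho> \<le> d" by (simp add: field_simps)
  moreover have "0 < \<rho>" "\<rho> \<le> 1"
    using d(1) by (simp_all add: \<rho>_def)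
  ultimately have \<rho>: "0 < \<rho>" "\<rho> \<le> 1" "real CARD('n) * \<rho> \<le> d"
    by simp_all
  have "\<Phi> z \<in> ball (\<Phi> \<xi>) r \<inter> closure V" if z: "z \<in> corner \<xi> \<rho>" for z
  proof -
    have "dist z \<xi> < real CARD('n) * \<rho>"
      using z by (intro dist_vec_less) (simp add: corner_iff dist_commute)
    then have "dist (\<Phi> z) (\<Phi> \<xi>) < r"
      using \<rho>(3) z corner_subset by (intro d(2)) auto
    then show ?thesis
      using z corner_subset unfolding closure_V by (auto simp: dist_commute)
  qed
  then show thesis using that \<rho> by blast
qed

lemma Psi_ball_in_corner:
  assumes \<xi>: "\<xi> \<in> torus" and \<rho>: "\<rho> > 0"
  obtains r where "r > 0" "\<And>x. x \<in> ball (\<Phi> \<xi>) r \<inter> closure V \<Longrightarrow> \<Psi> x \<in> corner \<xi> \<rho>"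
    "\<And>x. x \<in> ball (\<Phi> \<xi>) r \<inter> V \<Longrightarrow> \<Psi> x \<in> open_corner \<xi> \<rho>"
proof -
  have \<xi>': "\<xi> \<in> closed_polydisc" "\<Phi> \<xi> \<in> closure V"
    using \<xi> torus_subset K_subset by blast+
  then obtain r where r: "r > 0" "\<And>x. x \<in> closure V \<Longrightarrow> dist x (\<Phi> \<xi>) < r \<Longrightarrow> dist (\<Psi> x) (\<Psi> (\<Phi> \<xi>)) < \<rho>"
    using Psi_continuous \<rho> unfolding continuous_on_iff by metis
  have corner: "\<Psi> x \<in> corner \<xi> \<rho>" if x: "x \<in> ball (\<Phi> \<xi>) r \<inter> closure V" for x
  proof -
    have "dist (\<Psi> x) \<xi> < \<rho>"
      using r(2)[of x] x Psi_Phi[OF \<xi>'(1)] by (simp add: dist_commute)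
    then have "dist (\<Psi> x $ i) (\<xi> $ i) < \<rho>" for i
      using dist_vec_nth_le[of "\<Psi> x" i \<xi>] by linarith
    then show ?thesis
      using Psi_closed_polydisc[of x] x by (simp add: corner_iff closed_polydisc_iff dist_commute)
  qed
  have "\<Psi> x \<in> open_corner \<xi> \<rho>" if x: "x \<in> ball (\<Phi> \<xi>) r \<inter> V" for x
  proof -
    have x': "x \<in> closure V" using x closure_subset by blast
    then have "norm (\<Psi> x $ i) < 1" for i
      using x Phi_in_V_iff[OF Psi_closed_polydisc[OF x']] Phi_Psi[OF x'] by simp
    then show ?thesis
      using corner[of x] x x' by (simp add: corner_iff open_corner_iff)
  qed
  then show thesis using that r(1) corner by blast
qed

lemma Phi_open_corner: "z \<in> open_corner \<xi> \<rho> \<Longrightarrow> \<Phi> z \<in> V"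
  using Phi_in_V_iff[of z] by (auto simp: open_corner_iff closed_polydisc_iff less_imp_le)

lemma holomorphic_several_pullback:
  assumes "holomorphic_several F (ball \<zeta> r \<inter> V)"
    and "\<And>z. z \<in> open_corner \<xi> \<rho> \<Longrightarrow> \<Phi> z \<in> ball \<zeta> r"
  shows "holomorphic_several (\<lambda>z. F (\<Phi> z)) (open_corner \<xi> \<rho>)"
proof (rule holomorphic_several_compose_map_product[OF assms(1) _ coordinate_holomorphic open_ball])
  show "open (ball \<zeta> r \<inter> V)" by (intro open_Int open_ball open_V)
  show "open_corner \<xi> \<rho> \<subseteq> set_product (\<lambda>i. ball 0 1)"
    by (auto simp: open_corner_def set_product_def)
  show "\<Phi> z \<in> ball \<zeta> r \<inter> V" if "z \<in> open_corner \<xi> \<rho>" for z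
    using assms(2)[OF that] Phi_open_corner[OF that] by blast
qed

lemma holomorphic_several_pushforward:
  assumes "holomorphic_several H (open_corner \<xi> \<rho>)"
    and "W \<subseteq> V" "\<And>x. x \<in> W \<Longrightarrow> \<Psi> x \<in> open_corner \<xi> \<rho>"
  shows "holomorphic_several (\<lambda>x. H (\<Psi> x)) W"
  by (rule holomorphic_several_compose_map_product[OF assms(1) open_open_corner
        coordinate_inverse_holomorphic open_coordinate_domain assms(2,3)])

lemma Cp_space_continuous:
  assumes "f \<in> Cp_space p \<Phi>"
  shows "continuous_on torus (f \<circ> \<Phi>)" and "continuous_on K f"
proof -
  show g: "continuous_on torus (f \<circ> \<Phi>)"
    using assms Cp_torus_continuous_on[of p "f \<circ> \<Phi>" "[]"] by (simp add: Cp_space_def)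
  have "continuous_on K (\<lambda>x. (f \<circ> \<Phi>) (\<Psi> x))"
  proof (rule continuous_on_compose2[OF g continuous_on_subset[OF Psi_continuous K_subset]])
    show "\<Psi> ` K \<subseteq> torus" using Psi_Phi torus_subset by force
  qed
  then show "continuous_on K f"
    by (rule continuous_on_eq) (use Phi_Psi K_subset in auto)
qed

subsection \<open>Three notions of extension and one\<close>

text \<open>Transporting \<open>H\<close> gives \<open>F\<close> near \<open>\<Phi> \<xi>\<close>; elsewhere on \<open>K\<close> it has to be \<open>f\<close>. The two definitions fit together
  continuously because the ball in the conclusion has half the radius of the ball on which \<open>H\<close> is used.\<close>

lemma continuous_extension_of_corner_extension:
  assumes \<xi>: "\<xi> \<in> torus" and \<rho>: "0 < \<rho>" and f: "f \<in> Cp_space p \<Phi>"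
    and ext: "extends_into_corner (f \<circ> \<Phi>) \<xi> \<rho> M H"
  obtains r F where "r > 0" "continuous_on ((ball (\<Phi> \<xi>) r \<inter> closure V) \<union> K) F"
    "bounded (F ` ((ball (\<Phi> \<xi>) r \<inter> closure V) \<union> K))"
    "holomorphic_several F (ball (\<Phi> \<xi>) r \<inter> V)" "\<forall>x\<in>K. F x = f x"
proof -
  let ?\<zeta> = "\<Phi> \<xi>"
  obtain r where r: "r > 0" "\<And>x. x \<in> ball ?\<zeta> r \<inter> closure V \<Longrightarrow> \<Psi> x \<in> corner \<xi> \<rho>"
    "\<And>x. x \<in> ball ?\<zeta> r \<inter> V \<Longrightarrow> \<Psi> x \<in> open_corner \<xi> \<rho>"
    by (rule Psi_ball_in_corner[OF \<xi> \<rho>]) blast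
  define F where "F = (\<lambda>x. if x \<in> ball ?\<zeta> r \<inter> closure V then H (\<Psi> x) else f x)"
  have F_K: "F x = f x" if x: "x \<in> K" for x
  proof (cases "x \<in> ball ?\<zeta> r")
    case True
    have x': "x \<in> closure V" using x K_subset by blast
    have "\<Psi> x \<in> torus" using x Psi_Phi torus_subset by force
    then have "H (\<Psi> x) = f (\<Phi> (\<Psi> x))"
      using ext r(2)[of x] True x' unfolding extends_into_corner_def by simp
    then show ?thesis using Phi_Psi[OF x'] by (simp add: F_def)
  qed (simp add: F_def)
  let ?S = "(ball ?\<zeta> (r / 2) \<inter> closure V) \<union> K"
  let ?A = "?S \<inter> ball ?\<zeta> r" and ?B = "?S \<inter> - cball ?\<zeta> (r / 2)"
  have "continuous_on ?A F"
  proof (rule continuous_on_eq)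
    show "continuous_on ?A (\<lambda>x. H (\<Psi> x))"
    proof (rule continuous_on_compose2[of "corner \<xi> \<rho>" H])
      show "continuous_on (corner \<xi> \<rho>) H"
        using ext by (simp add: extends_into_corner_def)
      show "continuous_on ?A \<Psi>"
        by (rule continuous_on_subset[OF Psi_continuous]) (use K_subset in auto)
      show "\<Psi> ` ?A \<subseteq> corner \<xi> \<rho>"
        using r(2) K_subset by blast
    qed
    show "H (\<Psi> x) = F x" if "x \<in> ?A" for x
      using that K_subset by (auto simp: F_def)
  qed
  moreover have "continuous_on ?B F"
  proof (rule continuous_on_eq)
    show "continuous_on ?B f"
      by (rule continuous_on_subset[OF Cp_space_continuous(2)[OF f]]) auto
    show "f x = F x" if "x \<in> ?B" for x
      using that F_K by auto
  qed
  moreover have "?A \<union> ?B = ?S"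
    using r(1) by auto
  moreover have "openin (top_of_set ?S) ?A" "openin (top_of_set ?S) ?B"
    by (intro openin_open_Int open_ball) (intro openin_open_Int open_Compl closed_cball)
  ultimately have cont: "continuous_on ?S F"
    using continuous_on_Un_local_open[of ?A ?B F] by simp
  have "bounded (F ` ?S)"
  proof -
    have "bounded (f ` K)"
    proof (rule compact_imp_bounded, rule compact_continuous_image)
      show "continuous_on K f" by (rule Cp_space_continuous(2)[OF f])
      show "compact K"
        by (rule compact_continuous_image[OF continuous_on_subset[OF Phi_continuous torus_subset] compact_torus])
    qed
    then obtain B where B: "\<And>x. x \<in> K \<Longrightarrow> norm (f x) \<le> B"
      unfolding bounded_iff by blast
    have "norm (F x) \<le> max M B" if x: "x \<in> ?S" for x
    proof (cases "x \<in> K")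
      case True
      then show ?thesis using B[of x] F_K[of x] by (simp add: max.coboundedI2)
    next
      case False
      then have x': "x \<in> ball ?\<zeta> r \<inter> closure V"
        using x r(1) by auto
      then have "norm (H (\<Psi> x)) \<le> M"
        using ext r(2)[OF x'] unfolding extends_into_corner_def by blast
      then show ?thesis using x' by (simp add: F_def max.coboundedI1)
    qed
    then show ?thesis unfolding bounded_iff by blast
  qed
  have "holomorphic_several F (ball ?\<zeta> (r / 2) \<inter> V)"
  proof -
    have "ball ?\<zeta> (r / 2) \<inter> V \<subseteq> ball ?\<zeta> r \<inter> V"
      using r(1) by auto
    then have "holomorphic_several (\<lambda>x. H (\<Psi> x)) (ball ?\<zeta> (r / 2) \<inter> V)"
      using ext r(3) by (intro holomorphic_several_pushforward) (auto simp: extends_into_corner_def)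
    moreover have "H (\<Psi> x) = F x" if x: "x \<in> ball ?\<zeta> (r / 2) \<inter> V" for x
    proof -
      have "x \<in> ball ?\<zeta> r \<inter> closure V"
        using x r(1) closure_subset by auto
      then show ?thesis by (simp add: F_def)
    qed
    ultimately show ?thesis
      using holomorphic_several_cong[of "ball ?\<zeta> (r / 2) \<inter> V" "\<lambda>x. H (\<Psi> x)" F] by blast
  qed
  then show thesis
    using that[of "r / 2" F] r(1) cont \<open>bounded (F ` ?S)\<close> F_K by simp
qed

definition corner_extendable :: "(complex^'n \<Rightarrow> complex) \<Rightarrow> complex^'n \<Rightarrow> bool" where
  "corner_extendable f \<xi> \<longleftrightarrow> (\<exists>\<rho> M H. 0 < \<rho> \<and> \<rho> \<le> 1 \<and> extends_into_corner (f \<circ> \<Phi>) \<xi> \<rho> M H)"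

text \<open>The first direction holds because joint continuity implies separate continuity. In the second one the slices of
  \<open>F\<close> in the product domain become slices of \<open>F \<circ> \<Phi>\<close>, since \<open>\<Phi>\<close> acts on each coordinate separately.\<close>

lemma separately_extendable_iff:
  assumes \<xi>: "\<xi> \<in> torus" and f: "f \<in> Cp_space p \<Phi>"
  shows "separately_extendable_at V K f (\<Phi> \<xi>) \<longleftrightarrow> corner_extendable f \<xi>"
proof
  assume "corner_extendable f \<xi>"
  then obtain \<rho> M H where "0 < \<rho>" "extends_into_corner (f \<circ> \<Phi>) \<xi> \<rho> M H"
    unfolding corner_extendable_def by blast
  then obtain r F where F: "r > 0" "continuous_on ((ball (\<Phi> \<xi>) r \<inter> closure V) \<union> K) F"
    "bounded (F ` ((ball (\<Phi> \<xi>) r \<inter> closure V) \<union> K))"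
    "holomorphic_several F (ball (\<Phi> \<xi>) r \<inter> V)" "\<forall>x\<in>K. F x = f x"
    by (rule continuous_extension_of_corner_extension[OF \<xi> _ f])
  have "separately_continuous_on ((ball (\<Phi> \<xi>) r \<inter> closure V) \<union> K) F"
    unfolding separately_continuous_on_def
    by (intro allI, rule continuous_on_compose2[OF F(2) continuous_on_replace_coord]) blast
  then show "separately_extendable_at V K f (\<Phi> \<xi>)"
    unfolding separately_extendable_at_def
    by (intro exI[of _ r] exI[of _ F] conjI) (use F in simp_all)
next
  assume "separately_extendable_at V K f (\<Phi> \<xi>)"
  then obtain r F where r: "r > 0" and bdd: "bounded (F ` ((ball (\<Phi> \<xi>) r \<inter> closure V) \<union> K))"
    and sep: "separately_continuous_on ((ball (\<Phi> \<xi>) r \<inter> closure V) \<union> K) F"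
    and hol: "holomorphic_several F (ball (\<Phi> \<xi>) r \<inter> V)" and F: "\<forall>x\<in>K. F x = f x"
    unfolding separately_extendable_at_def by blast
  let ?S = "(ball (\<Phi> \<xi>) r \<inter> closure V) \<union> K"
  obtain \<rho> where \<rho>: "0 < \<rho>" "\<rho> \<le> 1" and sub: "\<And>z. z \<in> corner \<xi> \<rho> \<Longrightarrow> \<Phi> z \<in> ball (\<Phi> \<xi>) r \<inter> closure V"
    by (rule Phi_corner_in_ball[OF \<xi> r]) blast
  obtain M where "\<forall>y\<in>F ` ?S. norm y \<le> M"
    using bdd unfolding bounded_iff by (elim exE)
  then have M: "norm (F x) \<le> M" if "x \<in> ?S" for x
    using that by blast
  have hol': "holomorphic_several (\<lambda>z. F (\<Phi> z)) (open_corner \<xi> \<rho>)"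
  proof (rule holomorphic_several_pullback[OF hol])
    show "\<Phi> z \<in> ball (\<Phi> \<xi>) r" if "z \<in> open_corner \<xi> \<rho>" for z
      using sub[OF subsetD[OF open_corner_subset that]] by blast
  qed
  have bound: "norm (F (\<Phi> z)) \<le> M" if "z \<in> corner \<xi> \<rho>" for z
    using M[of "\<Phi> z"] sub[OF that] by simp
  have slice: "slicewise_holomorphic (\<lambda>z. F (\<Phi> z)) \<xi> \<rho>"
  proof (rule slicewise_holomorphicI[OF _ hol' bound])
    fix z j assume z: "z \<in> corner \<xi> \<rho>"
    have eq: "\<Phi> (replace_coord j w z) = replace_coord j (\<phi> j w) (\<Phi> z)" for w
      by (simp add: map_product_def vec_eq_iff)
    have "continuous_on {w. replace_coord j w (\<Phi> z) \<in> ?S} (\<lambda>w. F (replace_coord j w (\<Phi> z)))"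
      using sep unfolding separately_continuous_on_def by (elim allE)
    moreover have "continuous_on (cball 0 1 \<inter> ball (\<xi> $ j) \<rho>) (\<phi> j)"
      by (rule continuous_on_subset[OF homeomorphism_cont1[OF coordinate_homeomorphism]]) blast
    moreover have "\<phi> j ` (cball 0 1 \<inter> ball (\<xi> $ j) \<rho>) \<subseteq> {w. replace_coord j w (\<Phi> z) \<in> ?S}"
    proof (intro image_subsetI CollectI UnI1)
      fix w assume "w \<in> cball 0 1 \<inter> ball (\<xi> $ j) \<rho>"
      from sub[OF replace_coord_in_corner[OF z this]]
      show "replace_coord j (\<phi> j w) (\<Phi> z) \<in> ball (\<Phi> \<xi>) r \<inter> closure V"
        unfolding eq .
    qed
    ultimately have "continuous_on (cball 0 1 \<inter> ball (\<xi> $ j) \<rho>) (\<lambda>w. F (replace_coord j (\<phi> j w) (\<Phi> z)))"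
      by (rule continuous_on_compose2)
    then show "continuous_on (cball 0 1 \<inter> ball (\<xi> $ j) \<rho>) (\<lambda>w. F (\<Phi> (replace_coord j w z)))"
      unfolding eq .
  qed
  obtain H' where "extends_into_corner (f \<circ> \<Phi>) \<xi> ((\<rho> / 2)\<^sup>2 / 8) M H'"
  proof (rule extends_into_corner_of_slicewise[OF \<xi> \<rho> hol' slice])
    show "norm (F (\<Phi> z)) \<le> M" if "z \<in> corner \<xi> \<rho>" for z
      by (rule bound[OF that])
    show "F (\<Phi> z) = (f \<circ> \<Phi>) z" if "z \<in> torus \<inter> corner \<xi> \<rho>" for z
      using F that by simp
    show "continuous_on torus (f \<circ> \<Phi>)"
      by (rule Cp_space_continuous(1)[OF f])
  qed
  moreover have "0 < (\<rho> / 2)\<^sup>2 / 8 \<and> (\<rho> / 2)\<^sup>2 / 8 \<le> 1"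
    using shrunk_radius[of "\<rho> / 2"] \<rho> by linarith
  ultimately show "corner_extendable f \<xi>"
    unfolding corner_extendable_def by blast
qed

lemma corner_extension_of_continuous_extension:
  assumes \<xi>: "\<xi> \<in> torus" and \<rho>: "0 < \<rho>" "\<rho> \<le> 1" and sub: "\<And>z. z \<in> corner \<xi> \<rho> \<Longrightarrow> \<Phi> z \<in> ball (\<Phi> \<xi>) r"
    and cont: "continuous_on ((ball (\<Phi> \<xi>) r \<inter> V) \<union> K) F"
    and hol: "holomorphic_several F (ball (\<Phi> \<xi>) r \<inter> V)" and F: "\<And>x. x \<in> K \<Longrightarrow> F x = f x"
    and bound: "\<And>x. x \<in> ball (\<Phi> \<xi>) r \<inter> V \<Longrightarrow> norm (F x) \<le> M"
  shows "\<exists>H. extends_into_corner (f \<circ> \<Phi>) \<xi> ((\<rho> / 2)\<^sup>2 / 8) M H \<and>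
    (\<forall>z\<in>open_corner \<xi> ((\<rho> / 2)\<^sup>2 / 8). H z = F (\<Phi> z))"
proof (rule extends_into_corner_of_continuous[OF \<xi> \<rho>])
  have sub': "\<Phi> z \<in> ball (\<Phi> \<xi>) r \<inter> V" if "z \<in> open_corner \<xi> \<rho>" for z
    using sub open_corner_subset Phi_open_corner that by blast
  show "holomorphic_several (\<lambda>z. F (\<Phi> z)) (open_corner \<xi> \<rho>)"
    using sub' by (intro holomorphic_several_pullback[OF hol]) blast
  show "continuous_on (open_corner \<xi> \<rho> \<union> (torus \<inter> corner \<xi> \<rho>)) (\<lambda>z. F (\<Phi> z))"
  proof (rule continuous_on_compose2[OF cont])
    show "continuous_on (open_corner \<xi> \<rho> \<union> (torus \<inter> corner \<xi> \<rho>)) \<Phi>"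
      by (rule continuous_on_subset[OF Phi_continuous])
        (use open_corner_subset corner_subset in blast)
    show "\<Phi> ` (open_corner \<xi> \<rho> \<union> (torus \<inter> corner \<xi> \<rho>)) \<subseteq> (ball (\<Phi> \<xi>) r \<inter> V) \<union> K"
      using sub' by blast
  qed
  show "norm (F (\<Phi> z)) \<le> M" if "z \<in> open_corner \<xi> \<rho>" for z
    using bound sub'[OF that] .
  show "F (\<Phi> z) = (f \<circ> \<Phi>) z" if "z \<in> torus \<inter> corner \<xi> \<rho>" for z
    using F that by auto
qed blast

text \<open>Continuity at \<open>\<Phi> \<xi>\<close> provides the bound on \<open>F\<close> near this point.\<close>

lemma extendable_iff:
  assumes \<xi>: "\<xi> \<in> torus" and f: "f \<in> Cp_space p \<Phi>"
  shows "extendable_at V K f (\<Phi> \<xi>) \<longleftrightarrow> corner_extendable f \<xi>"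
proof
  assume "corner_extendable f \<xi>"
  then obtain \<rho> M H where "0 < \<rho>" "extends_into_corner (f \<circ> \<Phi>) \<xi> \<rho> M H"
    unfolding corner_extendable_def by blast
  then obtain r F where F: "r > 0" "continuous_on ((ball (\<Phi> \<xi>) r \<inter> closure V) \<union> K) F"
    "bounded (F ` ((ball (\<Phi> \<xi>) r \<inter> closure V) \<union> K))"
    "holomorphic_several F (ball (\<Phi> \<xi>) r \<inter> V)" "\<forall>x\<in>K. F x = f x"
    by (rule continuous_extension_of_corner_extension[OF \<xi> _ f])
  have "continuous_on ((ball (\<Phi> \<xi>) r \<inter> V) \<union> K) F"
    by (rule continuous_on_subset[OF F(2)]) (use closure_subset in blast)
  then show "extendable_at V K f (\<Phi> \<xi>)"
    unfolding extendable_at_def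
    by (intro exI[of _ r] exI[of _ F] conjI) (use F in simp_all)
next
  assume "extendable_at V K f (\<Phi> \<xi>)"
  then obtain r F where r: "r > 0" and cont: "continuous_on ((ball (\<Phi> \<xi>) r \<inter> V) \<union> K) F"
    and hol: "holomorphic_several F (ball (\<Phi> \<xi>) r \<inter> V)" and F: "\<And>x. x \<in> K \<Longrightarrow> F x = f x"
    unfolding extendable_at_def by blast
  have "\<Phi> \<xi> \<in> (ball (\<Phi> \<xi>) r \<inter> V) \<union> K" using \<xi> by blast
  then obtain d where d: "d > 0" "\<And>x. x \<in> (ball (\<Phi> \<xi>) r \<inter> V) \<union> K \<Longrightarrow> dist x (\<Phi> \<xi>) < d \<Longrightarrow> dist (F x) (F (\<Phi> \<xi>)) < 1"
    using cont unfolding continuous_on_iff by (metis zero_less_one)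
  define r' where "r' = min r d"
  have r': "r' > 0" "ball (\<Phi> \<xi>) r' \<subseteq> ball (\<Phi> \<xi>) r"
    using r d(1) by (auto simp: r'_def)
  obtain \<rho> where \<rho>: "0 < \<rho>" "\<rho> \<le> 1" and sub: "\<And>z. z \<in> corner \<xi> \<rho> \<Longrightarrow> \<Phi> z \<in> ball (\<Phi> \<xi>) r' \<inter> closure V"
    by (rule Phi_corner_in_ball[OF \<xi> r'(1)]) blast
  have bound: "norm (F x) \<le> norm (F (\<Phi> \<xi>)) + 1" if x: "x \<in> ball (\<Phi> \<xi>) r' \<inter> V" for x
  proof -
    have "dist (F x) (F (\<Phi> \<xi>)) < 1"
      using x r'(2) by (intro d(2)) (auto simp: r'_def dist_commute)
    then show ?thesis
      using norm_triangle_sub[of "F x" "F (\<Phi> \<xi>)"] by (simp add: dist_norm)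
  qed
  have "continuous_on ((ball (\<Phi> \<xi>) r' \<inter> V) \<union> K) F"
    by (rule continuous_on_subset[OF cont]) (use r'(2) in blast)
  moreover have "holomorphic_several F (ball (\<Phi> \<xi>) r' \<inter> V)"
    by (rule holomorphic_several_subset[OF hol]) (use r'(2) in blast)
  moreover have "\<Phi> z \<in> ball (\<Phi> \<xi>) r'" if "z \<in> corner \<xi> \<rho>" for z
    using sub[OF that] by blast
  ultimately have "\<exists>H. extends_into_corner (f \<circ> \<Phi>) \<xi> ((\<rho> / 2)\<^sup>2 / 8) (norm (F (\<Phi> \<xi>)) + 1) H \<and>
      (\<forall>z\<in>open_corner \<xi> ((\<rho> / 2)\<^sup>2 / 8). H z = F (\<Phi> z))"
    by (intro corner_extension_of_continuous_extension[OF \<xi> \<rho>] F bound)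
  then obtain H where "extends_into_corner (f \<circ> \<Phi>) \<xi> ((\<rho> / 2)\<^sup>2 / 8) (norm (F (\<Phi> \<xi>)) + 1) H"
    by blast
  moreover have "0 < (\<rho> / 2)\<^sup>2 / 8 \<and> (\<rho> / 2)\<^sup>2 / 8 \<le> 1"
    using shrunk_radius[of "\<rho> / 2"] \<rho> by linarith
  ultimately show "corner_extendable f \<xi>"
    unfolding corner_extendable_def by blast
qed

subsection \<open>The category argument\<close>

lemma extends_into_corner_mono:
  assumes "extends_into_corner g \<xi> \<rho> M H" "corner \<xi>' \<rho>' \<subseteq> corner \<xi> \<rho>" "M \<le> M'"
  shows "extends_into_corner g \<xi>' \<rho>' M' (H :: complex^'n \<Rightarrow> complex)"
proof -
  have "open_corner \<xi>' \<rho>' \<subseteq> open_corner \<xi> \<rho>"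
  proof
    fix z assume z: "z \<in> open_corner \<xi>' \<rho>'"
    then have "z \<in> corner \<xi> \<rho>"
      using open_corner_subset assms(2) by blast
    then show "z \<in> open_corner \<xi> \<rho>"
      using z by (simp add: corner_iff open_corner_iff)
  qed
  moreover have "norm (H z) \<le> M'" if "z \<in> corner \<xi>' \<rho>'" for z
  proof -
    have "norm (H z) \<le> M"
      using assms(1) subsetD[OF assms(2) that] unfolding extends_into_corner_def by blast
    then show ?thesis using assms(3) by linarith
  qed
  moreover have "continuous_on (corner \<xi>' \<rho>') H"
    using assms(1) continuous_on_subset[OF _ assms(2)] unfolding extends_into_corner_def by blast
  moreover have "H z = g z" if "z \<in> torus \<inter> corner \<xi>' \<rho>'" for z
    using assms(1,2) that unfolding extends_into_corner_def by blast
  ultimately show ?thesis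
    using assms(1) holomorphic_several_subset[of H "open_corner \<xi> \<rho>" "open_corner \<xi>' \<rho>'"]
    unfolding extends_into_corner_def by simp
qed

text \<open>The sets \<open>E \<xi> k m\<close> stand for the functions in \<open>A\<close> that have an extension at \<open>\<xi>\<close> of size \<open>1 / (k + 1)\<close> with bound
  or Lipschitz constant \<open>m\<close>. They need not be closed, but their closures must not leave \<open>A\<close>. The closures have empty
  interior: if \<open>f\<close> and \<open>f + t h\<close> extend to the same corner, then so does \<open>t h\<close>, which is impossible if \<open>h\<close>
  vanishes exactly on one side of \<open>\<xi>\<close>.\<close>

lemma dense_gdelta_of_nonextendable:
  fixes E :: "complex^'n \<Rightarrow> nat \<Rightarrow> nat \<Rightarrow> (complex^'n \<Rightarrow> complex) set"
  assumes T: "countable T" "T \<subseteq> torus"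
    and sub: "\<And>\<xi> k m. E \<xi> k m \<subseteq> Cp_space p \<Phi>"
    and cover: "\<And>f. f \<in> A \<Longrightarrow> \<exists>\<xi>\<in>T. \<exists>k m. f \<in> E \<xi> k m"
    and closure: "\<And>\<xi> k m. \<xi> \<in> T \<Longrightarrow> \<exists>\<rho>. 0 < \<rho> \<and> \<rho> \<le> 1 \<and>
      (\<forall>f\<in>Cp_topology p \<Phi> closure_of (E \<xi> k m). f \<in> A \<and> (\<exists>M H. extends_into_corner (f \<circ> \<Phi>) \<xi> \<rho> M H))"
  shows "dense_gdelta_in (Cp_topology p \<Phi>) (Cp_space p \<Phi> - A)"
proof (rule dense_gdelta_complement)
  define \<E> where "\<E> = (\<lambda>(\<xi>, k, m). E \<xi> k m) ` (T \<times> (UNIV :: nat set) \<times> (UNIV :: nat set))"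
  show inj: "inj_on \<Phi> torus"
    by (rule inj_on_subset[OF Phi_inj torus_subset])
  show "countable \<E>"
    unfolding \<E>_def using T(1) by (intro countable_image countable_SIGMA) auto
  have memE: "\<exists>\<xi>\<in>T. \<exists>k m. F = E \<xi> k m" if "F \<in> \<E>" for F
    using that unfolding \<E>_def by (elim imageE SigmaE) auto
  have closure_A: "Cp_topology p \<Phi> closure_of F \<subseteq> A" if F: "F \<in> \<E>" for F
  proof -
    obtain \<xi> k m where \<xi>: "\<xi> \<in> T" "F = E \<xi> k m"
      using memE[OF F] by (elim bexE exE)
    show ?thesis
      unfolding \<xi>(2) using closure[OF \<xi>(1), of k m] by (elim exE conjE) (rule subsetI, simp)
  qed
  show "Cp_topology p \<Phi> closure_of F \<subseteq> A" if "F \<in> \<E>" for F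
    by (rule closure_A[OF that])
  show "A = \<Union>\<E>"
  proof (intro equalityI subsetI)
    fix f assume "f \<in> A"
    from cover[OF this] obtain \<xi> k m where f: "\<xi> \<in> T" "f \<in> E \<xi> k m"
      by (elim bexE exE)
    have "E \<xi> k m \<in> \<E>"
      unfolding \<E>_def using f(1) by (intro image_eqI[of _ _ "(\<xi>, k, m)"]) simp_all
    then show "f \<in> \<Union>\<E>"
      using f(2) by (rule UnionI)
  next
    fix f assume "f \<in> \<Union>\<E>"
    then obtain F where F: "F \<in> \<E>" "f \<in> F" by blast
    obtain \<xi> k m where "F = E \<xi> k m"
      using memE[OF F(1)] by (elim bexE exE)
    then have "F \<subseteq> topspace (Cp_topology p \<Phi>)"
      using sub[of \<xi> k m] by (simp add: topspace_Cp_topology)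
    from closure_of_subset[OF this] show "f \<in> A"
      using closure_A[OF F(1)] F(2) by blast
  qed
  fix F assume "F \<in> \<E>"
  from memE[OF this] obtain \<xi> k m where F: "\<xi> \<in> T" "F = E \<xi> k m"
    by (elim bexE exE)
  then have \<xi>: "\<xi> \<in> torus" using T(2) by blast
  obtain \<rho> where \<rho>: "0 < \<rho>" "\<rho> \<le> 1"
    and ext': "\<forall>f\<in>Cp_topology p \<Phi> closure_of F. f \<in> A \<and> (\<exists>M H. extends_into_corner (f \<circ> \<Phi>) \<xi> \<rho> M H)"
    using closure[OF F(1), of k m] unfolding F(2) by (elim exE conjE)
  have ext: "\<exists>M H. extends_into_corner (f \<circ> \<Phi>) \<xi> \<rho> M H" if "f \<in> Cp_topology p \<Phi> closure_of F" for f
    using ext' that by blast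
  \<comment> \<open>any coordinate will do\<close>
  obtain j :: 'n where True by blast
  obtain h where h: "h \<in> Cp_space p \<Phi>" "\<And>z. z \<in> torus \<Longrightarrow> h (\<Phi> z) = of_real (flat_exp 0 (Im (cnj (\<xi> $ j) * z $ j)))"
    by (rule Cp_space_representative[OF Cp_torus_flat inj]) blast
  have "\<exists>z\<in>torus. g (\<Phi> z) \<noteq> f (\<Phi> z) + complex_of_real t * h (\<Phi> z)"
    if f: "f \<in> Cp_topology p \<Phi> closure_of F" and g: "g \<in> Cp_topology p \<Phi> closure_of F" and t: "t \<noteq> 0" for f g t
  proof (rule ccontr)
    assume "\<not> ?thesis"
    then have eq: "g (\<Phi> z) - f (\<Phi> z) = complex_of_real (t * flat_exp 0 (Im (cnj (\<xi> $ j) * z $ j)))" if "z \<in> torus" for z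
      using h(2)[OF that] that by auto
    obtain M H M' H' where "extends_into_corner (f \<circ> \<Phi>) \<xi> \<rho> M H" "extends_into_corner (g \<circ> \<Phi>) \<xi> \<rho> M' H'"
      using ext[OF f] ext[OF g] by blast
    from extends_into_corner_diff[OF this(2,1)]
    have "extends_into_corner (\<lambda>z. of_real (t * flat_exp 0 (Im (cnj (\<xi> $ j) * z $ j)))) \<xi> \<rho> (M' + M) (\<lambda>z. H' z - H z)"
      using eq unfolding extends_into_corner_def by simp
    moreover have "\<not> extends_into_corner (\<lambda>z. of_real (t * flat_exp 0 (Im (cnj (\<xi> $ j) * z $ j)))) \<xi> \<rho> (M' + M) (\<lambda>z. H' z - H z)"
      using t by (intro one_sided_not_extendable[OF _ _ \<xi> \<rho>]) (simp_all add: flat_exp_def)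
    ultimately show False by blast
  qed
  then show "\<exists>h\<in>Cp_space p \<Phi>. \<forall>f\<in>Cp_topology p \<Phi> closure_of F. \<forall>g\<in>Cp_topology p \<Phi> closure_of F.
      \<forall>t. t \<noteq> 0 \<longrightarrow> (\<exists>z\<in>torus. g (\<Phi> z) \<noteq> f (\<Phi> z) + complex_of_real t * h (\<Phi> z))"
    using h(1) by blast
qed

lemma closure_of_sequence:
  assumes "f \<in> Cp_topology p \<Phi> closure_of E"
  obtains g where "\<And>m. g m \<in> E" "uniform_limit torus (\<lambda>m. g m \<circ> \<Phi>) (f \<circ> \<Phi>) sequentially"
proof -
  have "\<exists>g\<in>E. \<forall>z\<in>torus. norm (g (\<Phi> z) - f (\<Phi> z)) < inverse (real (Suc m))" for m
  proof -
    have "inverse (real (Suc m)) > 0" by simp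
    from Cp_closure_approximation[OF assms this] show ?thesis by metis
  qed
  then obtain g where g: "\<And>m. g m \<in> E" "\<And>m z. z \<in> torus \<Longrightarrow> norm (g m (\<Phi> z) - f (\<Phi> z)) < inverse (real (Suc m))"
    by metis
  have "uniform_limit torus (\<lambda>m. g m \<circ> \<Phi>) (f \<circ> \<Phi>) sequentially"
  proof (rule uniform_limitI)
    fix e :: real assume "e > 0"
    then have "\<forall>\<^sub>F m in sequentially. inverse (real (Suc m)) < e"
      using order_tendstoD(2)[OF LIMSEQ_inverse_real_of_nat] by blast
    then show "\<forall>\<^sub>F m in sequentially. \<forall>z\<in>torus. dist ((g m \<circ> \<Phi>) z) ((f \<circ> \<Phi>) z) < e"
    proof eventually_elim
      case (elim m)
      then show ?case
        using g(2)[of _ m] by (auto simp: dist_norm intro: less_trans)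
    qed
  qed
  then show thesis using that g(1) by blast
qed

lemma dense_gdelta_not_corner_extendable:
  "dense_gdelta_in (Cp_topology p \<Phi>) {f \<in> Cp_space p \<Phi>. \<forall>\<xi>\<in>torus. \<not> corner_extendable f \<xi>}"
proof -
  obtain T where T: "countable T" "T \<subseteq> torus" "(torus :: (complex^'n) set) \<subseteq> closure T"
    by (rule separable)
  define A where "A = {f \<in> Cp_space p \<Phi>. \<exists>\<xi>\<in>torus. corner_extendable f \<xi>}"
  define E where "E = (\<lambda>\<xi> k m. {f \<in> Cp_space p \<Phi>. \<exists>H. extends_into_corner (f \<circ> \<Phi>) \<xi> (inverse (real (Suc k))) (real m) H})"
  have radius: "0 < inverse (real (Suc k))" "inverse (real (Suc k)) \<le> 1" for k
    by (simp_all add: inverse_le_1_iff)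
  have "dense_gdelta_in (Cp_topology p \<Phi>) (Cp_space p \<Phi> - A)"
  proof (rule dense_gdelta_of_nonextendable[OF T(1,2)])
    show "E \<xi> k m \<subseteq> Cp_space p \<Phi>" for \<xi> k m
      by (auto simp: E_def)
  next
    fix \<xi> k m assume \<xi>: "\<xi> \<in> T"
    have "f \<in> A \<and> (\<exists>M H. extends_into_corner (f \<circ> \<Phi>) \<xi> ((inverse (real (Suc k)))\<^sup>2 / 8) M H)"
      if f: "f \<in> Cp_topology p \<Phi> closure_of (E \<xi> k m)" for f
    proof -
      obtain g where g: "\<And>i. g i \<in> E \<xi> k m" "uniform_limit torus (\<lambda>i. g i \<circ> \<Phi>) (f \<circ> \<Phi>) sequentially"
        by (rule closure_of_sequence[OF f]) blast
      have "\<forall>i. \<exists>H. extends_into_corner (g i \<circ> \<Phi>) \<xi> (inverse (real (Suc k))) (real m) H"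
        using g(1) by (auto simp: E_def)
      then obtain H where "\<And>i. extends_into_corner (g i \<circ> \<Phi>) \<xi> (inverse (real (Suc k))) (real m) (H i)"
        by metis
      from extends_into_corner_limit[OF subsetD[OF T(2) \<xi>] radius this uniform_limit_on_subset[OF g(2) Int_lower1]]
      obtain H' where ext: "extends_into_corner (f \<circ> \<Phi>) \<xi> ((inverse (real (Suc k)))\<^sup>2 / 8) (real m) H'"
        by blast
      have "0 < (inverse (real (Suc k)))\<^sup>2 / 8 \<and> (inverse (real (Suc k)))\<^sup>2 / 8 \<le> 1"
        using shrunk_radius[OF radius, of k] radius(2)[of k] by linarith
      then have "corner_extendable f \<xi>"
        using ext unfolding corner_extendable_def by blast
      moreover have "f \<in> Cp_space p \<Phi>"
        using f by (metis closure_of_subset_topspace subsetD topspace_Cp_topology)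
      ultimately show ?thesis
        using ext \<xi> T(2) by (auto simp: A_def)
    qed
    moreover have "0 < (inverse (real (Suc k)))\<^sup>2 / 8" "(inverse (real (Suc k)))\<^sup>2 / 8 \<le> 1"
      using shrunk_radius[OF radius, of k] radius(2)[of k] by linarith+
    ultimately show "\<exists>\<rho>. 0 < \<rho> \<and> \<rho> \<le> 1 \<and> (\<forall>f\<in>Cp_topology p \<Phi> closure_of (E \<xi> k m).
        f \<in> A \<and> (\<exists>M H. extends_into_corner (f \<circ> \<Phi>) \<xi> \<rho> M H))"
      by blast
  next
    fix f assume "f \<in> A"
    then obtain \<xi> \<rho> M H where f: "f \<in> Cp_space p \<Phi>" and \<xi>: "\<xi> \<in> torus" and \<rho>: "0 < \<rho>" "\<rho> \<le> 1"
      and ext: "extends_into_corner (f \<circ> \<Phi>) \<xi> \<rho> M H"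
      unfolding A_def corner_extendable_def by blast
    obtain \<xi>' where \<xi>': "\<xi>' \<in> T" "dist \<xi>' \<xi> < \<rho> / 2"
      using T(3) \<xi> \<rho>(1) closure_approachable[of \<xi> T] by (metis half_gt_zero subsetD)
    obtain k where k: "inverse (real (Suc k)) < \<rho> / 2"
      using reals_Archimedean[of "\<rho> / 2"] \<rho>(1) by auto
    obtain m where m: "M \<le> real m"
      using real_arch_simple by blast
    have "corner \<xi>' (inverse (real (Suc k))) \<subseteq> corner \<xi> \<rho>"
    proof
      fix z assume z: "z \<in> corner \<xi>' (inverse (real (Suc k)))"
      have "dist (\<xi> $ i) (z $ i) < \<rho>" for i
      proof -
        have "dist (\<xi>' $ i) (z $ i) < inverse (real (Suc k))"
          using z unfolding corner_iff by blast
        then have "dist (\<xi>' $ i) (z $ i) < \<rho> / 2"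
          using k by linarith
        moreover have "dist (\<xi>' $ i) (\<xi> $ i) < \<rho> / 2"
          using dist_vec_nth_le[of \<xi>' i \<xi>] \<xi>'(2) by linarith
        ultimately show ?thesis
          using dist_triangle3[of "\<xi> $ i" "z $ i" "\<xi>' $ i"] by linarith
      qed
      then show "z \<in> corner \<xi> \<rho>"
        using z by (simp add: corner_iff)
    qed
    from extends_into_corner_mono[OF ext this m] have "f \<in> E \<xi>' k m"
      using f by (auto simp: E_def)
    then show "\<exists>\<xi>\<in>T. \<exists>k m. f \<in> E \<xi> k m"
      using \<xi>'(1) by blast
  qed
  moreover have "Cp_space p \<Phi> - A = {f \<in> Cp_space p \<Phi>. \<forall>\<xi>\<in>torus. \<not> corner_extendable f \<xi>}"
    unfolding A_def by blast
  ultimately show ?thesis by simp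
qed

text \<open>Lipschitz continuity with a fixed constant passes to pointwise limits. The extensions of a sequence that converges
  on \<open>K\<close> converge in the interior because a Lipschitz constant and the values on \<open>K\<close> bound them uniformly, so that
  \<open>extends_into_corner_limit\<close> applies.\<close>

lemma lipschitz_extension_limit:
  assumes \<xi>: "\<xi> \<in> torus" and r: "r > 0" and L: "L \<ge> 0"
  shows "\<exists>\<rho>. 0 < \<rho> \<and> \<rho> \<le> 1 \<and>
    (\<forall>f\<in>Cp_topology p \<Phi> closure_of {f \<in> Cp_space p \<Phi>. \<exists>F. L-lipschitz_on ((ball (\<Phi> \<xi>) r \<inter> V) \<union> K) F \<and>
        holomorphic_several F (ball (\<Phi> \<xi>) r \<inter> V) \<and> (\<forall>x\<in>K. F x = f x)}.
      lipschitz_extendable_at V K f (\<Phi> \<xi>) \<and> (\<exists>M H. extends_into_corner (f \<circ> \<Phi>) \<xi> \<rho> M H))"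
proof -
  let ?\<zeta> = "\<Phi> \<xi>"
  obtain \<rho>0 where \<rho>0: "0 < \<rho>0" "\<rho>0 \<le> 1" and sub: "\<And>z. z \<in> corner \<xi> \<rho>0 \<Longrightarrow> \<Phi> z \<in> ball ?\<zeta> r \<inter> closure V"
    by (rule Phi_corner_in_ball[OF \<xi> r]) blast
  define \<sigma> where "\<sigma> = (\<rho>0 / 2)\<^sup>2 / 8"
  have \<sigma>: "0 < \<sigma>" "\<sigma> \<le> 1"
    unfolding \<sigma>_def using shrunk_radius[of "\<rho>0 / 2"] \<rho>0 by linarith+
  define \<rho> where "\<rho> = \<sigma>\<^sup>2 / 8"
  have \<rho>: "0 < \<rho>" "\<rho> \<le> \<sigma>" "\<rho> \<le> 1"
    unfolding \<rho>_def using shrunk_radius[OF \<sigma>] \<sigma> by linarith+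
  obtain r0 where r0: "r0 > 0" "\<And>x. x \<in> ball ?\<zeta> r0 \<inter> V \<Longrightarrow> \<Psi> x \<in> open_corner \<xi> \<rho>"
    using Psi_ball_in_corner[OF \<xi> \<rho>(1)] by metis
  define r' where "r' = min r r0"
  have r': "r' > 0" "ball ?\<zeta> r' \<subseteq> ball ?\<zeta> r" "\<And>x. x \<in> ball ?\<zeta> r' \<inter> V \<Longrightarrow> \<Psi> x \<in> open_corner \<xi> \<rho>"
    using r r0 by (auto simp: r'_def)
  have \<zeta>K: "?\<zeta> \<in> K" using \<xi> by blast
  have "lipschitz_extendable_at V K f ?\<zeta> \<and> (\<exists>M H. extends_into_corner (f \<circ> \<Phi>) \<xi> \<rho> M H)"
    if f: "f \<in> Cp_topology p \<Phi> closure_of {f \<in> Cp_space p \<Phi>. \<exists>F. L-lipschitz_on ((ball ?\<zeta> r \<inter> V) \<union> K) F \<and>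
        holomorphic_several F (ball ?\<zeta> r \<inter> V) \<and> (\<forall>x\<in>K. F x = f x)}" (is "f \<in> _ closure_of ?E") for f
  proof -
    obtain g0 where g0: "\<And>m. g0 m \<in> ?E" "uniform_limit torus (\<lambda>m. g0 m \<circ> \<Phi>) (f \<circ> \<Phi>) sequentially"
      by (rule closure_of_sequence[OF f]) blast
    have "\<forall>\<^sub>F m in sequentially. \<forall>z\<in>torus. dist ((g0 m \<circ> \<Phi>) z) ((f \<circ> \<Phi>) z) < 1"
      using uniform_limitD[OF g0(2), of 1] by simp
    then obtain N where N: "\<And>m. m \<ge> N \<Longrightarrow> dist (g0 m ?\<zeta>) (f ?\<zeta>) < 1"
      using \<xi> unfolding eventually_sequentially by auto
    \<comment> \<open>discarding finitely many terms gives one bound \<open>M\<close> for all extensions\<close>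
    define g where "g = (\<lambda>m. g0 (m + N))"
    have g: "\<And>m. g m \<in> ?E" "uniform_limit torus (\<lambda>m. g m \<circ> \<Phi>) (f \<circ> \<Phi>) sequentially"
      "\<And>m. dist (g m ?\<zeta>) (f ?\<zeta>) < 1"
    proof -
      show "g m \<in> ?E" for m unfolding g_def by (rule g0(1))
      show "dist (g m ?\<zeta>) (f ?\<zeta>) < 1" for m unfolding g_def by (rule N) simp
      show "uniform_limit torus (\<lambda>m. g m \<circ> \<Phi>) (f \<circ> \<Phi>) sequentially"
        unfolding g_def
        by (rule filterlim_compose[OF g0(2) filterlim_add_const_nat_at_top])
    qed
    have "\<forall>m. \<exists>F. L-lipschitz_on ((ball ?\<zeta> r \<inter> V) \<union> K) F \<and>
        holomorphic_several F (ball ?\<zeta> r \<inter> V) \<and> (\<forall>x\<in>K. F x = g m x)"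
      using g(1) by blast
    then obtain F where lip: "\<And>m. L-lipschitz_on ((ball ?\<zeta> r \<inter> V) \<union> K) (F m)"
      and hol: "\<And>m. holomorphic_several (F m) (ball ?\<zeta> r \<inter> V)" and F_K: "\<And>m x. x \<in> K \<Longrightarrow> F m x = g m x"
      by metis
    define M where "M = norm (f ?\<zeta>) + 1 + L * r"
    have bound: "norm (F m x) \<le> M" if x: "x \<in> ball ?\<zeta> r \<inter> V" for m x
    proof -
      have "dist (F m x) (F m ?\<zeta>) \<le> L * dist x ?\<zeta>"
        using x \<zeta>K by (intro lipschitz_onD[OF lip]) auto
      also have "\<dots> \<le> L * r"
        using x L by (intro mult_left_mono) (auto simp: dist_commute)
      finally have "dist (F m x) (g m ?\<zeta>) \<le> L * r"
        using F_K[OF \<zeta>K] by simp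
      then have "dist (F m x) (f ?\<zeta>) \<le> L * r + 1"
        using g(3)[of m] dist_triangle[of "F m x" "f ?\<zeta>" "g m ?\<zeta>"] by linarith
      then show ?thesis
        using norm_triangle_sub[of "F m x" "f ?\<zeta>"] by (simp add: dist_norm M_def)
    qed
    have "\<exists>H. extends_into_corner (g m \<circ> \<Phi>) \<xi> \<sigma> M H \<and> (\<forall>z\<in>open_corner \<xi> \<sigma>. H z = F m (\<Phi> z))" for m
    proof -
      have in_ball: "\<Phi> z \<in> ball ?\<zeta> r" if "z \<in> corner \<xi> \<rho>0" for z
        using sub[OF that] by blast
      show ?thesis
        unfolding \<sigma>_def
      proof (rule corner_extension_of_continuous_extension[OF \<xi> \<rho>0 in_ball])
        show "continuous_on ((ball ?\<zeta> r \<inter> V) \<union> K) (F m)"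
          by (rule lipschitz_on_continuous_on[OF lip])
        show "holomorphic_several (F m) (ball ?\<zeta> r \<inter> V)"
          by (rule hol)
      qed (use F_K bound in auto)
    qed
    then obtain H where H: "\<And>m. extends_into_corner (g m \<circ> \<Phi>) \<xi> \<sigma> M (H m)"
      "\<And>m z. z \<in> open_corner \<xi> \<sigma> \<Longrightarrow> H m z = F m (\<Phi> z)"
      by metis
    obtain H' where H': "extends_into_corner (f \<circ> \<Phi>) \<xi> \<rho> M H'" "uniform_limit (corner \<xi> \<rho>) H H' sequentially"
      unfolding \<rho>_def
      by (rule extends_into_corner_limit[OF \<xi> \<sigma> H(1) uniform_limit_on_subset[OF g(2) Int_lower1]])
    define F' where "F' = (\<lambda>x. if x \<in> V then H' (\<Psi> x) else f x)"
    have F'_K: "F' x = f x" if "x \<in> K" for x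
      using that V_K_disjoint by (auto simp: F'_def)
    have lim: "(\<lambda>m. F m x) \<longlonglongrightarrow> F' x" if x: "x \<in> (ball ?\<zeta> r' \<inter> V) \<union> K" for x
    proof (cases "x \<in> K")
      case True
      then obtain z where z: "z \<in> torus" "x = \<Phi> z" by blast
      from tendsto_uniform_limitI[OF g(2) z(1)] show ?thesis
        using F_K[OF True] F'_K[OF True] z(2) by simp
    next
      case False
      then have x': "x \<in> ball ?\<zeta> r' \<inter> V" using x by blast
      have \<Psi>x: "\<Psi> x \<in> open_corner \<xi> \<rho>" using r'(3)[OF x'] .
      have "\<Psi> x \<in> open_corner \<xi> \<sigma>" "\<Psi> x \<in> corner \<xi> \<rho>"
        using \<Psi>x open_corner_mono[OF \<rho>(2)] open_corner_subset by blast+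
      moreover have "\<Phi> (\<Psi> x) = x"
        using x' closure_subset by (intro Phi_Psi) blast
      ultimately show ?thesis
        using tendsto_uniform_limitI[OF H'(2)] H(2) x' by (force simp: F'_def)
    qed
    have "L-lipschitz_on ((ball ?\<zeta> r' \<inter> V) \<union> K) F'"
    proof (rule lipschitz_onI[OF _ L])
      fix x y assume xy: "x \<in> (ball ?\<zeta> r' \<inter> V) \<union> K" "y \<in> (ball ?\<zeta> r' \<inter> V) \<union> K"
      have "dist (F m x) (F m y) \<le> L * dist x y" for m
        using xy r'(2) by (intro lipschitz_onD[OF lip]) blast+
      then show "dist (F' x) (F' y) \<le> L * dist x y"
        by (intro LIMSEQ_le_const2[OF tendsto_dist[OF lim[OF xy(1)] lim[OF xy(2)]]]) blast
    qed
    moreover have "holomorphic_several F' (ball ?\<zeta> r' \<inter> V)"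
    proof -
      have "holomorphic_several (\<lambda>x. H' (\<Psi> x)) (ball ?\<zeta> r' \<inter> V)"
        using H'(1) r'(3) by (intro holomorphic_several_pushforward) (auto simp: extends_into_corner_def)
      moreover have "H' (\<Psi> x) = F' x" if "x \<in> ball ?\<zeta> r' \<inter> V" for x
        using that by (simp add: F'_def)
      ultimately show ?thesis
        using holomorphic_several_cong[of "ball ?\<zeta> r' \<inter> V" "\<lambda>x. H' (\<Psi> x)" F'] by blast
    qed
    ultimately have "lipschitz_extendable_at V K f ?\<zeta>"
      unfolding lipschitz_extendable_at_def using r'(1) F'_K by blast
    then show ?thesis using H'(1) by blast
  qed
  then show ?thesis
    using \<rho>(1,3) by (intro exI[of _ \<rho>]) blast
qed

lemma dense_gdelta_not_lipschitz_extendable: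
  "dense_gdelta_in (Cp_topology p \<Phi>) {f \<in> Cp_space p \<Phi>. \<forall>\<zeta>\<in>K. \<not> lipschitz_extendable_at V K f \<zeta>}"
proof -
  obtain T where T: "countable T" "T \<subseteq> torus" "(torus :: (complex^'n) set) \<subseteq> closure T"
    by (rule separable)
  define A where "A = {f \<in> Cp_space p \<Phi>. \<exists>\<zeta>\<in>K. lipschitz_extendable_at V K f \<zeta>}"
  define E where "E = (\<lambda>\<xi> k m. {f \<in> Cp_space p \<Phi>. \<exists>F.
      (real m)-lipschitz_on ((ball (\<Phi> \<xi>) (inverse (real (Suc k))) \<inter> V) \<union> K) F \<and>
      holomorphic_several F (ball (\<Phi> \<xi>) (inverse (real (Suc k))) \<inter> V) \<and> (\<forall>x\<in>K. F x = f x)})"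
  have "dense_gdelta_in (Cp_topology p \<Phi>) (Cp_space p \<Phi> - A)"
  proof (rule dense_gdelta_of_nonextendable[OF T(1,2)])
    show "E \<xi> k m \<subseteq> Cp_space p \<Phi>" for \<xi> k m
      by (auto simp: E_def)
  next
    fix \<xi> k m assume \<xi>: "\<xi> \<in> T"
    have "\<exists>\<rho>. 0 < \<rho> \<and> \<rho> \<le> 1 \<and> (\<forall>f\<in>Cp_topology p \<Phi> closure_of (E \<xi> k m).
        lipschitz_extendable_at V K f (\<Phi> \<xi>) \<and> (\<exists>M H. extends_into_corner (f \<circ> \<Phi>) \<xi> \<rho> M H))"
      unfolding E_def by (rule lipschitz_extension_limit) (use \<xi> T(2) in auto)
    moreover have "f \<in> Cp_space p \<Phi>" if "f \<in> Cp_topology p \<Phi> closure_of (E \<xi> k m)" for f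
      using that by (metis closure_of_subset_topspace subsetD topspace_Cp_topology)
    moreover have "\<Phi> \<xi> \<in> K"
      using \<xi> T(2) by blast
    ultimately show "\<exists>\<rho>. 0 < \<rho> \<and> \<rho> \<le> 1 \<and> (\<forall>f\<in>Cp_topology p \<Phi> closure_of (E \<xi> k m).
        f \<in> A \<and> (\<exists>M H. extends_into_corner (f \<circ> \<Phi>) \<xi> \<rho> M H))"
      unfolding A_def by blast
  next
    fix f assume "f \<in> A"
    then obtain \<xi> r F L where f: "f \<in> Cp_space p \<Phi>" and \<xi>: "\<xi> \<in> torus" and r: "r > 0"
      and F: "L-lipschitz_on ((ball (\<Phi> \<xi>) r \<inter> V) \<union> K) F" "holomorphic_several F (ball (\<Phi> \<xi>) r \<inter> V)"
        "\<forall>x\<in>K. F x = f x"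
      unfolding A_def lipschitz_extendable_at_def by (elim CollectE conjE bexE imageE exE) simp
    have "\<xi> \<in> closed_polydisc" using \<xi> torus_subset by blast
    then obtain d where d: "d > 0" "\<And>z. z \<in> closed_polydisc \<Longrightarrow> dist z \<xi> < d \<Longrightarrow> dist (\<Phi> z) (\<Phi> \<xi>) < r / 2"
      using Phi_continuous r unfolding continuous_on_iff by (metis half_gt_zero)
    obtain \<xi>' where \<xi>': "\<xi>' \<in> T" "dist \<xi>' \<xi> < d"
      using T(3) \<xi> d(1) closure_approachable[of \<xi> T] by blast
    then have near: "dist (\<Phi> \<xi>') (\<Phi> \<xi>) < r / 2"
      using T(2) torus_subset by (intro d(2)) auto
    obtain k where k: "inverse (real (Suc k)) < r / 2"
      using reals_Archimedean[of "r / 2"] r by auto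
    obtain m where m: "L \<le> real m"
      using real_arch_simple by blast
    have sub: "ball (\<Phi> \<xi>') (inverse (real (Suc k))) \<subseteq> ball (\<Phi> \<xi>) r"
    proof
      fix x assume "x \<in> ball (\<Phi> \<xi>') (inverse (real (Suc k)))"
      then have "dist (\<Phi> \<xi>') x < r / 2" using k by simp
      then show "x \<in> ball (\<Phi> \<xi>) r"
        using near dist_triangle3[of "\<Phi> \<xi>" x "\<Phi> \<xi>'"] by simp
    qed
    have "(real m)-lipschitz_on ((ball (\<Phi> \<xi>') (inverse (real (Suc k))) \<inter> V) \<union> K) F"
      by (rule lipschitz_on_mono[OF F(1) _ m]) (use sub in blast)
    moreover have "holomorphic_several F (ball (\<Phi> \<xi>') (inverse (real (Suc k))) \<inter> V)"
      by (rule holomorphic_several_subset[OF F(2)]) (use sub in blast)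
    ultimately have "f \<in> E \<xi>' k m"
      using f F(3) by (auto simp: E_def)
    then show "\<exists>\<xi>\<in>T. \<exists>k m. f \<in> E \<xi> k m"
      using \<xi>'(1) by blast
  qed
  moreover have "Cp_space p \<Phi> - A = {f \<in> Cp_space p \<Phi>. \<forall>\<zeta>\<in>K. \<not> lipschitz_extendable_at V K f \<zeta>}"
    unfolding A_def by blast
  ultimately show ?thesis by simp
qed

end

theorem theorem20:
  fixes \<Omega> :: "'n::finite \<Rightarrow> complex set"
    and \<phi> :: "'n \<Rightarrow> complex \<Rightarrow> complex"
    and p :: enat
  assumes "\<And>i. jordan_domain (\<Omega> i)"
    and "\<And>i. extended_riemann_map (\<phi> i) (\<Omega> i)"
    and "\<And>i. Cp_torus p (\<lambda>z :: complex^1. \<phi> i (z $ 1))"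
  shows
    "dense_gdelta_in (Cp_topology p (map_product \<phi>))
       {f \<in> Cp_space p (map_product \<phi>). \<forall>\<zeta> \<in> map_product \<phi> ` torus.
          \<not> separately_extendable_at (set_product \<Omega>) (map_product \<phi> ` torus) f \<zeta>} \<and>
     residual_in (Cp_topology p (map_product \<phi>))
       {f \<in> Cp_space p (map_product \<phi>). \<forall>\<zeta> \<in> map_product \<phi> ` torus.
          \<not> extendable_at (set_product \<Omega>) (map_product \<phi> ` torus) f \<zeta>} \<and>
     ((\<exists>L. L-lipschitz_on closed_polydisc (map_product \<phi>)) \<and>
      (\<exists>L. L-lipschitz_on (closure (set_product \<Omega>)) (inv_into closed_polydisc (map_product \<phi>)))
      \<longrightarrow> dense_gdelta_in (Cp_topology p (map_product \<phi>))
        {f \<in> Cp_space p (map_product \<phi>). \<forall>\<zeta> \<in> map_product \<phi> ` torus.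
           \<not> lipschitz_extendable_at (set_product \<Omega>) (map_product \<phi> ` torus) f \<zeta>})"
proof -
  interpret riemann_product \<Omega> \<phi>
    by unfold_locales (fact assms(2))
  have sep: "{f \<in> Cp_space p \<Phi>. \<forall>\<zeta>\<in>K. \<not> separately_extendable_at V K f \<zeta>} =
      {f \<in> Cp_space p \<Phi>. \<forall>\<xi>\<in>torus. \<not> corner_extendable f \<xi>}"
    using separately_extendable_iff by auto
  have ext: "{f \<in> Cp_space p \<Phi>. \<forall>\<zeta>\<in>K. \<not> extendable_at V K f \<zeta>} =
      {f \<in> Cp_space p \<Phi>. \<forall>\<xi>\<in>torus. \<not> corner_extendable f \<xi>}"
    using extendable_iff by auto
  have dense: "dense_gdelta_in (Cp_topology p \<Phi>) {f \<in> Cp_space p \<Phi>. \<forall>\<xi>\<in>torus. \<not> corner_extendable f \<xi>}"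
    by (rule dense_gdelta_not_corner_extendable)
  have "residual_in (Cp_topology p \<Phi>) {f \<in> Cp_space p \<Phi>. \<forall>\<zeta>\<in>K. \<not> extendable_at V K f \<zeta>}"
    unfolding residual_in_def ext using dense by (auto simp: topspace_Cp_topology)
  then show ?thesis
    using dense dense_gdelta_not_lipschitz_extendable[of p] unfolding sep by blast
qed

end
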